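(* Consider the IMEX Runge--Kutta time discretization of the scaled micro-macro BGK system whose internal stages, for $i=1,\dots,s$, are $$\rho^{(i)}=\rho^n-\frac{\Delta t}{\varepsilon}\sum_{j=1}^{i}a_{ij}\nabla_x\cdot u^{(j)},$$ $$u^{(i)}=u^n-\Delta t\sum_{j=1}^{i}\Big(a_{ij}\nabla_x\cdot\langle \mathcal A(v)g^{(j)}\rangle+\frac{a_{ij}}{\varepsilon}\nabla_x(T^{(j)}+\rho^{(j)})\Big),$$ $$T^{(i)}=T^n-\Delta t\sum_{j=1}^{i}\Big(\frac{a_{ij}}{d}\nabla_x\cdot\langle \mathcal B(v)g^{(j)}\rangle+\frac{2a_{ij}}{d\varepsilon}\nabla_x\cdot u^{(j)}\Big),$$ $$p^{(i)}=p^n-\Delta t\sum_{j=1}^{i}\Big(\frac{a_{ij}}{d}\nabla_x\cdot\langle \mathcal B(v)g^{(j)}\rangle+\frac{d+2}{d\varepsilon}a_{ij}\nabla_x\cdot u^{(j)}\Big),$$ $$g^{(i)}=g^n-\frac{\Delta t}{\varepsilon^2}\sum_{j=1}^{i-1}\tilde a_{ij}\Big(\nabla_x\cdot\big[\mathcal A(v)u^{(j)}+\tfrac{\mathcal B(v)}{2}T^{(j)}+\varepsilon(I-P)(vg^{(j)})\big]-Q(u^{(j)},\rho^{(j)},T^{(j)})\Big)-\frac{\Delta t}{\varepsilon^2\tau}\sum_{j=1}^{i}a_{ij}g^{(j)},$$ where $p=\rho+T$. If the IMEX method is of type A and satisfies the GSA property, then in the fluid dynamic limit $\varepsilon\to0$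 this scheme becomes a consistent time discretization of the thermal incompressible Navier--Stokes equations $$\nabla_x\cdot u=0,\qquad \nabla_x(\rho+T)=0,\qquad \partial_t u+\nabla_x\cdot(u\otimes u)+\nabla_x\tilde p=\tau\Delta_x u,\qquad \partial_t T+\nabla_x\cdot(uT)=\tau\Delta_x T .$$
   Context: Setting. $d\in\{1,2,3\}$, $x\in D\subset\mathbb R^d$, $v\in\mathbb R^d$, $\tau>0$ is the relaxation time, $\Delta t>0$ the time step, $\varepsilon>0$ the Knudsen number. Only time is discretized. The unknowns are $\rho(x,t),T(x,t)\in\mathbb R$, $u(x,t)\in\mathbb R^d$ and $g(x,v,t)\in\mathbb R$; a superscript $n$ denotes the approximation at time $t^n$, a superscript $(i)$ an internal stage. Notation. $M(v)=(2\pi)^{-d/2}e^{-|v|^2/2}$ and $\langle f\rangle=\int_{\mathbb R^d}f(v)M(v)\,dv$. $P$ is the projection $Pf=\langle f\rangle+v\cdot\langle vf\rangle+\frac{|v|^2-d}{2}\big\langle\frac{|v|^2-d}{d}f\big\rangle$, and $g$ satisfies $Pg=0$. $\mathcal A(v)=v\otimes v-\frac{|v|^2}{d}I$ and $\mathcal B(v)=v(|v|^2-(d+2))$. Here $\nabla_x\cdot[\mathcal A(v)u]=\mathcal A(v):\nabla_x u$ and $\nabla_x\cdot[\mathcal B(v)T]=\mathcal B(v)\cdot\nabla_x T$. Further $$Q(u,\rho,T)(v)=\frac{1}{\varepsilon^2\tau}\Big(\frac{M_F(v)}{M(v)}-1-\varepsilon\big(\rho+v\cdot u+\tfrac{|v|^2-d}{2}T\big)\Big),\qquad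 M_F(v)=\frac{\rho_F}{(2\pi T_F)^{d/2}}\exp\Big(-\frac{|v-u_F|^2}{2T_F}\Big),$$ with $\rho_F=1+\varepsilon\rho$, $\rho_Fu_F=\varepsilon u$, $T_F=1+\varepsilon\frac{T}{1+\varepsilon\rho}-\varepsilon^2\frac{|u|^2}{d(1+\varepsilon\rho)^2}$. IMEX tableaux. An $s$-stage IMEX Runge--Kutta method is given by an explicit tableau $(\tilde A,\tilde w)$, with $\tilde A=(\tilde a_{ij})\in\mathbb R^{s\times s}$ lower triangular with zero diagonal, and an implicit tableau $(A,w)$, with $A=(a_{ij})\in\mathbb R^{s\times s}$ lower triangular (diagonally implicit). It is of type A if $A$ is invertible, i.e. $a_{ii}\neq0$ for all $i$. It is implicitly stiffly accurate if $a_{si}=w_i$ for $i=1,\dots,s$, and globally stiffly accurate (GSA) if additionally $\tilde a_{si}=\tilde w_i$ for $i=1,\dots,s-1$ (with $\tilde w_s=0$); for a GSA method the numerical solution at $t^{n+1}$ equals the last internal stage $(s)$. Meaning of the limit and of consistency. The limit $\varepsilon\to0$ is formal: $p=\rho+T$ is rescaled as $p=\varepsilon\tilde p$, and $\rho,u,T,\tilde p,g$ (values at $t^n$ and at all stages), together with the space derivatives and velocity moments occurring, are taken to have finite limits as $\varepsilon\to0$, with limits and derivatives/moments interchanged. "Becomes a consistent discretization" means that the limits of the stages are the stages of the IMEX Runge--Kutta method with the same tableaux applied to the limit equations, with convection and diffusion treated by the explicit tableau and pressure gradient and incompressibility by the implicit one: for $i=1,\dots,s$, $\nabla_x\cdot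 u^{(i)}=0$, $\nabla_x(\rho^{(i)}+T^{(i)})=0$, $$u^{(i)}=u^n+\Delta t\sum_{j=1}^{i-1}\tilde a_{ij}\big(\tau\Delta_xu^{(j)}-(u^{(j)}\cdot\nabla_x)u^{(j)}\big)-\Delta t\sum_{j=1}^{i}a_{ij}\nabla_x\pi^{(j)},$$ $$T^{(i)}=T^n+\Delta t\sum_{j=1}^{i-1}\tilde a_{ij}\big(\tau\Delta_xT^{(j)}-\nabla_x\cdot(u^{(j)}T^{(j)})\big),$$ for some stage pressures $\pi^{(j)}$ (obtained from $\tilde p^{(j)}$ by absorbing gradient terms of the form $\nabla_x\frac{|u^{(j)}|^2}{d}$), the values at $t^{n+1}$ being those of the stage $i=s$. *)

theory Defs
  imports "HOL-Analysis.Analysis"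
begin

definition partial :: "'d::finite \<Rightarrow> (real^'d \<Rightarrow> 'b::real_normed_vector) \<Rightarrow> real^'d \<Rightarrow> 'b" where
  "partial k f x = frechet_derivative f (at x) (axis k 1)"

definition gradient :: "(real^'d::finite \<Rightarrow> real) \<Rightarrow> real^'d \<Rightarrow> real^'d" where
  "gradient f x = (\<chi> k. partial k f x)"

definition divergence :: "(real^'d::finite \<Rightarrow> real^'d) \<Rightarrow> real^'d \<Rightarrow> real" where
  "divergence f x = (\<Sum>k\<in>UNIV. partial k f x $ k)"

definition tensor_divergence :: "(real^'d::finite \<Rightarrow> real^'d^'d) \<Rightarrow> real^'d \<Rightarrow> real^'d" where
  "tensor_divergence F x = (\<chi> i. divergence (\<lambda>y. F y $ i) x)"

definition laplacian :: "(real^'d::finite \<Rightarrow> 'b::real_normed_vector) \<Rightarrow> real^'d \<Rightarrow> 'b" where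
  "laplacian f x = (\<Sum>k\<in>UNIV. partial k (partial k f) x)"

definition convection :: "(real^'d::finite \<Rightarrow> real^'d) \<Rightarrow> real^'d \<Rightarrow> real^'d" where
  "convection u x = (\<Sum>k\<in>UNIV. (u x $ k) *\<^sub>R partial k u x)"

definition C2_on :: "(real^'d::finite) set \<Rightarrow> (real^'d \<Rightarrow> 'b::real_normed_vector) \<Rightarrow> bool" where
  "C2_on D f \<longleftrightarrow> f differentiable_on D \<and> (\<forall>k. partial k f differentiable_on D) \<and>
     (\<forall>k l. continuous_on D (partial k (partial l f)))"

definition maxwellian :: "real^'d::finite \<Rightarrow> real" where
  "maxwellian v = (2 * pi) powr (- (real CARD('d) / 2)) * exp (- ((norm v)\<^sup>2 / 2))"

definition avg :: "(real^'d::finite \<Rightarrow> 'b::{banach, second_countable_topology}) \<Rightarrow> 'b" where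
  "avg f = (LINT v|lborel. maxwellian v *\<^sub>R f v)"

definition proj :: "(real^'d::finite \<Rightarrow> real) \<Rightarrow> real^'d \<Rightarrow> real" where
  "proj f v = avg f + v \<bullet> avg (\<lambda>w. f w *\<^sub>R w)
     + ((norm v)\<^sup>2 - real CARD('d)) / 2
       * avg (\<lambda>w. ((norm w)\<^sup>2 - real CARD('d)) / real CARD('d) * f w)"

text \<open>The vector \<open>(I - P)(v g)\<close>, with \<open>P\<close> acting on each of the components \<open>v\<^sub>k g\<close>.\<close>

definition coproj_flux :: "(real^'d::finite \<Rightarrow> real) \<Rightarrow> real^'d \<Rightarrow> real^'d" where
  "coproj_flux g v = (\<chi> k. v $ k * g v - proj (\<lambda>w. w $ k * g w) v)"

definition tensor_A :: "real^'d::finite \<Rightarrow> real^'d^'d" where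
  "tensor_A v = (\<chi> i j. v $ i * v $ j) - ((norm v)\<^sup>2 / real CARD('d)) *\<^sub>R mat 1"

definition vector_B :: "real^'d::finite \<Rightarrow> real^'d" where
  "vector_B v = ((norm v)\<^sup>2 - (real CARD('d) + 2)) *\<^sub>R v"

definition local_maxwellian :: "real \<Rightarrow> real^'d::finite \<Rightarrow> real \<Rightarrow> real^'d \<Rightarrow> real" where
  "local_maxwellian \<rho>F uF TF v =
     \<rho>F / (2 * pi * TF) powr (real CARD('d) / 2) * exp (- ((norm (v - uF))\<^sup>2 / (2 * TF)))"

definition collision_Q ::
  "real \<Rightarrow> real \<Rightarrow> real^'d::finite \<Rightarrow> real \<Rightarrow> real \<Rightarrow> real^'d \<Rightarrow> real" where
  "collision_Q \<tau> \<epsilon> u \<rho> T v =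
     (let \<rho>F = 1 + \<epsilon> * \<rho>;
          uF = (\<epsilon> / \<rho>F) *\<^sub>R u;
          TF = 1 + \<epsilon> * (T / (1 + \<epsilon> * \<rho>))
                 - \<epsilon>\<^sup>2 * ((norm u)\<^sup>2 / (real CARD('d) * (1 + \<epsilon> * \<rho>)\<^sup>2))
      in 1 / (\<epsilon>\<^sup>2 * \<tau>) *
         (local_maxwellian \<rho>F uF TF v / maxwellian v - 1
          - \<epsilon> * (\<rho> + v \<bullet> u + ((norm v)\<^sup>2 - real CARD('d)) / 2 * T)))"

text \<open>All velocity moments of \<open>g\<close> in the scheme and in the constraint \<open>P g = 0\<close> are linear
  combinations of the moments with the following weights.\<close>

definition moment_weights :: "(real^'d::finite \<Rightarrow> real) set" where
  "moment_weights = {\<lambda>v. 1} \<union> range (\<lambda>k v. v $ k) \<union> range (\<lambda>(k, l) v. v $ k * v $ l)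
     \<union> range (\<lambda>k v. (norm v)\<^sup>2 * v $ k)"

text \<open>Tableau entries are indexed from \<open>1\<close> to \<open>s\<close>; \<open>ta\<close>, \<open>tw\<close> belong to the explicit tableau
  and \<open>a\<close>, \<open>w\<close> to the implicit one.\<close>

definition imex_tableaux :: "nat \<Rightarrow> (nat \<Rightarrow> nat \<Rightarrow> real) \<Rightarrow> (nat \<Rightarrow> nat \<Rightarrow> real) \<Rightarrow> bool" where
  "imex_tableaux s ta a \<longleftrightarrow> s \<ge> 1 \<and>
     (\<forall>i\<in>{1..s}. \<forall>j\<in>{1..s}. i \<le> j \<longrightarrow> ta i j = 0) \<and>
     (\<forall>i\<in>{1..s}. \<forall>j\<in>{1..s}. i < j \<longrightarrow> a i j = 0)"

definition type_A :: "nat \<Rightarrow> (nat \<Rightarrow> nat \<Rightarrow> real) \<Rightarrow> bool" where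
  "type_A s a \<longleftrightarrow> (\<exists>b :: nat \<Rightarrow> nat \<Rightarrow> real. \<forall>i\<in>{1..s}. \<forall>k\<in>{1..s}.
     (\<Sum>j=1..s. a i j * b j k) = (if i = k then 1 else 0) \<and>
     (\<Sum>j=1..s. b i j * a j k) = (if i = k then 1 else 0))"

definition implicitly_stiffly_accurate :: "nat \<Rightarrow> (nat \<Rightarrow> nat \<Rightarrow> real) \<Rightarrow> (nat \<Rightarrow> real) \<Rightarrow> bool" where
  "implicitly_stiffly_accurate s a w \<longleftrightarrow> (\<forall>i\<in>{1..s}. a s i = w i)"

definition globally_stiffly_accurate ::
  "nat \<Rightarrow> (nat \<Rightarrow> nat \<Rightarrow> real) \<Rightarrow> (nat \<Rightarrow> real) \<Rightarrow> (nat \<Rightarrow> nat \<Rightarrow> real) \<Rightarrow> (nat \<Rightarrow> real) \<Rightarrow> bool" where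
  "globally_stiffly_accurate s ta tw a w \<longleftrightarrow> implicitly_stiffly_accurate s a w \<and>
     (\<forall>i\<in>{1..<s}. ta s i = tw i) \<and> tw s = 0"

record ('d::finite) state =
  dens :: "real^'d \<Rightarrow> real"
  vel :: "real^'d \<Rightarrow> real^'d"
  temp :: "real^'d \<Rightarrow> real"
  micro :: "real^'d \<Rightarrow> real^'d \<Rightarrow> real"

definition press :: "'d::finite state \<Rightarrow> real^'d \<Rightarrow> real" where
  "press S x = dens S x + temp S x"

definition flux_A :: "'d::finite state \<Rightarrow> real^'d \<Rightarrow> real^'d" where
  "flux_A S = tensor_divergence (\<lambda>y. avg (\<lambda>v. micro S y v *\<^sub>R tensor_A v))"

definition flux_B :: "'d::finite state \<Rightarrow> real^'d \<Rightarrow> real" where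
  "flux_B S = divergence (\<lambda>y. avg (\<lambda>v. micro S y v *\<^sub>R vector_B v))"

text \<open>The explicitly treated part
  \<open>\<nabla>\<^sub>x \<cdot> [A(v) u + B(v)/2 T + \<epsilon> (I - P)(v g)] - Q(u, \<rho>, T)\<close> of the equation for \<open>g\<close>.\<close>

definition explicit_micro :: "real \<Rightarrow> real \<Rightarrow> 'd::finite state \<Rightarrow> real^'d \<Rightarrow> real^'d \<Rightarrow> real" where
  "explicit_micro \<tau> \<epsilon> S x v =
     divergence (\<lambda>y. tensor_A v *v vel S y + (temp S y / 2) *\<^sub>R vector_B v
                       + \<epsilon> *\<^sub>R coproj_flux (micro S y) v) x
     - collision_Q \<tau> \<epsilon> (vel S x) (dens S x) (temp S x) v"

text \<open>One row of the method: \<open>R\<close> is computed from the old value \<open>Sn\<close> and the stages \<open>S j\<close>,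
  with explicit coefficients \<open>ct j\<close>, \<open>j \<in> Jt\<close>, and implicit coefficients \<open>c j\<close>, \<open>j \<in> J\<close>.\<close>

definition micro_macro_row ::
  "(real^'d::finite) set \<Rightarrow> real \<Rightarrow> real \<Rightarrow> real \<Rightarrow> nat set \<Rightarrow> (nat \<Rightarrow> real) \<Rightarrow> nat set \<Rightarrow> (nat \<Rightarrow> real)
   \<Rightarrow> 'd state \<Rightarrow> (nat \<Rightarrow> 'd state) \<Rightarrow> 'd state \<Rightarrow> bool" where
  "micro_macro_row D \<tau> dt \<epsilon> Jt ct J c Sn S R \<longleftrightarrow> (\<forall>x\<in>D.
     dens R x = dens Sn x - dt / \<epsilon> * (\<Sum>j\<in>J. c j * divergence (vel (S j)) x) \<and>
     vel R x = vel Sn x - dt *\<^sub>R (\<Sum>j\<in>J. c j *\<^sub>R flux_A (S j) x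
        + (c j / \<epsilon>) *\<^sub>R gradient (\<lambda>y. temp (S j) y + dens (S j) y) x) \<and>
     temp R x = temp Sn x - dt * (\<Sum>j\<in>J. c j / real CARD('d) * flux_B (S j) x
        + 2 * c j / (real CARD('d) * \<epsilon>) * divergence (vel (S j)) x) \<and>
     press R x = press Sn x - dt * (\<Sum>j\<in>J. c j / real CARD('d) * flux_B (S j) x
        + (real CARD('d) + 2) / (real CARD('d) * \<epsilon>) * c j * divergence (vel (S j)) x) \<and>
     (\<forall>v. micro R x v = micro Sn x v
        - dt / \<epsilon>\<^sup>2 * (\<Sum>j\<in>Jt. ct j * explicit_micro \<tau> \<epsilon> (S j) x v)
        - dt / (\<epsilon>\<^sup>2 * \<tau>) * (\<Sum>j\<in>J. c j * micro (S j) x v)))"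

text \<open>The internal stages \<open>S 1, \<dots>, S s\<close> and the numerical solution \<open>Snew\<close> at the new time level,
  the latter computed with the weights, as in any IMEX Runge--Kutta method.\<close>

definition micro_macro_imex ::
  "(real^'d::finite) set \<Rightarrow> real \<Rightarrow> real \<Rightarrow> real \<Rightarrow> nat \<Rightarrow> (nat \<Rightarrow> nat \<Rightarrow> real) \<Rightarrow> (nat \<Rightarrow> real)
   \<Rightarrow> (nat \<Rightarrow> nat \<Rightarrow> real) \<Rightarrow> (nat \<Rightarrow> real) \<Rightarrow> 'd state \<Rightarrow> (nat \<Rightarrow> 'd state) \<Rightarrow> 'd state \<Rightarrow> bool" where
  "micro_macro_imex D \<tau> dt \<epsilon> s ta tw a w Sn S Snew \<longleftrightarrow>
     (\<forall>i\<in>{1..s}. micro_macro_row D \<tau> dt \<epsilon> {1..<i} (ta i) {1..i} (a i) Sn S (S i)) \<and>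
     micro_macro_row D \<tau> dt \<epsilon> {1..s} tw {1..s} w Sn S Snew"

text \<open>States for which all derivatives and moments in the scheme are meaningful and \<open>P g = 0\<close>.\<close>

definition admissible :: "(real^'d::finite) set \<Rightarrow> 'd state \<Rightarrow> bool" where
  "admissible D S \<longleftrightarrow>
     dens S differentiable_on D \<and> vel S differentiable_on D \<and> temp S differentiable_on D \<and>
     (\<forall>v. (\<lambda>x. micro S x v) differentiable_on D) \<and>
     (\<forall>\<phi>\<in>moment_weights. (\<lambda>x. avg (\<lambda>v. \<phi> v * micro S x v)) differentiable_on D \<and>
        (\<forall>x\<in>D. integrable lborel (\<lambda>v. maxwellian v * (\<phi> v * micro S x v)))) \<and>
     (\<forall>x\<in>D. \<forall>v. proj (micro S x) v = 0)"

definition C1_limit ::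
  "(real^'d::finite) set \<Rightarrow> (real \<Rightarrow> real^'d \<Rightarrow> 'b::real_normed_vector) \<Rightarrow> (real^'d \<Rightarrow> 'b) \<Rightarrow> bool" where
  "C1_limit D F f \<longleftrightarrow> (\<forall>x\<in>D. ((\<lambda>\<epsilon>. F \<epsilon> x) \<longlongrightarrow> f x) (at_right 0) \<and>
     (\<forall>k. ((\<lambda>\<epsilon>. partial k (F \<epsilon>) x) \<longlongrightarrow> partial k f x) (at_right 0)))"

text \<open>\<open>S \<epsilon>\<close> has the finite limit \<open>S0\<close> and the rescaled pressure \<open>p / \<epsilon>\<close> the finite limit \<open>q0\<close>; limits
  are interchanged with space derivatives and velocity moments.\<close>

definition formal_limit ::
  "(real^'d::finite) set \<Rightarrow> (real \<Rightarrow> 'd state) \<Rightarrow> 'd state \<Rightarrow> (real^'d \<Rightarrow> real) \<Rightarrow> bool" where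
  "formal_limit D S S0 q0 \<longleftrightarrow>
     admissible D S0 \<and> q0 differentiable_on D \<and>
     C1_limit D (\<lambda>\<epsilon>. dens (S \<epsilon>)) (dens S0) \<and>
     C1_limit D (\<lambda>\<epsilon>. vel (S \<epsilon>)) (vel S0) \<and>
     C1_limit D (\<lambda>\<epsilon>. temp (S \<epsilon>)) (temp S0) \<and>
     C1_limit D (\<lambda>\<epsilon> x. press (S \<epsilon>) x / \<epsilon>) q0 \<and>
     (\<forall>v. C1_limit D (\<lambda>\<epsilon> x. micro (S \<epsilon>) x v) (\<lambda>x. micro S0 x v)) \<and>
     (\<forall>\<phi>\<in>moment_weights. C1_limit D (\<lambda>\<epsilon> x. avg (\<lambda>v. \<phi> v * micro (S \<epsilon>) x v))
                                      (\<lambda>x. avg (\<lambda>v. \<phi> v * micro S0 x v)))"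

text \<open>Stages of the IMEX method for the thermal incompressible Navier--Stokes equations:
  convection and diffusion explicit, pressure gradient and incompressibility implicit.\<close>

definition ins_imex_stages ::
  "(real^'d::finite) set \<Rightarrow> real \<Rightarrow> real \<Rightarrow> nat \<Rightarrow> (nat \<Rightarrow> nat \<Rightarrow> real) \<Rightarrow> (nat \<Rightarrow> nat \<Rightarrow> real)
   \<Rightarrow> (real^'d \<Rightarrow> real^'d) \<Rightarrow> (real^'d \<Rightarrow> real)
   \<Rightarrow> (nat \<Rightarrow> real^'d \<Rightarrow> real) \<Rightarrow> (nat \<Rightarrow> real^'d \<Rightarrow> real^'d) \<Rightarrow> (nat \<Rightarrow> real^'d \<Rightarrow> real)
   \<Rightarrow> (nat \<Rightarrow> real^'d \<Rightarrow> real) \<Rightarrow> bool" where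
  "ins_imex_stages D \<tau> dt s ta a un Tn \<rho> u T \<pi> \<longleftrightarrow> (\<forall>i\<in>{1..s}. \<forall>x\<in>D.
     divergence (u i) x = 0 \<and>
     gradient (\<lambda>y. \<rho> i y + T i y) x = 0 \<and>
     u i x = un x
       + dt *\<^sub>R (\<Sum>j\<in>{1..<i}. ta i j *\<^sub>R (\<tau> *\<^sub>R laplacian (u j) x - convection (u j) x))
       - dt *\<^sub>R (\<Sum>j\<in>{1..i}. a i j *\<^sub>R gradient (\<pi> j) x) \<and>
     T i x = Tn x
       + dt * (\<Sum>j\<in>{1..<i}. ta i j *
                 (\<tau> * laplacian (T j) x - divergence (\<lambda>y. T j y *\<^sub>R u j y) x)))"

text \<open>The stage pressures \<open>\<pi>\<close> arise from the limits \<open>q\<close> of the rescaled pressure by absorbing the terms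
  \<open>|u j|\<^sup>2 / d\<close>; for an invertible implicit matrix this determines \<open>\<pi>\<close>.\<close>

definition absorbed_pressure ::
  "(real^'d::finite) set \<Rightarrow> nat \<Rightarrow> (nat \<Rightarrow> nat \<Rightarrow> real) \<Rightarrow> (nat \<Rightarrow> nat \<Rightarrow> real)
   \<Rightarrow> (nat \<Rightarrow> real^'d \<Rightarrow> real^'d) \<Rightarrow> (nat \<Rightarrow> real^'d \<Rightarrow> real) \<Rightarrow> (nat \<Rightarrow> real^'d \<Rightarrow> real) \<Rightarrow> bool" where
  "absorbed_pressure D s ta a u q \<pi> \<longleftrightarrow> (\<forall>i\<in>{1..s}. \<forall>x\<in>D.
     (\<Sum>j\<in>{1..i}. a i j * \<pi> j x) =
       (\<Sum>j\<in>{1..i}. a i j * q j x)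
       - (\<Sum>j\<in>{1..<i}. ta i j * ((norm (u j x))\<^sup>2 / real CARD('d))))"

end

(* As \<epsilon> tends to 0, the density equation gives A (div u) = 0 for the stages, so div u = 0 because A is
   invertible; boundedness of p/\<epsilon> gives \<rho> + T = 0. Multiplying the equation for g by \<epsilon>^2 expresses the
   combinations sum_j a_ij g_j through the explicit stage terms
   A(v):grad u + B(v).grad T / 2 - Q_0, where Q_0 is the second-order coefficient of M_F / M divided by
   \<tau>. The Gaussian moments of A(v) and B(v) turn these into the viscous stress minus u u^T and the heat
   flux minus u T, up to the trace |u|^2/d, which goes into the pressure. In the temperature equation
   the singular term div u / \<epsilon> is eliminated with the density equation, which produces the factor
   (d + 2)/d on both sides. *)

theory Submission
  imports Defs "HOL-Probability.Distributions" "HOL-Real_Asymp.Real_Asymp"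
begin

subsection \<open>Partial derivatives\<close>

text \<open>The single stages of g are never determined: the macroscopic rows see them only through
  sums with the implicit coefficients, and exactly these sums are what the g equation yields in the
  limit. The resulting identity holds for each fixed v and its right side is a polynomial in v, so
  it can be integrated against A(v) and B(v) exactly; limits and v-integrals are exchanged only for
  the moments of g listed in \<open>formal_limit\<close>. It also holds at every x of the open set D
  and may be differentiated there. Q_0 is polynomial in v because M_F / M is the exponential of a
  quantity of order \<epsilon> whose first-order part is subtracted in Q. Invertibility of the
  implicit matrix is used a second time for the pressure: the gradients of |u|^2 / d arrive with
  explicit coefficients while pressure gradients carry implicit ones, so absorbing the former means
  solving a linear system with matrix \<open>a\<close>. The viscous stress contains the transposed
  velocity gradient, whose divergence vanishes because second partials commute; hence Clairaut's
  theorem is proved for \<open>partial\<close>.\<close>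

lemma partial_has_derivative:
  "(f has_derivative f') (at x) \<Longrightarrow> partial k f x = f' (axis k 1)"
  unfolding partial_def using frechet_derivative_at by metis

lemma has_derivative_frechet:
  "f differentiable (at x) \<Longrightarrow> (f has_derivative frechet_derivative f (at x)) (at x)"
  by (simp add: frechet_derivative_works)

lemma differentiable_on_openD:
  "f differentiable_on D \<Longrightarrow> open D \<Longrightarrow> x \<in> D \<Longrightarrow> f differentiable (at x)"
  using differentiable_on_eq_differentiable_at by blast

lemma partial_bounded_linear:
  assumes "bounded_linear h" "f differentiable (at x)"
  shows "partial k (\<lambda>y. h (f y)) x = h (partial k f x)"
proof -
  have "((\<lambda>y. h (f y)) has_derivative (\<lambda>v. h (frechet_derivative f (at x) v))) (at x)"
    using bounded_linear.has_derivative[OF assms(1) has_derivative_frechet[OF assms(2)]] .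
  from partial_has_derivative[OF this] show ?thesis by (simp add: partial_def)
qed

lemma differentiable_bounded_linear:
  assumes "bounded_linear h" "f differentiable (at x)"
  shows "(\<lambda>y. h (f y)) differentiable (at x)"
  using bounded_linear.has_derivative[OF assms(1) has_derivative_frechet[OF assms(2)]]
  by (rule differentiableI)

lemma partial_nth:
  "f differentiable (at x) \<Longrightarrow> partial k (\<lambda>y. f y $ i) x = partial k f x $ i"
  by (rule partial_bounded_linear[OF bounded_linear_vec_nth])

lemma differentiable_nth:
  "f differentiable (at x) \<Longrightarrow> (\<lambda>y. f y $ i) differentiable (at x)"
  by (rule differentiable_bounded_linear[OF bounded_linear_vec_nth])

lemma partial_const [simp]: "partial k (\<lambda>y. c) x = 0"
  using partial_has_derivative[OF has_derivative_const] .

lemma partial_add: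
  "f differentiable (at x) \<Longrightarrow> g differentiable (at x) \<Longrightarrow>
    partial k (\<lambda>y. f y + g y) x = partial k f x + partial k g x"
  using partial_has_derivative[OF has_derivative_add[OF has_derivative_frechet has_derivative_frechet]]
  by (simp add: partial_def)

lemma partial_diff:
  "f differentiable (at x) \<Longrightarrow> g differentiable (at x) \<Longrightarrow>
    partial k (\<lambda>y. f y - g y) x = partial k f x - partial k g x"
  using partial_has_derivative[OF has_derivative_diff[OF has_derivative_frechet has_derivative_frechet]]
  by (simp add: partial_def)

lemma partial_cmult:
  fixes f :: "real^'d::finite \<Rightarrow> real"
  shows "f differentiable (at x) \<Longrightarrow> partial k (\<lambda>y. c * f y) x = c * partial k f x"
  by (rule partial_bounded_linear[OF bounded_linear_mult_right])

lemma partial_divide: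
  fixes f :: "real^'d::finite \<Rightarrow> real"
  shows "f differentiable (at x) \<Longrightarrow> partial k (\<lambda>y. f y / c) x = partial k f x / c"
  by (rule partial_bounded_linear[OF bounded_linear_divide])

lemma partial_mult:
  fixes f g :: "real^'d::finite \<Rightarrow> real"
  shows "f differentiable (at x) \<Longrightarrow> g differentiable (at x) \<Longrightarrow>
    partial k (\<lambda>y. f y * g y) x = f x * partial k g x + partial k f x * g x"
  using partial_has_derivative[OF has_derivative_mult[OF has_derivative_frechet has_derivative_frechet]]
  by (simp add: partial_def)

lemma partial_sum:
  "(\<And>i. i \<in> I \<Longrightarrow> f i differentiable (at x)) \<Longrightarrow>
    partial k (\<lambda>y. \<Sum>i\<in>I. f i y) x = (\<Sum>i\<in>I. partial k (f i) x)"
  using partial_has_derivative[OF has_derivative_sum[of I f "\<lambda>i. frechet_derivative (f i) (at x)"]]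
  by (simp add: partial_def has_derivative_frechet)

lemma differentiable_cong_open:
  assumes "open D" "x \<in> D" "\<And>y. y \<in> D \<Longrightarrow> f y = g y" "f differentiable (at x)"
  shows "g differentiable (at x)"
  using has_derivative_transform_within_open[OF has_derivative_frechet[OF assms(4)] assms(1,2,3)]
  by (blast intro: differentiableI)

text \<open>Functions that agree near x have the same set of derivatives there, and
  \<open>frechet_derivative\<close> chooses from that set, so the values agree even where the set is
  empty.\<close>

lemma partial_cong_open:
  assumes "open D" "x \<in> D" "\<And>y. y \<in> D \<Longrightarrow> f y = g y" 
  shows "partial k f x = partial k g x"
proof -
  have "(f has_derivative h) (at x) \<longleftrightarrow> (g has_derivative h) (at x)" for h
    using has_derivative_transform_within_open[OF _ assms(1,2)] assms(3) by metis
  then show ?thesis by (simp add: partial_def frechet_derivative_def)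
qed

lemma partial_eq_0_open:
  assumes "open D" "x \<in> D" "\<And>y. y \<in> D \<Longrightarrow> f y = 0"
  shows "partial k f x = 0"
  using partial_cong_open[OF assms(1,2), of f "\<lambda>_. 0"] assms(3) by simp

section \<open>Symmetry of second partial derivatives\<close>

lemma has_real_derivative_along_axis:
  fixes f :: "real^'d::finite \<Rightarrow> real"
  assumes "f differentiable (at (p + t *\<^sub>R axis k 1))"
  shows "((\<lambda>t. f (p + t *\<^sub>R axis k 1)) has_real_derivative partial k f (p + t *\<^sub>R axis k 1)) (at t)"
proof -
  let ?f' = "frechet_derivative f (at (p + t *\<^sub>R axis k 1))"
  have L: "linear ?f'"
    using linear_frechet_derivative[OF assms] .
  have *: "((\<lambda>t. p + t *\<^sub>R axis k 1) has_derivative (\<lambda>h. h *\<^sub>R axis k 1)) (at t)"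
    by (auto intro!: derivative_eq_intros)
  have "((\<lambda>t. f (p + t *\<^sub>R axis k 1)) has_derivative (\<lambda>h. ?f' (h *\<^sub>R axis k 1))) (at t)"
    using diff_chain_at[OF *, of f ?f'] has_derivative_frechet[OF assms] by (simp add: o_def)
  then show ?thesis
    by (simp add: has_field_derivative_def partial_def linear_scale[OF L] mult.commute[of _ "?f' (axis k 1)"])
qed

text \<open>Mean value theorem twice: the left side is the increment, over a step h in direction k,
  of the difference of f across the shift in direction l; the resulting difference of
  \<open>partial k f\<close> is again an increment, now along l. The left side is symmetric in k and
  l while the right side is not.\<close>

lemma second_difference_eq_partial:
  fixes f :: "real^'d::finite \<Rightarrow> real"
  assumes f: "\<And>y. dist x y < r \<Longrightarrow> f differentiable (at y)"
    and pf: "\<And>y. dist x y < r \<Longrightarrow> partial k f differentiable (at y)"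
    and h: "0 < h" "2 * h < r"
  shows "\<exists>z. dist x z \<le> 2 * h \<and>
    f (x + h *\<^sub>R axis k 1 + h *\<^sub>R axis l 1) - f (x + h *\<^sub>R axis k 1)
      - f (x + h *\<^sub>R axis l 1) + f x = h\<^sup>2 * partial l (partial k f) z"
proof -
  let ?k = "axis k 1 :: real^'d" and ?l = "axis l 1 :: real^'d"
  have near: "dist x (x + s *\<^sub>R ?k + t *\<^sub>R ?l) \<le> 2 * h" if "0 \<le> s" "s \<le> h" "0 \<le> t" "t \<le> h" for s t
  proof -
    have "dist x (x + s *\<^sub>R ?k + t *\<^sub>R ?l) = norm (s *\<^sub>R ?k + t *\<^sub>R ?l)"
      by (metis add.assoc dist_add_cancel dist_0_norm add.right_neutral)
    also have "\<dots> \<le> norm (s *\<^sub>R ?k) + norm (t *\<^sub>R ?l)" by (rule norm_triangle_ineq)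
    also have "\<dots> \<le> 2 * h" using that by simp
    finally show ?thesis .
  qed
  have near': "dist x (x + s *\<^sub>R ?k + t *\<^sub>R ?l) < r" if "0 \<le> s" "s \<le> h" "0 \<le> t" "t \<le> h" for s t
    using near[OF that] h by linarith
  let ?\<phi> = "\<lambda>s. f ((x + h *\<^sub>R ?l) + s *\<^sub>R ?k) - f (x + s *\<^sub>R ?k)"
  have "\<exists>s>0. s < h \<and> ?\<phi> h - ?\<phi> 0 =
      (h - 0) * (partial k f ((x + h *\<^sub>R ?l) + s *\<^sub>R ?k) - partial k f (x + s *\<^sub>R ?k))"
  proof (rule MVT2[OF h(1)])
    fix s assume s: "0 \<le> s" "s \<le> h"
    have "dist x ((x + h *\<^sub>R ?l) + s *\<^sub>R ?k) < r" "dist x (x + s *\<^sub>R ?k) < r"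
      using near'[of s h] near'[of s 0] s h(1) by (simp_all add: ac_simps)
    then show "DERIV ?\<phi> s :> partial k f ((x + h *\<^sub>R ?l) + s *\<^sub>R ?k) - partial k f (x + s *\<^sub>R ?k)"
      by (intro DERIV_diff has_real_derivative_along_axis f)
  qed
  then obtain s where s: "0 < s" "s < h" and 1: "?\<phi> h - ?\<phi> 0 =
      h * (partial k f ((x + h *\<^sub>R ?l) + s *\<^sub>R ?k) - partial k f (x + s *\<^sub>R ?k))" by auto
  let ?\<psi> = "\<lambda>t. partial k f ((x + s *\<^sub>R ?k) + t *\<^sub>R ?l)"
  have "\<exists>t>0. t < h \<and> ?\<psi> h - ?\<psi> 0 = (h - 0) * partial l (partial k f) ((x + s *\<^sub>R ?k) + t *\<^sub>R ?l)"
  proof (rule MVT2[OF h(1)])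
    fix t assume t: "0 \<le> t" "t \<le> h"
    show "DERIV ?\<psi> t :> partial l (partial k f) ((x + s *\<^sub>R ?k) + t *\<^sub>R ?l)"
      by (intro has_real_derivative_along_axis pf near') (use s t in auto)
  qed
  then obtain t where t: "0 < t" "t < h" and
    2: "?\<psi> h - ?\<psi> 0 = h * partial l (partial k f) ((x + s *\<^sub>R ?k) + t *\<^sub>R ?l)" by auto
  show ?thesis
    by (rule exI[of _ "x + s *\<^sub>R ?k + t *\<^sub>R ?l"])
      (use 1 2 s t near[of s t] in \<open>simp add: ac_simps power2_eq_square\<close>)
qed

text \<open>Clairaut's theorem. The same second difference equals h^2 times either mixed partial, at
  points within distance 2 h of x; after division by h^2, continuity of the mixed partials
  identifies their values at x as h tends to 0.\<close>

lemma partial_commute: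
  fixes f :: "real^'d::finite \<Rightarrow> real"
  assumes D: "open D" "x \<in> D" and f: "C2_on D f"
  shows "partial l (partial k f) x = partial k (partial l f) x"
proof -
  obtain r where r: "r > 0" "ball x r \<subseteq> D" using D by (meson openE)
  have fd: "f differentiable (at y)" and pd: "partial m f differentiable (at y)"
    if "dist x y < r" for y m
    using f r(2) that D unfolding C2_on_def by (auto intro!: differentiable_on_openD[of _ D])
  have lim: "((\<lambda>h. partial l (partial k f) (z h)) \<longlongrightarrow> partial l (partial k f) x) (at_right 0)"
    if z: "\<And>h. 0 < h \<Longrightarrow> 2 * h < r \<Longrightarrow> dist x (z h) \<le> 2 * h" for z k l
  proof -
    have "isCont (partial l (partial k f)) x"
      using f D unfolding C2_on_def by (meson continuous_on_eq_continuous_at)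
    moreover have "(z \<longlongrightarrow> x) (at_right 0)"
    proof (rule tendsto_dist_iff[THEN iffD2])
      have ev: "\<forall>\<^sub>F h in at_right 0. dist (z h) x \<le> 2 * h"
        unfolding eventually_at_right_field
        by (rule exI[of _ "r/2"]) (use r z in \<open>auto simp: dist_commute\<close>)
      have "((\<lambda>h::real. 2 * h) \<longlongrightarrow> 2 * 0) (at_right 0)" by (intro tendsto_intros)
      then show "((\<lambda>h. dist (z h) x) \<longlongrightarrow> 0) (at_right 0)"
        by (intro tendsto_sandwich[OF _ ev tendsto_const]) auto
    qed
    ultimately show ?thesis by (rule isCont_tendsto_compose)
  qed
  have "\<exists>z. \<forall>h>0. 2 * h < r \<longrightarrow> dist x (z h) \<le> 2 * h \<and>
    f (x + h *\<^sub>R axis k 1 + h *\<^sub>R axis l 1) - f (x + h *\<^sub>R axis k 1)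
      - f (x + h *\<^sub>R axis l 1) + f x = h\<^sup>2 * partial l (partial k f) (z h)" for k l
    by (rule choice) (metis second_difference_eq_partial[OF fd pd])
  from this[of k l] this[of l k] obtain z w where
    z: "\<And>h. 0 < h \<Longrightarrow> 2 * h < r \<Longrightarrow> dist x (z h) \<le> 2 * h \<and>
      f (x + h *\<^sub>R axis k 1 + h *\<^sub>R axis l 1) - f (x + h *\<^sub>R axis k 1)
        - f (x + h *\<^sub>R axis l 1) + f x = h\<^sup>2 * partial l (partial k f) (z h)" and
    w: "\<And>h. 0 < h \<Longrightarrow> 2 * h < r \<Longrightarrow> dist x (w h) \<le> 2 * h \<and>
      f (x + h *\<^sub>R axis l 1 + h *\<^sub>R axis k 1) - f (x + h *\<^sub>R axis l 1)
        - f (x + h *\<^sub>R axis k 1) + f x = h\<^sup>2 * partial k (partial l f) (w h)"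
    by metis
  have eq: "partial l (partial k f) (z h) = partial k (partial l f) (w h)" if "0 < h" "2 * h < r" for h
  proof -
    have "h\<^sup>2 * partial l (partial k f) (z h) = h\<^sup>2 * partial k (partial l f) (w h)"
      using z[OF that] w[OF that] unfolding add.commute[of "h *\<^sub>R axis l 1" "h *\<^sub>R axis k 1"] add.assoc
      by linarith
    then show ?thesis using that by simp
  qed
  have ev: "\<forall>\<^sub>F h in at_right 0. partial l (partial k f) (z h) = partial k (partial l f) (w h)"
    unfolding eventually_at_right_field by (rule exI[of _ "r/2"]) (use r eq in auto)
  have "((\<lambda>h. partial k (partial l f) (w h)) \<longlongrightarrow> partial l (partial k f) x) (at_right 0)"
    using lim[of z l k] z tendsto_cong[OF ev] by blast
  moreover have "((\<lambda>h. partial k (partial l f) (w h)) \<longlongrightarrow> partial k (partial l f) x) (at_right 0)"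
    using lim[of w k l] w by blast
  ultimately show ?thesis by (rule tendsto_unique[rotated]) simp
qed

subsection \<open>Gaussian moments\<close>

text \<open>Integrability and value in one predicate: \<open>avg\<close> alone is 0 for a
  non-integrable function, so its linearity would need side conditions at each use.\<close>

definition has_avg :: "(real^'d::finite \<Rightarrow> real) \<Rightarrow> real \<Rightarrow> bool" where
  "has_avg f m \<longleftrightarrow> has_bochner_integral lborel (\<lambda>v. maxwellian v * f v) m"

lemma has_avg_avg: "has_avg f m \<Longrightarrow> avg f = m"
  unfolding has_avg_def avg_def by (simp add: has_bochner_integral_integral_eq)

lemma has_avg_unique: "has_avg f m \<Longrightarrow> has_avg f m' \<Longrightarrow> m = m'"
  using has_avg_avg by blast

lemma has_avg_add: "has_avg f m \<Longrightarrow> has_avg g m' \<Longrightarrow> has_avg (\<lambda>v. f v + g v) (m + m')"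
  unfolding has_avg_def by (drule (1) has_bochner_integral_add) (simp add: distrib_left)

lemma has_avg_cmult: "has_avg f m \<Longrightarrow> has_avg (\<lambda>v. c * f v) (c * m)"
  unfolding has_avg_def using has_bochner_integral_mult_right[of c lborel "\<lambda>v. maxwellian v * f v" m]
  by (simp add: mult.left_commute)

lemma has_avg_diff: "has_avg f m \<Longrightarrow> has_avg g m' \<Longrightarrow> has_avg (\<lambda>v. f v - g v) (m - m')"
  using has_avg_add[of f m "\<lambda>v. - 1 * g v" "- 1 * m'"] has_avg_cmult[of g m' "- 1"] by simp

lemma has_avg_sum:
  "(\<And>i. i \<in> I \<Longrightarrow> has_avg (f i) (m i)) \<Longrightarrow> has_avg (\<lambda>v. \<Sum>i\<in>I. f i v) (\<Sum>i\<in>I. m i)"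
  unfolding has_avg_def
  using has_bochner_integral_sum[of I lborel "\<lambda>i v. maxwellian v * f i v" m]
  by (simp add: sum_distrib_left)

lemma has_avg_integrable: "has_avg f m \<Longrightarrow> integrable lborel (\<lambda>v. maxwellian v * f v)"
  unfolding has_avg_def by (rule integrable.intros)

lemma integrable_has_avg: "integrable lborel (\<lambda>v. maxwellian v * f v) \<Longrightarrow> has_avg f (avg f)"
  unfolding has_avg_def avg_def by (simp add: has_bochner_integral_integrable)

section \<open>Moments of monomials under the standard Gaussian\<close>

definition normal_moment :: "nat \<Rightarrow> real" where
  "normal_moment n = (LINT x|lborel. std_normal_density x * x ^ n)"

lemma normal_moment_odd: "odd n \<Longrightarrow> normal_moment n = 0"
  unfolding normal_moment_def using integral_std_normal_moment_odd by (auto elim!: oddE)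

lemma normal_moment_0 [simp]: "normal_moment 0 = 1"
  unfolding normal_moment_def using integral_std_normal_moment_even[of 0] by simp

lemma normal_moment_1 [simp]: "normal_moment (Suc 0) = 0"
  by (rule normal_moment_odd) simp

text \<open>One-dimensional Gaussian integration by parts, read off from the closed form (2 k)! /
  (2^k k!) of the even moments; for odd n both sides vanish.\<close>

lemma normal_moment_Suc_Suc: "normal_moment (Suc (Suc n)) = real (Suc n) * normal_moment n"
proof (cases "even n")
  case True
  then obtain k where n: "n = 2 * k" by (elim evenE)
  have e: "Suc (Suc n) = 2 * Suc k" by (simp add: n)
  show ?thesis
    unfolding e unfolding n normal_moment_def integral_std_normal_moment_even
    by (simp add: divide_simps)
qed (simp add: normal_moment_odd)

lemma maxwellian_eq_prod: "maxwellian v = (\<Prod>k\<in>UNIV. std_normal_density (v $ k))"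
proof -
  have "(\<Prod>k\<in>UNIV. std_normal_density (v $ k)) =
      (1 / sqrt (2 * pi)) ^ CARD('a) * exp (\<Sum>k\<in>UNIV. - (v $ k)\<^sup>2 / 2)"
    unfolding std_normal_density_def by (simp add: prod_dividef exp_sum power_one_over)
  also have "(\<Sum>k\<in>UNIV. - (v $ k)\<^sup>2 / 2) = - ((norm v)\<^sup>2 / 2)"
    by (simp add: norm_vec_def L2_set_def sum_nonneg sum_divide_distrib sum_negf)
  also have "(1 / sqrt (2 * pi)) ^ CARD('a) = (2 * pi) powr (- (real CARD('a) / 2))"
  proof -
    have "(2 * pi) powr (- (real CARD('a) / 2)) = ((2 * pi) powr (- (1/2))) powr real CARD('a)"
      by (simp add: powr_powr)
    also have "\<dots> = ((2 * pi) powr (- (1/2))) ^ CARD('a)" by (subst powr_realpow) auto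
    also have "(2 * pi) powr (- (1/2)) = 1 / sqrt (2 * pi)"
      by (simp add: powr_minus_divide powr_half_sqrt)
    finally show ?thesis by simp
  qed
  finally show ?thesis by (simp add: maxwellian_def)
qed

text \<open>Fubini: \<open>lborel\<close> on a Euclidean space is the image of a product measure
  indexed by \<open>Basis\<close> under the map from coordinates to vectors, and
  \<open>Basis\<close> consists here of the axis vectors.\<close>

lemma has_bochner_integral_prod_vec:
  fixes f :: "'d::finite \<Rightarrow> real \<Rightarrow> real"
  assumes f: "\<And>k. integrable lborel (f k)"
  shows "has_bochner_integral lborel (\<lambda>v. \<Prod>k\<in>UNIV. f k (v $ k)) (\<Prod>k\<in>UNIV. LINT x|lborel. f k x)"
proof -
  let ?ax = "\<lambda>k::'d. axis k 1 :: real^'d"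
  \<comment> \<open>The factors are re-indexed by basis vectors, because the product measure is
    indexed by \<open>Basis\<close> rather than by coordinates.\<close>
  let ?g = "\<lambda>b::real^'d. f (THE k. b = ?ax k)"
  interpret product_sigma_finite "\<lambda>b::real^'d. lborel :: real measure" ..
  have ax: "(THE k'. ?ax k = ?ax k') = k" for k by (auto simp: axis_eq_axis)
  have inj: "inj ?ax" by (auto simp: inj_on_def axis_eq_axis)
  have Basis: "(Basis :: (real^'d) set) = range ?ax" by (auto simp: Basis_vec_def)
  have P: "(\<Prod>b\<in>Basis. h b) = (\<Prod>k\<in>UNIV. h (?ax k))" for h :: "real^'d \<Rightarrow> real"
    unfolding Basis by (simp add: prod.reindex[OF inj])
  have m [measurable]: "f k \<in> borel_measurable borel" for k
    using borel_measurable_integrable[OF f[of k]] by simp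
  have g: "integrable lborel (?g b)" if "b \<in> Basis" for b using f by simp
  have comp: "(\<Sum>b\<in>Basis. x b *\<^sub>R b) $ k = x (?ax k)" for x :: "real^'d \<Rightarrow> real" and k
  proof -
    have "(\<Sum>b\<in>Basis. x b *\<^sub>R b) $ k = (\<Sum>b\<in>Basis. x b *\<^sub>R b) \<bullet> ?ax k"
      by (simp add: inner_axis)
    also have "\<dots> = x (?ax k)" by (rule inner_sum_left_Basis) (auto simp: Basis)
    finally show ?thesis .
  qed
  have meas: "(\<lambda>v::real^'d. \<Prod>k\<in>UNIV. f k (v $ k)) \<in> borel_measurable borel" 
    by measurable
  have M: "(\<lambda>x. \<Sum>b\<in>Basis. x b *\<^sub>R b) \<in> (\<Pi>\<^sub>M b\<in>(Basis::(real^'d) set). lborel) \<rightarrow>\<^sub>M borel"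
    by measurable
  have "has_bochner_integral (\<Pi>\<^sub>M b\<in>(Basis::(real^'d) set). lborel) (\<lambda>x. \<Prod>b\<in>Basis. ?g b (x b))
      (\<Prod>b\<in>Basis. integral\<^sup>L lborel (?g b))"
    unfolding has_bochner_integral_iff
    by (intro conjI product_integrable_prod product_integral_prod finite_Basis g)
  then have *: "has_bochner_integral (\<Pi>\<^sub>M b\<in>(Basis::(real^'d) set). lborel)
     (\<lambda>x. \<Prod>k\<in>UNIV. f k ((\<Sum>b\<in>Basis. x b *\<^sub>R b) $ k)) (\<Prod>k\<in>UNIV. LINT x|lborel. f k x)"
    unfolding comp by (simp add: P ax)
  show ?thesis
    unfolding has_bochner_integral_iff lborel_eq[where 'a="real^'d"]
      integrable_distr_eq[OF M meas] integral_distr[OF M meas]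
    using * unfolding has_bochner_integral_iff .
qed

text \<open>A monomial is encoded by the list of its indices with repetitions, and the coordinates
  are independent, so only multiplicities matter. The list form makes the contraction of two equal
  indices a recursion.\<close>

definition gauss_moment :: "'d::finite list \<Rightarrow> real" where
  "gauss_moment ks = (\<Prod>k\<in>UNIV. normal_moment (count_list ks k))"

lemma prod_list_eq_power_count:
  fixes g :: "'d::finite \<Rightarrow> real"
  shows "(\<Prod>k\<leftarrow>ks. g k) = (\<Prod>k\<in>UNIV. g k ^ count_list ks k)"
proof (induction ks)
  case (Cons l ks)
  have "(\<Prod>k\<in>UNIV. g k ^ count_list (l # ks) k) = (\<Prod>k\<in>UNIV. (if k = l then g k else 1) * g k ^ count_list ks k)"
    by (rule prod.cong) auto
  also have "\<dots> = g l * (\<Prod>k\<in>UNIV. g k ^ count_list ks k)"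
    by (simp add: prod.distrib prod.delta)
  finally show ?case using Cons by simp
qed simp

lemma has_avg_monomial: "has_avg (\<lambda>v. \<Prod>k\<leftarrow>ks. v $ k) (gauss_moment ks)"
proof -
  have *: "has_bochner_integral lborel
      (\<lambda>v. \<Prod>k\<in>UNIV. std_normal_density (v $ k) * (v $ k) ^ count_list ks k)
      (\<Prod>k\<in>UNIV. LINT x|lborel. std_normal_density x * x ^ count_list ks k)"
    by (rule has_bochner_integral_prod_vec) (rule integrable_std_normal_moment)
  have e: "maxwellian v * (\<Prod>k\<leftarrow>ks. v $ k) =
      (\<Prod>k\<in>UNIV. std_normal_density (v $ k) * (v $ k) ^ count_list ks k)" for v :: "real^'a"
    by (simp add: maxwellian_eq_prod prod_list_eq_power_count prod.distrib)
  show ?thesis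
    unfolding has_avg_def e using * by (simp add: gauss_moment_def normal_moment_def)
qed

lemma gauss_moment_Nil [simp]: "gauss_moment [] = 1"
  by (simp add: gauss_moment_def)

text \<open>Gaussian integration by parts: \<open>\<langle>v\<^sub>k f\<rangle> = \<langle>\<partial>\<^sub>k f\<rangle>\<close> for a monomial \<open>f\<close>.\<close>

lemma gauss_moment_Cons:
  "gauss_moment (k # ks) = real (count_list ks k) * gauss_moment (remove1 k ks)"
proof -
  have split: "(\<Prod>l\<in>UNIV. h l) = h k * (\<Prod>l\<in>UNIV - {k}. h l)" for h :: "_ \<Rightarrow> real"
    by (rule prod.remove) auto
  have other: "count_list (remove1 k xs) l = count_list xs l" if "l \<noteq> k" for l xs
    using that by (induction xs) auto
  have same: "count_list (remove1 k xs) k = count_list xs k - 1" for xs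
    by (induction xs) (auto simp: count_list_0_iff)
  have "normal_moment (Suc n) = real n * normal_moment (n - 1)" for n
    by (cases n) (auto simp: normal_moment_Suc_Suc)
  moreover have "(\<Prod>l\<in>UNIV - {k}. normal_moment (count_list (k # ks) l)) =
      (\<Prod>l\<in>UNIV - {k}. normal_moment (count_list (remove1 k ks) l))"
    by (rule prod.cong) (auto simp: other)
  ultimately show ?thesis
    unfolding gauss_moment_def split by (simp add: same)
qed

text \<open>Pairing the head index with an equal one removes two entries and keeps the parity; a
  head index without partner gives the factor 0.\<close>

lemma gauss_moment_odd: "odd (length ks) \<Longrightarrow> gauss_moment ks = 0"
proof (induction "length ks" arbitrary: ks rule: less_induct)
  case less
  show ?case
  proof (cases ks)
    case (Cons k ks')
    show ?thesis
    proof (cases "k \<in> set ks'")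
      case True
      then have l: "length (remove1 k ks') = length ks' - 1" "length ks' > 0"
        by (auto simp: length_remove1)
      then show ?thesis using less(1)[of "remove1 k ks'"] less(2) Cons
        by (simp add: gauss_moment_Cons)
    qed (simp add: Cons gauss_moment_Cons count_notin)
  qed (use less in simp)
qed

text \<open>By Gaussian integration by parts a factor \<open>|v|\<^sup>2\<close> acts on a monomial of degree \<open>m\<close> as
  multiplication by \<open>d + m\<close> (Euler's homogeneity relation).\<close>

fun radial_factor :: "real \<Rightarrow> nat \<Rightarrow> nat \<Rightarrow> real" where
  "radial_factor d 0 m = 1"
| "radial_factor d (Suc n) m = (d + real m) * radial_factor d n (m + 2)"

lemma has_avg_radial_monomial:
  "has_avg (\<lambda>v::real^'d::finite. ((norm v)\<^sup>2) ^ n * (\<Prod>k\<leftarrow>ks. v $ k))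
     (radial_factor (real CARD('d)) n (length ks) * gauss_moment ks)"
proof (induction n arbitrary: ks)
  case 0
  then show ?case using has_avg_monomial[of ks] by simp
next
  case (Suc n)
  have e: "((norm v)\<^sup>2) ^ Suc n * (\<Prod>k\<leftarrow>ks. v $ k) =
    (\<Sum>l\<in>UNIV. ((norm v)\<^sup>2) ^ n * (\<Prod>k\<leftarrow>l # l # ks. v $ k))" for v :: "real^'d"
    by (simp add: norm_vec_def L2_set_def sum_nonneg sum_distrib_left sum_distrib_right
        power2_eq_square mult_ac)
  \<comment> \<open>Contracting the new index l with its twin contributes 1, contracting it with the
    equal entries of \<open>ks\<close> contributes their number; summed over l this is d plus the
    degree.\<close>
  have s: "(\<Sum>l\<in>UNIV. gauss_moment (l # l # ks)) = (real CARD('d) + real (length ks)) * gauss_moment ks"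
  proof -
    have "(\<Sum>l\<in>UNIV. real (count_list ks l)) = real (length ks)"
      using sum_count_set[of ks UNIV] by (simp flip: of_nat_sum)
    moreover have "(\<Sum>l\<in>UNIV. gauss_moment (l # l # ks)) = 
       (\<Sum>l\<in>UNIV. 1 + real (count_list ks l)) * gauss_moment ks"
      by (simp add: gauss_moment_Cons[of _ "_ # ks"] sum_distrib_right)
    ultimately show ?thesis by (simp add: sum.distrib)
  qed
  have "has_avg (\<lambda>v::real^'d. \<Sum>l\<in>UNIV. ((norm v)\<^sup>2) ^ n * (\<Prod>k\<leftarrow>l # l # ks. v $ k))
     (\<Sum>l\<in>UNIV. radial_factor (real CARD('d)) n (length (l # l # ks)) * gauss_moment (l # l # ks))"
    by (rule has_avg_sum) (rule Suc)
  moreover have "(\<Sum>l\<in>UNIV. radial_factor (real CARD('d)) n (length (l # l # ks)) * gauss_moment (l # l # ks))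
     = radial_factor (real CARD('d)) (Suc n) (length ks) * gauss_moment ks"
    using s by (simp add: sum_distrib_left[symmetric])
  ultimately show ?case unfolding e by simp
qed

lemma gauss_moment_1: "gauss_moment [i] = 0"
  by (rule gauss_moment_odd) simp

lemma gauss_moment_3: "gauss_moment [i, j, k] = 0"
  by (rule gauss_moment_odd) simp

lemma gauss_moment_2: "gauss_moment [i, j] = (if i = j then 1 else 0)"
  by (simp add: gauss_moment_Cons)

text \<open>Isserlis' formula: one term for each of the three pairings of the four indices.\<close>

lemma gauss_moment_4: "gauss_moment [i, j, k, l] =
   (if i = j \<and> k = l then 1 else 0) + (if i = k \<and> j = l then 1 else 0) + (if i = l \<and> j = k then 1 else 0)"
  unfolding gauss_moment_Cons[of i "[j, k, l]"]
  by (cases "j = i"; cases "k = i"; cases "l = i"; simp add: gauss_moment_2)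

lemma has_avg_cong:
  "has_avg f m \<Longrightarrow> (\<And>v. g v = f v) \<Longrightarrow> m' = m \<Longrightarrow> has_avg g m'"
  by (metis ext)

section \<open>Gaussian moments of A(v) and B(v)\<close>

lemma tensor_A_nth:
  "tensor_A (v :: real^'d::finite) $ i $ j = v $ i * v $ j - of_bool (i = j) / real CARD('d) * (norm v)\<^sup>2"
  by (simp add: tensor_A_def mat_def)

lemma vector_B_nth:
  "vector_B (v :: real^'d::finite) $ i = (norm v)\<^sup>2 * v $ i - (real CARD('d) + 2) * v $ i"
  by (simp add: vector_B_def left_diff_distrib)

text \<open>The quartic part gives the three pairings. Since the means of |v|^2 v_i v_j and |v|^4
  are (d + 2) times delta_ij and d (d + 2), the trace corrections change the coefficient of the
  pairing \<open>i = j \<and> k = l\<close> to 1 - 2 (d + 2) / d + (d + 2) / d = - 2 / d.\<close>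

lemma has_avg_tensor_A_tensor_A:
  "has_avg (\<lambda>v::real^'d::finite. tensor_A v $ i $ j * tensor_A v $ k $ l)
     (of_bool (i = k \<and> j = l) + of_bool (i = l \<and> j = k) - 2 / real CARD('d) * of_bool (i = j \<and> k = l))"
proof -
  let ?d = "real CARD('d)"
  let ?R = "\<lambda>n ks (v::real^'d). ((norm v)\<^sup>2) ^ n * (\<Prod>k\<leftarrow>ks. v $ k)"
  let ?m = "\<lambda>n ks. radial_factor ?d n (length ks) * gauss_moment (ks :: 'd list)"
  let ?a = "of_bool (i = j) / ?d" and ?b = "of_bool (k = l) / ?d"
  have "has_avg (\<lambda>v. ?R 0 [i, j, k, l] v - ?b * ?R 1 [i, j] v - ?a * ?R 1 [k, l] v + ?a * ?b * ?R 2 [] v)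
     (?m 0 [i, j, k, l] - ?b * ?m 1 [i, j] - ?a * ?m 1 [k, l] + ?a * ?b * ?m 2 [])"
    by (intro has_avg_add has_avg_diff has_avg_cmult has_avg_radial_monomial)
  then show ?thesis
    by (rule has_avg_cong)
      (simp_all add: tensor_A_nth gauss_moment_2 gauss_moment_4 numeral_2_eq_2 field_simps)
qed

text \<open>The product is an odd polynomial in v.\<close>

lemma has_avg_tensor_A_vector_B:
  "has_avg (\<lambda>v::real^'d::finite. tensor_A v $ i $ j * vector_B v $ k) 0"
proof -
  let ?d = "real CARD('d)"
  let ?R = "\<lambda>n ks (v::real^'d). ((norm v)\<^sup>2) ^ n * (\<Prod>k\<leftarrow>ks. v $ k)"
  let ?m = "\<lambda>n ks. radial_factor ?d n (length ks) * gauss_moment (ks :: 'd list)"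
  let ?a = "of_bool (i = j) / ?d"
  have "has_avg (\<lambda>v. ?R 1 [i, j, k] v - (?d + 2) * ?R 0 [i, j, k] v
       - ?a * ?R 2 [k] v + (?d + 2) * ?a * ?R 1 [k] v)
     (?m 1 [i, j, k] - (?d + 2) * ?m 0 [i, j, k] - ?a * ?m 2 [k] + (?d + 2) * ?a * ?m 1 [k])"
    by (intro has_avg_add has_avg_diff has_avg_cmult has_avg_radial_monomial)
  then show ?thesis
    by (rule has_avg_cong)
      (simp_all add: tensor_A_nth vector_B_nth gauss_moment_1 gauss_moment_3
        numeral_2_eq_2 field_simps)
qed

text \<open>By isotropy the mean of |v|^(2 n) v_i v_j is delta_ij / d times that of |v|^(2 n + 2),
  which the trace correction in A cancels.\<close>

lemma has_avg_tensor_A_radial: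
  "has_avg (\<lambda>v::real^'d::finite. ((norm v)\<^sup>2) ^ n * tensor_A v $ i $ j) 0"
proof -
  let ?d = "real CARD('d)"
  let ?R = "\<lambda>n ks (v::real^'d). ((norm v)\<^sup>2) ^ n * (\<Prod>k\<leftarrow>ks. v $ k)"
  let ?m = "\<lambda>n ks. radial_factor ?d n (length ks) * gauss_moment (ks :: 'd list)"
  let ?a = "of_bool (i = j) / ?d"
  have "has_avg (\<lambda>v. ?R n [i, j] v - ?a * ?R (Suc n) [] v) (?m n [i, j] - ?a * ?m (Suc n) [])"
    by (intro has_avg_diff has_avg_cmult has_avg_radial_monomial)
  then show ?thesis
    by (rule has_avg_cong) (simp_all add: tensor_A_nth gauss_moment_2 algebra_simps numeral_2_eq_2)
qed

text \<open>The constant is (d + 2) (d + 4) - 2 (d + 2)^2 + (d + 2)^2, from the means of v_i v_j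
  multiplied by |v|^4, |v|^2 and 1.\<close>

lemma has_avg_vector_B_vector_B:
  "has_avg (\<lambda>v::real^'d::finite. vector_B v $ i * vector_B v $ j) (of_bool (i = j) * (2 * (real CARD('d) + 2)))"
proof -
  let ?d = "real CARD('d)"
  let ?R = "\<lambda>n ks (v::real^'d). ((norm v)\<^sup>2) ^ n * (\<Prod>k\<leftarrow>ks. v $ k)"
  let ?m = "\<lambda>n ks. radial_factor ?d n (length ks) * gauss_moment (ks :: 'd list)"
  have "has_avg (\<lambda>v. ?R 2 [i, j] v - 2 * (?d + 2) * ?R 1 [i, j] v + (?d + 2)\<^sup>2 * ?R 0 [i, j] v)
     (?m 2 [i, j] - 2 * (?d + 2) * ?m 1 [i, j] + (?d + 2)\<^sup>2 * ?m 0 [i, j])"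
    by (intro has_avg_add has_avg_diff has_avg_cmult has_avg_radial_monomial)
  then show ?thesis
    by (rule has_avg_cong)
      (simp_all add: vector_B_nth gauss_moment_2 power2_eq_square[of "_ + _"] numeral_2_eq_2 algebra_simps)
qed

lemma has_avg_vector_B_radial:
  "has_avg (\<lambda>v::real^'d::finite. ((norm v)\<^sup>2) ^ n * vector_B v $ i) 0"
proof -
  let ?d = "real CARD('d)"
  let ?R = "\<lambda>n ks (v::real^'d). ((norm v)\<^sup>2) ^ n * (\<Prod>k\<leftarrow>ks. v $ k)"
  let ?m = "\<lambda>n ks. radial_factor ?d n (length ks) * gauss_moment (ks :: 'd list)"
  have "has_avg (\<lambda>v. ?R (Suc n) [i] v - (?d + 2) * ?R n [i] v) (?m (Suc n) [i] - (?d + 2) * ?m n [i])"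
    by (intro has_avg_diff has_avg_cmult has_avg_radial_monomial)
  then show ?thesis
    by (rule has_avg_cong) (simp_all add: vector_B_nth gauss_moment_1 algebra_simps)
qed

text \<open>The shape of the second-order terms of the explicit part of the equation for \<open>g\<close>.\<close>

definition quadratic_source ::
  "('d::finite \<Rightarrow> 'd \<Rightarrow> real) \<Rightarrow> ('d \<Rightarrow> real) \<Rightarrow> real \<Rightarrow> real \<Rightarrow> real \<Rightarrow> real^'d \<Rightarrow> real" where
  "quadratic_source X Y \<alpha> \<beta> \<gamma> v = (\<Sum>k\<in>UNIV. \<Sum>l\<in>UNIV. X k l * tensor_A v $ k $ l)
     + (\<Sum>k\<in>UNIV. Y k * vector_B v $ k) + (\<alpha> * ((norm v)\<^sup>2)\<^sup>2 + \<beta> * (norm v)\<^sup>2 + \<gamma>)"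

text \<open>Only the A part survives, as B is odd and A is orthogonal to radial functions.
  Contracting X with the mean of A A leaves twice its symmetric trace-free part, the shape of a
  viscous stress.\<close>

lemma has_avg_quadratic_source_tensor_A:
  fixes X :: "'d::finite \<Rightarrow> 'd \<Rightarrow> real"
  shows "has_avg (\<lambda>v. quadratic_source X Y \<alpha> \<beta> \<gamma> v * tensor_A v $ m $ n)
     (X m n + X n m - of_bool (m = n) * (2 / real CARD('d) * (\<Sum>k\<in>UNIV. X k k)))"
proof -
  let ?d = "real CARD('d)"
  let ?A = "\<lambda>v::real^'d. tensor_A v $ m $ n"
  have "has_avg (\<lambda>v::real^'d.
      (\<Sum>k\<in>UNIV. \<Sum>l\<in>UNIV. X k l * (tensor_A v $ k $ l * ?A v))
      + (\<Sum>k\<in>UNIV. Y k * (?A v * vector_B v $ k))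
      + (\<alpha> * (((norm v)\<^sup>2) ^ 2 * ?A v) + \<beta> * (((norm v)\<^sup>2) ^ 1 * ?A v) + \<gamma> * (((norm v)\<^sup>2) ^ 0 * ?A v)))
    ((\<Sum>k\<in>UNIV. \<Sum>l\<in>UNIV. X k l * (of_bool (k = m \<and> l = n) + of_bool (k = n \<and> l = m)
        - 2 / ?d * of_bool (k = l \<and> m = n)))
      + (\<Sum>k\<in>UNIV. Y k * 0) + (\<alpha> * 0 + \<beta> * 0 + \<gamma> * 0))"
    by (intro has_avg_add has_avg_sum has_avg_cmult has_avg_tensor_A_tensor_A
        has_avg_tensor_A_vector_B has_avg_tensor_A_radial)
  moreover have "(\<Sum>k\<in>UNIV. \<Sum>l\<in>UNIV. X k l * of_bool (k = p \<and> l = q)) = X p q" for p q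
  proof -
    have "(\<Sum>k\<in>UNIV. \<Sum>l\<in>UNIV. X k l * of_bool (k = p \<and> l = q)) =
       (\<Sum>k\<in>UNIV. if k = p then X p q else 0)"
      by (rule sum.cong) (auto simp: of_bool_def if_distrib cong: if_cong)
    then show ?thesis by simp
  qed
  moreover have "(\<Sum>k\<in>UNIV. \<Sum>l\<in>UNIV. X k l * (2 / ?d * of_bool (k = l \<and> m = n))) =
      of_bool (m = n) * (2 / ?d * (\<Sum>k\<in>UNIV. X k k))"
  proof -
    have "(\<Sum>l\<in>UNIV. X k l * (2 / ?d * of_bool (k = l \<and> m = n))) = of_bool (m = n) * (2 / ?d * X k k)" for k
    proof -
      have "(\<Sum>l\<in>UNIV. X k l * (2 / ?d * of_bool (k = l \<and> m = n))) =
          (\<Sum>l\<in>UNIV. if k = l then of_bool (m = n) * (2 / ?d * X k k) else 0)"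
        by (rule sum.cong) auto
      then show ?thesis by simp
    qed
    then show ?thesis by (simp add: sum_distrib_left)
  qed
  ultimately show ?thesis
    by (elim has_avg_cong)
      (simp_all add: quadratic_source_def sum.distrib sum_subtractf distrib_left right_diff_distrib
        distrib_right sum_distrib_right mult.assoc mult.commute[of "tensor_A _ $ m $ n" "vector_B _ $ _"])
qed

text \<open>Parity removes the A part and the radial part; the constant is that of the mean of B
  B.\<close>

lemma has_avg_quadratic_source_vector_B:
  fixes X :: "'d::finite \<Rightarrow> 'd \<Rightarrow> real"
  shows "has_avg (\<lambda>v. quadratic_source X Y \<alpha> \<beta> \<gamma> v * vector_B v $ m) (2 * (real CARD('d) + 2) * Y m)"
proof -
  let ?d = "real CARD('d)"
  let ?B = "\<lambda>v::real^'d. vector_B v $ m"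
  have "has_avg (\<lambda>v::real^'d.
      (\<Sum>k\<in>UNIV. \<Sum>l\<in>UNIV. X k l * (tensor_A v $ k $ l * ?B v))
      + (\<Sum>k\<in>UNIV. Y k * (vector_B v $ k * ?B v))
      + (\<alpha> * (((norm v)\<^sup>2) ^ 2 * ?B v) + \<beta> * (((norm v)\<^sup>2) ^ 1 * ?B v) + \<gamma> * (((norm v)\<^sup>2) ^ 0 * ?B v)))
    ((\<Sum>k\<in>UNIV. \<Sum>l\<in>UNIV. X k l * 0)
      + (\<Sum>k\<in>UNIV. Y k * (of_bool (k = m) * (2 * (?d + 2)))) + (\<alpha> * 0 + \<beta> * 0 + \<gamma> * 0))"
    by (intro has_avg_add has_avg_sum has_avg_cmult has_avg_vector_B_vector_B
        has_avg_tensor_A_vector_B has_avg_vector_B_radial)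
  moreover have "(\<Sum>k\<in>UNIV. Y k * (of_bool (k = m) * (2 * (?d + 2)))) = 2 * (?d + 2) * Y m"
  proof -
    have "(\<Sum>k\<in>UNIV. Y k * (of_bool (k = m) * (2 * (?d + 2)))) =
        (\<Sum>k\<in>UNIV. if k = m then 2 * (?d + 2) * Y m else 0)"
      by (rule sum.cong) auto
    then show ?thesis by simp
  qed
  ultimately show ?thesis
    by (elim has_avg_cong) (simp_all add: quadratic_source_def distrib_right sum_distrib_right mult.assoc)
qed

subsection \<open>Second-order expansion of the local Maxwellian\<close>

text \<open>Second Taylor remainder divided by x^2, completed at 0 by its limit 1 / 2. With it and
  \<open>ln_rem\<close> the second-order expansions are exact identities whose coefficients are
  continuous at 0, which replaces error estimates.\<close>

definition exp_rem :: "real \<Rightarrow> real" where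
  "exp_rem x = (if x = 0 then 1 / 2 else (exp x - 1 - x) / x\<^sup>2)"

definition ln_rem :: "real \<Rightarrow> real" where
  "ln_rem x = (if x = 0 then 1 / 2 else (x - ln (1 + x)) / x\<^sup>2)"

lemma exp_eq_rem: "exp x = 1 + x + x\<^sup>2 * exp_rem x"
  by (simp add: exp_rem_def)

lemma ln_eq_rem: "ln (1 + x) = x - x\<^sup>2 * ln_rem x"
  by (simp add: ln_rem_def)

lemma tendsto_remI:
  assumes "isCont f 0" "f 0 = (1/2 :: real)" "(x \<longlongrightarrow> (0::real)) F"
  shows "((\<lambda>e. f (x e)) \<longlongrightarrow> 1 / 2) F"
  using isCont_tendsto_compose[OF assms(1,3)] assms(2) by simp

lemma isCont_exp_rem: "isCont exp_rem 0"
proof -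
  have "((\<lambda>x::real. (exp x - 1 - x) / x\<^sup>2) \<longlongrightarrow> 1 / 2) (at 0)" by real_asymp
  then have "(exp_rem \<longlongrightarrow> 1 / 2) (at 0)"
    by (rule Lim_transform_eventually) (auto simp: exp_rem_def eventually_at intro: exI[of _ 1])
  then show ?thesis by (simp add: isCont_def exp_rem_def[of 0])
qed

lemma isCont_ln_rem: "isCont ln_rem 0"
proof -
  have "((\<lambda>x::real. (x - ln (1 + x)) / x\<^sup>2) \<longlongrightarrow> 1 / 2) (at 0)" by real_asymp
  then have "(ln_rem \<longlongrightarrow> 1 / 2) (at 0)"
    by (rule Lim_transform_eventually) (auto simp: ln_rem_def eventually_at intro: exI[of _ 1])
  then show ?thesis by (simp add: isCont_def ln_rem_def[of 0])
qed

text \<open>The prefactors move into the exponent through logarithms and the powers of 2 pi cancel,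
  so that a single exponent has to be expanded in \<epsilon>.\<close>

lemma local_maxwellian_ratio:
  assumes "\<rho>F > 0" "TF > 0"
  shows "local_maxwellian \<rho>F uF TF v / maxwellian v =
    exp (ln \<rho>F - real CARD('d) / 2 * ln TF + (norm (v::real^'d::finite))\<^sup>2 / 2 - (norm (v - uF))\<^sup>2 / (2 * TF))"
proof -
  let ?h = "real CARD('d) / 2"
  have "(2 * pi * TF) powr ?h = (2 * pi) powr ?h * TF powr ?h"
    using assms by (simp add: powr_mult)
  then have "local_maxwellian \<rho>F uF TF v / maxwellian v
    = \<rho>F / TF powr ?h * (exp (- ((norm (v - uF))\<^sup>2 / (2 * TF))) / exp (- ((norm v)\<^sup>2 / 2)))"
    by (simp add: local_maxwellian_def maxwellian_def powr_minus field_simps)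
  also have "exp (- ((norm (v - uF))\<^sup>2 / (2 * TF))) / exp (- ((norm v)\<^sup>2 / 2))
    = exp ((norm v)\<^sup>2 / 2 - (norm (v - uF))\<^sup>2 / (2 * TF))"
    by (simp flip: exp_diff)
  also have "\<rho>F / TF powr ?h = exp (ln \<rho>F - ?h * ln TF)"
    using assms by (simp add: exp_diff powr_def)
  finally show ?thesis by (simp flip: exp_add add: algebra_simps)
qed

text \<open>With \<open>T\<^sub>F = 1 + \<epsilon> \<theta>\<close> and \<open>\<theta> = T + \<epsilon> \<eta>\<close>, the exponent of \<open>M\<^sub>F / M\<close> is
  \<open>\<epsilon> L\<^sub>1 + \<epsilon>\<^sup>2 L\<^sub>2\<close>.\<close>

lemma maxwellian_exponent_expansion:
  fixes e \<rho> \<theta> \<eta> T d V N U :: real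
  assumes "1 + e * \<rho> > 0" "1 + e * \<theta> > 0" and \<theta>: "\<theta> = T + e * \<eta>"
  shows "ln (1 + e * \<rho>) - d / 2 * ln (1 + e * \<theta>) + N / 2
      - (N - 2 * (e / (1 + e * \<rho>)) * V + (e / (1 + e * \<rho>))\<^sup>2 * U) / (2 * (1 + e * \<theta>))
    = e * (\<rho> + V + (N - d) / 2 * T) + e\<^sup>2 * (- \<rho>\<^sup>2 * ln_rem (e * \<rho>)
      - d / 2 * (\<eta> - \<theta>\<^sup>2 * ln_rem (e * \<theta>)) + N / 2 * ((\<eta> - \<theta> * T) / (1 + e * \<theta>))
      - V * ((\<rho> + \<theta> + e * \<rho> * \<theta>) / ((1 + e * \<rho>) * (1 + e * \<theta>)))
      - U / (2 * (1 + e * \<rho>)\<^sup>2 * (1 + e * \<theta>)))" (is "?l = ?r")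
proof -
  \<comment> \<open>In the application \<open>N\<close>, \<open>V\<close>, \<open>U\<close> are
    |v|^2, v . u and |u|^2. The first-order part is the linear term that Q subtracts; the
    second-order part is kept exact, still depending on e.\<close>
  have ne: "1 + e * \<rho> \<noteq> 0" "1 + e * \<theta> \<noteq> 0" using assms by auto
  have 1: "N / 2 - N / (2 * (1 + e * \<theta>)) = e * (N / 2 * T) + e\<^sup>2 * (N / 2 * ((\<eta> - \<theta> * T) / (1 + e * \<theta>)))"
  proof -
    \<comment> \<open>Exact division with remainder: the quotient of \<theta> by 1 + e \<theta> is T
      up to a term of order e.\<close>
    have num: "e * \<theta> = e * T * (1 + e * \<theta>) + e\<^sup>2 * (\<eta> - \<theta> * T)"
      unfolding \<theta> by (simp add: power2_eq_square algebra_simps)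
    have "N / 2 - N / (2 * (1 + e * \<theta>)) = N / 2 * (e * \<theta> / (1 + e * \<theta>))"
      using ne by (simp add: field_simps)
    also have "e * \<theta> / (1 + e * \<theta>) = (e * T * (1 + e * \<theta>) + e\<^sup>2 * (\<eta> - \<theta> * T)) / (1 + e * \<theta>)"
      by (rule arg_cong[OF num, of "\<lambda>x. x / (1 + e * \<theta>)"])
    also have "(e * T * (1 + e * \<theta>) + e\<^sup>2 * (\<eta> - \<theta> * T)) / (1 + e * \<theta>)
        = e * T + e\<^sup>2 * ((\<eta> - \<theta> * T) / (1 + e * \<theta>))"
      using ne(2) by (simp add: add_divide_distrib)
    finally show ?thesis by (simp only: distrib_left mult.left_commute[of "N / 2"])
  qed
  have 2: "(2 * (e / (1 + e * \<rho>)) * V) / (2 * (1 + e * \<theta>)) = e * V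
      - e\<^sup>2 * (V * ((\<rho> + \<theta> + e * \<rho> * \<theta>) / ((1 + e * \<rho>) * (1 + e * \<theta>))))"
  proof -
    let ?PQ = "(1 + e * \<rho>) * (1 + e * \<theta>)"
    have PQ: "e * (\<rho> + \<theta> + e * \<rho> * \<theta>) = ?PQ - 1" by (simp add: algebra_simps)
    have "e\<^sup>2 * (V * ((\<rho> + \<theta> + e * \<rho> * \<theta>) / ?PQ)) = e * V * (e * (\<rho> + \<theta> + e * \<rho> * \<theta>) / ?PQ)"
      by (simp add: power2_eq_square)
    also have "\<dots> = e * V * (1 - 1 / ?PQ)"
      unfolding PQ using ne by (simp add: diff_divide_distrib)
    finally have "e * V - e\<^sup>2 * (V * ((\<rho> + \<theta> + e * \<rho> * \<theta>) / ?PQ)) = e * V * (1 / ?PQ)"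
      by (simp only: right_diff_distrib)
    moreover have "2 * (e / P) * V / (2 * Q) = e * V * (1 / (P * Q))" for P Q :: real by simp
    ultimately show ?thesis by metis
  qed
  have 3: "(e / (1 + e * \<rho>))\<^sup>2 * U / (2 * (1 + e * \<theta>)) = e\<^sup>2 * (U / (2 * (1 + e * \<rho>)\<^sup>2 * (1 + e * \<theta>)))"
    by (simp add: power_divide)
  have 4: "ln (1 + e * \<rho>) = e * \<rho> + e\<^sup>2 * (- \<rho>\<^sup>2 * ln_rem (e * \<rho>))"
    by (simp add: ln_eq_rem power_mult_distrib)
  have 5: "d / 2 * ln (1 + e * \<theta>) = e * (d / 2 * T) + e\<^sup>2 * (d / 2 * (\<eta> - \<theta>\<^sup>2 * ln_rem (e * \<theta>)))"
    unfolding ln_eq_rem power_mult_distrib by (simp add: \<theta> algebra_simps power2_eq_square)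
  have "?l = ln (1 + e * \<rho>) - d / 2 * ln (1 + e * \<theta>) + (N / 2 - N / (2 * (1 + e * \<theta>)))
     + (2 * (e / (1 + e * \<rho>)) * V) / (2 * (1 + e * \<theta>)) - (e / (1 + e * \<rho>))\<^sup>2 * U / (2 * (1 + e * \<theta>))"
    by (simp add: diff_divide_distrib add_divide_distrib)
  also have "\<dots> = ?r" unfolding 1 2 3 4 5 by (simp add: algebra_simps diff_divide_distrib)
  finally show ?thesis .
qed

text \<open>The limit is the second-order coefficient L2 + L1^2 / 2 of the exponential, divided by
  \<tau>. As \<rho> tends to - T0, L1 tends to v . u0 + (|v|^2 - (d + 2)) / 2 T0. In the limit of L2
  the term in v . u0 drops out because \<rho> + \<theta> tends to 0, and - |v|^2 |u0|^2 / (2 d) -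
  T0^2 (1 / 2 + d / 4) remains.\<close>

lemma collision_Q_limit:
  fixes v u0 :: "real^'d::finite"
  assumes \<tau>: "\<tau> > 0"
    and u: "(u \<longlongrightarrow> u0) (at_right 0)" and r: "(\<rho> \<longlongrightarrow> - T0) (at_right 0)" and T: "(T \<longlongrightarrow> T0) (at_right 0)"
  shows "((\<lambda>\<epsilon>. collision_Q \<tau> \<epsilon> (u \<epsilon>) (\<rho> \<epsilon>) (T \<epsilon>) v) \<longlongrightarrow>
    1 / \<tau> * (((v \<bullet> u0)\<^sup>2 - (norm v)\<^sup>2 * (norm u0)\<^sup>2 / real CARD('d)) / 2
      + ((norm v)\<^sup>2 - (real CARD('d) + 2)) / 2 * T0 * (v \<bullet> u0)
      + T0\<^sup>2 * (((norm v)\<^sup>2 - (real CARD('d) + 2))\<^sup>2 / 8 - 1 / 2 - real CARD('d) / 4))) (at_right 0)"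
proof -
  let ?d = "real CARD('d)" and ?N = "(norm v)\<^sup>2"
  \<comment> \<open>The second-order part of T_F: T / (1 + e \<rho>) equals T - e T \<rho> / (1 + e
    \<rho>), and the kinetic term is of second order already.\<close>
  define \<eta> where "\<eta> e = - T e * \<rho> e / (1 + e * \<rho> e) - (norm (u e))\<^sup>2 / (?d * (1 + e * \<rho> e)\<^sup>2)" for e
  define \<theta> where "\<theta> e = T e + e * \<eta> e" for e
  define L1 where "L1 e = \<rho> e + v \<bullet> u e + (?N - ?d) / 2 * T e" for e
  define L2 where "L2 e = - (\<rho> e)\<^sup>2 * ln_rem (e * \<rho> e)
      - ?d / 2 * (\<eta> e - (\<theta> e)\<^sup>2 * ln_rem (e * \<theta> e)) + ?N / 2 * ((\<eta> e - \<theta> e * T e) / (1 + e * \<theta> e))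
      - (v \<bullet> u e) * ((\<rho> e + \<theta> e + e * \<rho> e * \<theta> e) / ((1 + e * \<rho> e) * (1 + e * \<theta> e)))
      - (norm (u e))\<^sup>2 / (2 * (1 + e * \<rho> e)\<^sup>2 * (1 + e * \<theta> e))" for e
  have id: "((\<lambda>e::real. e) \<longlongrightarrow> 0) (at_right 0)" by (rule tendsto_ident_at)
  have \<rho>0: "((\<lambda>e. e * \<rho> e) \<longlongrightarrow> 0) (at_right 0)" using tendsto_mult[OF id r] by simp
  have \<rho>1: "((\<lambda>e. 1 + e * \<rho> e) \<longlongrightarrow> 1) (at_right 0)" using tendsto_add[OF tendsto_const \<rho>0] by simp
  have \<eta>: "(\<eta> \<longlongrightarrow> - T0 * - T0 / 1 - (norm u0)\<^sup>2 / (?d * 1\<^sup>2)) (at_right 0)"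
    unfolding \<eta>_def by (intro tendsto_intros \<rho>1 u r T) auto
  have \<theta>: "(\<theta> \<longlongrightarrow> T0) (at_right 0)"
    unfolding \<theta>_def using tendsto_add[OF T tendsto_mult[OF id \<eta>]] by simp
  have \<theta>0: "((\<lambda>e. e * \<theta> e) \<longlongrightarrow> 0) (at_right 0)" using tendsto_mult[OF id \<theta>] by simp
  have \<theta>1: "((\<lambda>e. 1 + e * \<theta> e) \<longlongrightarrow> 1) (at_right 0)" using tendsto_add[OF tendsto_const \<theta>0] by simp
  note ln_lim = tendsto_remI[OF isCont_ln_rem] 
  have ln0: "ln_rem 0 = 1 / 2" "exp_rem 0 = 1 / 2" by (simp_all add: ln_rem_def exp_rem_def)
  have L1: "(L1 \<longlongrightarrow> - T0 + v \<bullet> u0 + (?N - ?d) / 2 * T0) (at_right 0)"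
    unfolding L1_def by (intro tendsto_intros r u T)
  have L2: "(L2 \<longlongrightarrow> - (- T0)\<^sup>2 * (1 / 2)
      - ?d / 2 * ((- T0 * - T0 / 1 - (norm u0)\<^sup>2 / (?d * 1\<^sup>2)) - T0\<^sup>2 * (1 / 2))
      + ?N / 2 * (((- T0 * - T0 / 1 - (norm u0)\<^sup>2 / (?d * 1\<^sup>2)) - T0 * T0) / 1)
      - (v \<bullet> u0) * ((- T0 + T0 + 0 * - T0 * T0) / (1 * 1))
      - (norm u0)\<^sup>2 / (2 * 1\<^sup>2 * 1)) (at_right 0)"
    unfolding L2_def
    by (intro tendsto_intros \<rho>1 \<theta>1 \<eta> \<theta> u r T id ln_lim[OF ln0(1)] \<rho>0 \<theta>0) auto
  have L: "((\<lambda>e. e * (L1 e + e * L2 e)) \<longlongrightarrow> 0) (at_right 0)"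
    using tendsto_mult[OF id tendsto_add[OF L1 tendsto_mult[OF id L2]]] by simp
  have lim: "((\<lambda>e. 1 / \<tau> * (L2 e + (L1 e + e * L2 e)\<^sup>2 * exp_rem (e * (L1 e + e * L2 e)))) \<longlongrightarrow>
    1 / \<tau> * ((- (- T0)\<^sup>2 * (1 / 2)
      - ?d / 2 * ((- T0 * - T0 / 1 - (norm u0)\<^sup>2 / (?d * 1\<^sup>2)) - T0\<^sup>2 * (1 / 2))
      + ?N / 2 * (((- T0 * - T0 / 1 - (norm u0)\<^sup>2 / (?d * 1\<^sup>2)) - T0 * T0) / 1)
      - (v \<bullet> u0) * ((- T0 + T0 + 0 * - T0 * T0) / (1 * 1))
      - (norm u0)\<^sup>2 / (2 * 1\<^sup>2 * 1))
     + ((- T0 + v \<bullet> u0 + (?N - ?d) / 2 * T0) + 0 * (- (- T0)\<^sup>2 * (1 / 2)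
      - ?d / 2 * ((- T0 * - T0 / 1 - (norm u0)\<^sup>2 / (?d * 1\<^sup>2)) - T0\<^sup>2 * (1 / 2))
      + ?N / 2 * (((- T0 * - T0 / 1 - (norm u0)\<^sup>2 / (?d * 1\<^sup>2)) - T0 * T0) / 1)
      - (v \<bullet> u0) * ((- T0 + T0 + 0 * - T0 * T0) / (1 * 1))
      - (norm u0)\<^sup>2 / (2 * 1\<^sup>2 * 1)))\<^sup>2 * (1 / 2))) (at_right 0)"
    by (intro tendsto_intros L1 L2 id tendsto_remI[OF isCont_exp_rem ln0(2)] L)
  \<comment> \<open>For small e > 0 both 1 + e \<rho> and 1 + e \<theta> are positive, as the
    logarithms in the exponent require.\<close>
  have ev: "\<forall>\<^sub>F e in at_right 0. 1 / \<tau> * (L2 e + (L1 e + e * L2 e)\<^sup>2 * exp_rem (e * (L1 e + e * L2 e)))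
    = collision_Q \<tau> e (u e) (\<rho> e) (T e) v"
    using order_tendstoD(1)[OF \<rho>1, of 0, simplified] order_tendstoD(1)[OF \<theta>1, of 0, simplified]
      eventually_at_right_less[of 0]
  proof eventually_elim
    case (elim e)
    have TF: "1 + e * (T e / (1 + e * \<rho> e)) - e\<^sup>2 * ((norm (u e))\<^sup>2 / (?d * (1 + e * \<rho> e)\<^sup>2)) = 1 + e * \<theta> e"
    proof -
      have *: "T e / (1 + e * \<rho> e) = T e + e * (- T e * \<rho> e / (1 + e * \<rho> e))"
        using elim by (simp add: field_simps)
      show ?thesis unfolding * \<theta>_def \<eta>_def by (simp add: power2_eq_square algebra_simps)
    qed
    have n: "(norm (v - (e / (1 + e * \<rho> e)) *\<^sub>R u e))\<^sup>2 =
      ?N - 2 * (e / (1 + e * \<rho> e)) * (v \<bullet> u e) + (e / (1 + e * \<rho> e))\<^sup>2 * (norm (u e))\<^sup>2"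
      by (simp only: power2_norm_eq_inner)
        (simp add: inner_diff_left inner_diff_right inner_commute power2_eq_square)
    have "local_maxwellian (1 + e * \<rho> e) ((e / (1 + e * \<rho> e)) *\<^sub>R u e) (1 + e * \<theta> e) v / maxwellian v
       = exp (e * L1 e + e\<^sup>2 * L2 e)"
      unfolding local_maxwellian_ratio[OF elim(1,2)] n L1_def L2_def
      by (subst maxwellian_exponent_expansion[OF elim(1,2) \<theta>_def]) simp
    also have "e * L1 e + e\<^sup>2 * L2 e = e * (L1 e + e * L2 e)"
      by (simp add: power2_eq_square algebra_simps)
    finally have M: "local_maxwellian (1 + e * \<rho> e) ((e / (1 + e * \<rho> e)) *\<^sub>R u e) (1 + e * \<theta> e) v / maxwellian v
       - 1 - e * L1 e = e\<^sup>2 * (L2 e + (L1 e + e * L2 e)\<^sup>2 * exp_rem (e * (L1 e + e * L2 e)))"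
      unfolding exp_eq_rem[of "e * (L1 e + e * L2 e)"] by (simp add: power2_eq_square algebra_simps)
    show ?case
      using elim \<tau> unfolding collision_Q_def Let_def TF L1_def[symmetric] M by simp
  qed
  \<comment> \<open>Writing |u0|^2 as d w removes the quotient by d, so that comparing the two forms
    of the limit is elementary algebra.\<close>
  define w where "w = (norm u0)\<^sup>2 / ?d"
  have U: "(norm u0)\<^sup>2 = ?d * w" by (simp add: w_def)
  show ?thesis
    using Lim_transform_eventually[OF lim ev] unfolding U
    by (elim back_subst[of "\<lambda>l. (_ \<longlongrightarrow> l) _"], intro arg_cong[where f = "(*) (1 / \<tau>)"], simp)
      (simp add: field_simps power2_eq_square)
qed

subsection \<open>Moments of the microscopic part and formal limits\<close>

lemma norm_axis_eq: "norm (axis i x :: 'b::real_normed_vector ^ 'n::finite) = norm x"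
  by (simp add: norm_vec_def L2_set_def axis_def if_distrib[of norm] if_distrib[of "\<lambda>x. x\<^sup>2"] cong: if_cong)

lemma bounded_linear_axis: "bounded_linear (\<lambda>x. axis i x :: 'b::real_normed_vector ^ 'n::finite)"
proof (rule bounded_linear_intro[where K = 1])
  show "norm (axis i x :: 'b ^ 'n) \<le> norm x * 1" for x :: 'b by (simp add: norm_axis_eq)
qed (simp_all add: axis_def vec_eq_iff)

lemma sum_axis_nth: "(\<Sum>i\<in>UNIV. axis i (x $ i)) = (x :: 'b::real_normed_vector ^ 'n::finite)"
  by (simp add: vec_eq_iff axis_def)

lemma differentiable_vec_componentwise:
  fixes f :: "'a::real_normed_vector \<Rightarrow> 'b::real_normed_vector ^ 'n::finite"
  assumes "\<And>i. (\<lambda>y. f y $ i) differentiable (at x)"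
  shows "f differentiable (at x)"
proof -
  have "(\<lambda>y. axis i (f y $ i) :: 'b ^ 'n) differentiable (at x)" for i
    by (rule differentiable_bounded_linear[OF bounded_linear_axis, of "\<lambda>y. f y $ i"]) (rule assms)
  then have "(\<lambda>y. \<Sum>i\<in>UNIV. axis i (f y $ i)) differentiable (at x)"
    by (intro differentiable_sum ballI finite)
  then show ?thesis by (simp only: sum_axis_nth)
qed

lemma divergence_eq_sum_components:
  assumes "\<And>n. (\<lambda>y. f y $ n) differentiable (at x)"
  shows "divergence f x = (\<Sum>n\<in>UNIV. partial n (\<lambda>y. f y $ n) x)"
  unfolding divergence_def
  by (rule sum.cong[OF refl], rule partial_nth[symmetric], rule differentiable_vec_componentwise, rule assms)

lemma integrable_avg_componentwise:
  fixes f :: "real^'d::finite \<Rightarrow> 'b::euclidean_space ^ 'n::finite"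
  assumes "\<And>i. integrable lborel (\<lambda>v. maxwellian v *\<^sub>R f v $ i)"
  shows "integrable lborel (\<lambda>v. maxwellian v *\<^sub>R f v)"
proof -
  have "integrable lborel (\<lambda>v. \<Sum>i\<in>UNIV. axis i ((maxwellian v *\<^sub>R f v) $ i))"
    by (rule Bochner_Integration.integrable_sum, rule integrable_bounded_linear[OF bounded_linear_axis])
      (simp add: assms)
  then show ?thesis by (simp only: sum_axis_nth)
qed

lemma avg_nth:
  fixes f :: "real^'d::finite \<Rightarrow> 'b::euclidean_space ^ 'n::finite"
  assumes "\<And>i. integrable lborel (\<lambda>v. maxwellian v *\<^sub>R f v $ i)"
  shows "avg f $ i = avg (\<lambda>v. f v $ i)"
  unfolding avg_def
  using integral_bounded_linear[OF bounded_linear_vec_nth integrable_avg_componentwise[of f, OF assms], of i]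
  by simp

lemma has_avg_vec:
  fixes f :: "real^'d::finite \<Rightarrow> real ^ 'n::finite"
  assumes "\<And>i. has_avg (\<lambda>v. f v $ i) (m i)"
  shows "avg f $ i = m i"
  using avg_nth[of f i] has_avg_integrable[OF assms] has_avg_avg[OF assms] by simp

lemma has_avg_mat:
  fixes f :: "real^'d::finite \<Rightarrow> real ^ 'n::finite ^ 'm::finite"
  assumes "\<And>i j. has_avg (\<lambda>v. f v $ i $ j) (m i j)"
  shows "avg f $ i $ j = m i j"
proof -
  have "integrable lborel (\<lambda>v. maxwellian v *\<^sub>R f v $ i)" for i
    by (rule integrable_avg_componentwise) (use has_avg_integrable[OF assms] in simp)
  then have "avg f $ i = avg (\<lambda>v. f v $ i)" by (rule avg_nth)
  also have "\<dots> $ j = m i j" by (rule has_avg_vec) (rule assms)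
  finally show ?thesis .
qed

text \<open>\<open>C1_limit\<close> strengthened by differentiability of the limit and, for small
  \<epsilon>, of the family at each point: with it the sum and scaling rules for
  \<open>partial\<close> apply, so the notion is closed under linear operations.\<close>

definition C1_conv ::
  "(real^'d::finite) set \<Rightarrow> (real \<Rightarrow> real^'d \<Rightarrow> real) \<Rightarrow> (real^'d \<Rightarrow> real) \<Rightarrow> bool" where
  "C1_conv D F f \<longleftrightarrow> (\<forall>x\<in>D. f differentiable (at x) \<and>
     (\<forall>\<^sub>F \<epsilon> in at_right 0. F \<epsilon> differentiable (at x)) \<and>
     ((\<lambda>\<epsilon>. F \<epsilon> x) \<longlongrightarrow> f x) (at_right 0) \<and>
     (\<forall>k. ((\<lambda>\<epsilon>. partial k (F \<epsilon>) x) \<longlongrightarrow> partial k f x) (at_right 0)))"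

lemma C1_convI:
  assumes "open D" "f differentiable_on D" "\<forall>\<^sub>F \<epsilon> in at_right 0. F \<epsilon> differentiable_on D" "C1_limit D F f"
  shows "C1_conv D F f"
  using assms unfolding C1_conv_def C1_limit_def
  by (auto elim!: eventually_mono intro: differentiable_on_openD)

lemma C1_conv_partial:
  "C1_conv D F f \<Longrightarrow> x \<in> D \<Longrightarrow> ((\<lambda>\<epsilon>. partial k (F \<epsilon>) x) \<longlongrightarrow> partial k f x) (at_right 0)"
  by (simp add: C1_conv_def)

text \<open>For each small \<epsilon> the equality is required on all of D at once, because a
  partial derivative at x depends on the values near x.\<close>

lemma C1_conv_cong:
  assumes D: "open D" and F: "C1_conv D F f"
    and eqF: "\<forall>\<^sub>F \<epsilon> in at_right 0. \<forall>y\<in>D. F \<epsilon> y = G \<epsilon> y" and eqf: "\<And>y. y \<in> D \<Longrightarrow> f y = g y"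
  shows "C1_conv D G g"
  unfolding C1_conv_def
proof (intro ballI conjI allI)
  fix x k assume x: "x \<in> D"
  note Fx = F[unfolded C1_conv_def, rule_format, OF x]
  show "g differentiable (at x)" by (rule differentiable_cong_open[of D x f g, OF D x eqf Fx[THEN conjunct1]])
  have "\<forall>\<^sub>F \<epsilon> in at_right 0. F \<epsilon> differentiable (at x)" using Fx by blast
  then show "\<forall>\<^sub>F \<epsilon> in at_right 0. G \<epsilon> differentiable (at x)"
    using eqF
  proof eventually_elim
    case (elim \<epsilon>)
    then show ?case by (intro differentiable_cong_open[of D x "F \<epsilon>" "G \<epsilon>"] D x) auto
  qed
  have "\<forall>\<^sub>F \<epsilon> in at_right 0. F \<epsilon> x = G \<epsilon> x" using eqF by eventually_elim (use x in auto)
  from Lim_transform_eventually[OF Fx[THEN conjunct2, THEN conjunct2, THEN conjunct1] this]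
  show "((\<lambda>\<epsilon>. G \<epsilon> x) \<longlongrightarrow> g x) (at_right 0)" by (simp only: eqf[OF x])
  have ev: "\<forall>\<^sub>F \<epsilon> in at_right 0. partial k (F \<epsilon>) x = partial k (G \<epsilon>) x"
    using eqF
  proof eventually_elim
    case (elim \<epsilon>)
    then show ?case by (intro partial_cong_open[of D x "F \<epsilon>" "G \<epsilon>"] D x) auto
  qed
  have eq: "partial k f x = partial k g x" by (rule partial_cong_open[of D x f g, OF D x eqf])
  show "((\<lambda>\<epsilon>. partial k (G \<epsilon>) x) \<longlongrightarrow> partial k g x) (at_right 0)"
    using Lim_transform_eventually[OF Fx[THEN conjunct2, THEN conjunct2, THEN conjunct2, THEN spec, of k] ev]
    by (simp only: eq)
qed

lemma C1_conv_const: "C1_conv D (\<lambda>\<epsilon> y. c) (\<lambda>y. c)"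
  by (simp add: C1_conv_def)

lemma C1_conv_add:
  assumes "C1_conv D F f" "C1_conv D G g"
  shows "C1_conv D (\<lambda>\<epsilon> y. F \<epsilon> y + G \<epsilon> y) (\<lambda>y. f y + g y)"
  unfolding C1_conv_def
proof (intro ballI conjI allI)
  fix x k assume x: "x \<in> D"
  note F = assms(1)[unfolded C1_conv_def, rule_format, OF x]
  note G = assms(2)[unfolded C1_conv_def, rule_format, OF x]
  have ev: "\<forall>\<^sub>F \<epsilon> in at_right 0. F \<epsilon> differentiable (at x) \<and> G \<epsilon> differentiable (at x)"
    using F G by (simp add: eventually_conj)
  show "(\<lambda>y. f y + g y) differentiable (at x)" using F G by simp
  show "\<forall>\<^sub>F \<epsilon> in at_right 0. (\<lambda>y. F \<epsilon> y + G \<epsilon> y) differentiable (at x)"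
    using ev by eventually_elim simp
  show "((\<lambda>\<epsilon>. F \<epsilon> x + G \<epsilon> x) \<longlongrightarrow> f x + g x) (at_right 0)" using F G by (intro tendsto_add) auto
  have eq: "\<forall>\<^sub>F \<epsilon> in at_right 0. partial k (F \<epsilon>) x + partial k (G \<epsilon>) x = partial k (\<lambda>y. F \<epsilon> y + G \<epsilon> y) x"
    using ev by eventually_elim (simp add: partial_add)
  have "((\<lambda>\<epsilon>. partial k (F \<epsilon>) x + partial k (G \<epsilon>) x) \<longlongrightarrow> partial k (\<lambda>y. f y + g y) x) (at_right 0)"
    using F G by (subst partial_add) (auto intro!: tendsto_add)
  from Lim_transform_eventually[OF this eq]
  show "((\<lambda>\<epsilon>. partial k (\<lambda>y. F \<epsilon> y + G \<epsilon> y) x) \<longlongrightarrow> partial k (\<lambda>y. f y + g y) x) (at_right 0)" .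
qed

text \<open>The factor may vary with \<epsilon>; taking it to be \<epsilon> itself makes the
  contribution of (I - P)(v g) vanish in the limit.\<close>

lemma C1_conv_scale:
  assumes c: "(c \<longlongrightarrow> c0) (at_right 0)" and "C1_conv D F f"
  shows "C1_conv D (\<lambda>\<epsilon> y. c \<epsilon> * F \<epsilon> y) (\<lambda>y. c0 * f y)"
  unfolding C1_conv_def
proof (intro ballI conjI allI)
  fix x k assume x: "x \<in> D"
  note F = assms(2)[unfolded C1_conv_def, rule_format, OF x]
  then have ev: "\<forall>\<^sub>F \<epsilon> in at_right 0. F \<epsilon> differentiable (at x)" by blast
  show "(\<lambda>y. c0 * f y) differentiable (at x)" using F by simp
  show "\<forall>\<^sub>F \<epsilon> in at_right 0. (\<lambda>y. c \<epsilon> * F \<epsilon> y) differentiable (at x)"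
    using ev by eventually_elim simp
  show "((\<lambda>\<epsilon>. c \<epsilon> * F \<epsilon> x) \<longlongrightarrow> c0 * f x) (at_right 0)" using F by (intro tendsto_mult c) auto
  have eq: "\<forall>\<^sub>F \<epsilon> in at_right 0. c \<epsilon> * partial k (F \<epsilon>) x = partial k (\<lambda>y. c \<epsilon> * F \<epsilon> y) x"
    using ev by eventually_elim (simp add: partial_cmult)
  have "((\<lambda>\<epsilon>. c \<epsilon> * partial k (F \<epsilon>) x) \<longlongrightarrow> partial k (\<lambda>y. c0 * f y) x) (at_right 0)"
    using F by (subst partial_cmult) (auto intro!: tendsto_mult c)
  from Lim_transform_eventually[OF this eq]
  show "((\<lambda>\<epsilon>. partial k (\<lambda>y. c \<epsilon> * F \<epsilon> y) x) \<longlongrightarrow> partial k (\<lambda>y. c0 * f y) x) (at_right 0)" .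
qed

lemmas C1_conv_cmult = C1_conv_scale[OF tendsto_const]

lemma C1_conv_diff:
  assumes "C1_conv D F f" "C1_conv D G g"
  shows "C1_conv D (\<lambda>\<epsilon> y. F \<epsilon> y - G \<epsilon> y) (\<lambda>y. f y - g y)"
  using C1_conv_add[OF assms(1) C1_conv_cmult[OF assms(2), of "- 1"]] by simp

lemma C1_conv_sum:
  "(\<And>i. i \<in> I \<Longrightarrow> C1_conv D (F i) (f i)) \<Longrightarrow>
    C1_conv D (\<lambda>\<epsilon> y. \<Sum>i\<in>I. F i \<epsilon> y) (\<lambda>y. \<Sum>i\<in>I. f i y)"
  by (induction I rule: infinite_finite_induct) (simp_all add: C1_conv_const C1_conv_add)

section \<open>Velocity moments of g and the fluxes built from them\<close>

definition moment1 :: "'d::finite state \<Rightarrow> 'd \<Rightarrow> real^'d \<Rightarrow> real" where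
  "moment1 S k x = avg (\<lambda>v. v $ k * micro S x v)"

definition moment2 :: "'d::finite state \<Rightarrow> 'd \<Rightarrow> 'd \<Rightarrow> real^'d \<Rightarrow> real" where
  "moment2 S k l x = avg (\<lambda>v. (v $ k * v $ l) * micro S x v)"

definition moment3 :: "'d::finite state \<Rightarrow> 'd \<Rightarrow> real^'d \<Rightarrow> real" where
  "moment3 S k x = avg (\<lambda>v. ((norm v)\<^sup>2 * v $ k) * micro S x v)"

lemma moment_weights_mem:
  "(\<lambda>v. v $ k) \<in> moment_weights" "(\<lambda>v. v $ k * v $ l) \<in> moment_weights"
  "(\<lambda>v. (norm v)\<^sup>2 * v $ k) \<in> moment_weights"
  by (auto simp: moment_weights_def)

lemma admissible_has_avg:
  assumes "admissible D S" "x \<in> D" "\<phi> \<in> moment_weights"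
  shows "has_avg (\<lambda>v. \<phi> v * micro S x v) (avg (\<lambda>v. \<phi> v * micro S x v))"
  using assms by (auto simp: admissible_def intro!: integrable_has_avg)

lemma admissible_moments:
  assumes "admissible D S" "x \<in> D"
  shows "has_avg (\<lambda>v. v $ k * micro S x v) (moment1 S k x)"
    and "has_avg (\<lambda>v. (v $ k * v $ l) * micro S x v) (moment2 S k l x)"
    and "has_avg (\<lambda>v. ((norm v)\<^sup>2 * v $ k) * micro S x v) (moment3 S k x)"
  unfolding moment1_def moment2_def moment3_def
  by (rule admissible_has_avg[OF assms], rule moment_weights_mem)+

text \<open>This is the mean of g A_mn, and \<open>moment_B\<close> that of g B_m, expanded into
  monomial moments, since derivatives and limits are available for the weights in
  \<open>moment_weights\<close>.\<close>

definition moment_A :: "'d::finite state \<Rightarrow> 'd \<Rightarrow> 'd \<Rightarrow> real^'d \<Rightarrow> real" where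
  "moment_A S m n x = moment2 S m n x - of_bool (m = n) / real CARD('d) * (\<Sum>k\<in>UNIV. moment2 S k k x)"

definition moment_B :: "'d::finite state \<Rightarrow> 'd \<Rightarrow> real^'d \<Rightarrow> real" where
  "moment_B S m x = moment3 S m x - (real CARD('d) + 2) * moment1 S m x"

lemma norm_power2_eq_sum: "(norm v)\<^sup>2 = (\<Sum>k\<in>UNIV. v $ k * v $ k)" for v :: "real^'d::finite"
  by (simp add: norm_vec_def L2_set_def sum_nonneg power2_eq_square)

lemma has_avg_moment_A:
  fixes S :: "'d::finite state"
  assumes "admissible D S" "x \<in> D"
  shows "has_avg (\<lambda>v. micro S x v * tensor_A v $ m $ n) (moment_A S m n x)"
proof -
  have "has_avg (\<lambda>v. (v $ m * v $ n) * micro S x v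
      - of_bool (m = n) / real CARD('d) * (\<Sum>k\<in>UNIV. (v $ k * v $ k) * micro S x v)) (moment_A S m n x)"
    unfolding moment_A_def
    by (intro has_avg_diff has_avg_cmult has_avg_sum admissible_moments[OF assms])
  then show ?thesis
    by (rule has_avg_cong)
      (simp_all add: tensor_A_nth norm_power2_eq_sum right_diff_distrib sum_distrib_left mult_ac)
qed

lemma has_avg_moment_B:
  fixes S :: "'d::finite state"
  assumes "admissible D S" "x \<in> D"
  shows "has_avg (\<lambda>v. micro S x v * vector_B v $ m) (moment_B S m x)"
proof -
  have "has_avg (\<lambda>v. ((norm v)\<^sup>2 * v $ m) * micro S x v
      - (real CARD('d) + 2) * (v $ m * micro S x v)) (moment_B S m x)"
    unfolding moment_B_def
    by (intro has_avg_diff has_avg_cmult admissible_moments[OF assms])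
  then show ?thesis
    by (rule has_avg_cong) (simp_all add: vector_B_nth algebra_simps)
qed

lemma admissible_moment_differentiable:
  assumes "open D" "admissible D S" "x \<in> D"
  shows "moment1 S k differentiable (at x)" "moment2 S k l differentiable (at x)"
    "moment3 S k differentiable (at x)"
proof -
  have "(\<lambda>x. avg (\<lambda>v. \<phi> v * micro S x v)) differentiable (at x)" if "\<phi> \<in> moment_weights" for \<phi>
    using assms that differentiable_on_openD unfolding admissible_def by blast
  from this[OF moment_weights_mem(1)] this[OF moment_weights_mem(2)] this[OF moment_weights_mem(3)]
  show "moment1 S k differentiable (at x)" "moment2 S k l differentiable (at x)"
    "moment3 S k differentiable (at x)"
    unfolding moment1_def[abs_def] moment2_def[abs_def] moment3_def[abs_def] .
qed

lemma moment_A_differentiable: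
  assumes "open D" "admissible D S" "x \<in> D"
  shows "moment_A S m n differentiable (at x)"
  unfolding moment_A_def[abs_def]
  by (intro differentiable_diff differentiable_mult differentiable_const differentiable_sum ballI
      admissible_moment_differentiable[OF assms] finite)

lemma moment_B_differentiable:
  assumes "open D" "admissible D S" "x \<in> D"
  shows "moment_B S m differentiable (at x)"
  unfolding moment_B_def[abs_def]
  by (intro differentiable_diff differentiable_mult differentiable_const
      admissible_moment_differentiable[OF assms])

text \<open>Average and divergence are reduced to components, and openness of D allows the scalar
  moments to replace the averages under the derivative.\<close>

lemma flux_A_eq:
  fixes S :: "'d::finite state"
  assumes D: "open D" "x \<in> D" and S: "admissible D S"
  shows "flux_A S x $ m = (\<Sum>n\<in>UNIV. partial n (moment_A S m n) x)"
proof -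
  have eq: "avg (\<lambda>v. micro S y v *\<^sub>R tensor_A v) $ m $ n = moment_A S m n y" if "y \<in> D" for y m n
    by (rule has_avg_mat) (use has_avg_moment_A[OF S that] in simp)
  have "flux_A S x $ m = divergence (\<lambda>y. avg (\<lambda>v. micro S y v *\<^sub>R tensor_A v) $ m) x"
    by (simp add: flux_A_def tensor_divergence_def)
  also have "\<dots> = (\<Sum>n\<in>UNIV. partial n (\<lambda>y. avg (\<lambda>v. micro S y v *\<^sub>R tensor_A v) $ m $ n) x)"
    by (rule divergence_eq_sum_components, rule differentiable_cong_open[OF D eq[symmetric]])
      (auto intro: moment_A_differentiable[OF D(1) S D(2)])
  also have "\<dots> = (\<Sum>n\<in>UNIV. partial n (moment_A S m n) x)"
    by (rule sum.cong[OF refl], rule partial_cong_open[OF D eq])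
  finally show ?thesis .
qed

lemma flux_B_eq:
  fixes S :: "'d::finite state"
  assumes D: "open D" "x \<in> D" and S: "admissible D S"
  shows "flux_B S x = (\<Sum>n\<in>UNIV. partial n (moment_B S n) x)"
proof -
  have eq: "avg (\<lambda>v. micro S y v *\<^sub>R vector_B v) $ n = moment_B S n y" if "y \<in> D" for y n
    by (rule has_avg_vec) (use has_avg_moment_B[OF S that] in simp)
  have "flux_B S x = (\<Sum>n\<in>UNIV. partial n (\<lambda>y. avg (\<lambda>v. micro S y v *\<^sub>R vector_B v) $ n) x)"
    unfolding flux_B_def
    by (rule divergence_eq_sum_components, rule differentiable_cong_open[OF D eq[symmetric]])
      (auto intro: moment_B_differentiable[OF D(1) S D(2)])
  also have "\<dots> = (\<Sum>n\<in>UNIV. partial n (moment_B S n) x)"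
    by (rule sum.cong[OF refl], rule partial_cong_open[OF D eq])
  finally show ?thesis .
qed

text \<open>P sees v_k g only through moments of g of degree at most three, so convergence of this
  flux will follow from that of g and of these moments.\<close>

lemma coproj_flux_nth:
  fixes S :: "'d::finite state"
  assumes "admissible D S" "x \<in> D"
  shows "coproj_flux (micro S x) v $ k = v $ k * micro S x v
    - (moment1 S k x + (\<Sum>l\<in>UNIV. v $ l * moment2 S k l x)
       + ((norm v)\<^sup>2 - real CARD('d)) / 2 * (1 / real CARD('d) * (moment3 S k x - real CARD('d) * moment1 S k x)))"
proof -
  let ?d = "real CARD('d)"
  have 1: "avg (\<lambda>w. w $ k * micro S x w) = moment1 S k x" by (simp add: moment1_def)
  have 2: "avg (\<lambda>w. (w $ k * micro S x w) *\<^sub>R w) $ l = moment2 S k l x" for l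
    by (rule has_avg_vec, rule has_avg_cong[OF admissible_moments(2)[OF assms]]) auto
  have "has_avg (\<lambda>w. 1 / ?d * (((norm w)\<^sup>2 * w $ k) * micro S x w - ?d * (w $ k * micro S x w)))
      (1 / ?d * (moment3 S k x - ?d * moment1 S k x))"
    by (intro has_avg_diff has_avg_cmult admissible_moments[OF assms])
  then have "has_avg (\<lambda>w. ((norm w)\<^sup>2 - ?d) / ?d * (w $ k * micro S x w))
      (1 / ?d * (moment3 S k x - ?d * moment1 S k x))"
    by (rule has_avg_cong) (simp_all add: field_simps)
  from has_avg_avg[OF this] have 3: "avg (\<lambda>w. ((norm w)\<^sup>2 - ?d) / ?d * (w $ k * micro S x w))
      = 1 / ?d * (moment3 S k x - ?d * moment1 S k x)" .
  show ?thesis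
    unfolding coproj_flux_def proj_def vec_lambda_beta 1 3 by (simp add: inner_vec_def 2)
qed

text \<open>The last three coefficients expand
  \<open>- T\<^sup>2 / \<tau> * ((|v|\<^sup>2 - (d + 2))\<^sup>2 / 8 - 1 / 2 - d / 4)\<close>, the part of \<open>- Q\<^sub>0\<close> that contributes
  to neither the stress nor the heat flux.\<close>

definition macro_source :: "'d::finite state \<Rightarrow> real \<Rightarrow> real^'d \<Rightarrow> real^'d \<Rightarrow> real" where
  "macro_source S0 \<tau> x v = quadratic_source
     (\<lambda>k l. partial k (\<lambda>y. vel S0 y $ l) x - vel S0 x $ k * vel S0 x $ l / (2 * \<tau>))
     (\<lambda>k. partial k (temp S0) x / 2 - vel S0 x $ k * temp S0 x / (2 * \<tau>))
     (- (temp S0 x)\<^sup>2 / (8 * \<tau>)) ((temp S0 x)\<^sup>2 * (real CARD('d) + 2) / (4 * \<tau>))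
     (- (temp S0 x)\<^sup>2 * ((real CARD('d) + 2)\<^sup>2 / 8 - 1 / 2 - real CARD('d) / 4) / \<tau>) v"

section \<open>Limit of a single state, its fluxes and its explicit source\<close>

context
  fixes D :: "(real^'d::finite) set" and S :: "real \<Rightarrow> 'd state" and S0 :: "'d state"
    and q0 :: "real^'d \<Rightarrow> real"
  assumes D: "open D"
    and adm: "\<forall>\<^sub>F \<epsilon> in at_right 0. admissible D (S \<epsilon>)"
    and lim: "formal_limit D S S0 q0"
begin

lemma formal_limit_admissible: "admissible D S0"
  using lim by (simp add: formal_limit_def)

lemma formal_limit_tendsto:
  assumes "x \<in> D"
  shows "((\<lambda>\<epsilon>. dens (S \<epsilon>) x) \<longlongrightarrow> dens S0 x) (at_right 0)"
    and "((\<lambda>\<epsilon>. vel (S \<epsilon>) x) \<longlongrightarrow> vel S0 x) (at_right 0)"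
    and "((\<lambda>\<epsilon>. temp (S \<epsilon>) x) \<longlongrightarrow> temp S0 x) (at_right 0)"
    and "((\<lambda>\<epsilon>. micro (S \<epsilon>) x v) \<longlongrightarrow> micro S0 x v) (at_right 0)"
  using lim assms by (auto simp: formal_limit_def C1_limit_def)

lemma formal_limit_press_eq_0:
  assumes "x \<in> D"
  shows "dens S0 x + temp S0 x = 0"
proof -
  have "((\<lambda>\<epsilon>. press (S \<epsilon>) x / \<epsilon>) \<longlongrightarrow> q0 x) (at_right 0)"
    using lim assms by (auto simp: formal_limit_def C1_limit_def)
  from tendsto_mult[OF tendsto_ident_at this]
  have 1: "((\<lambda>\<epsilon>. \<epsilon> * (press (S \<epsilon>) x / \<epsilon>)) \<longlongrightarrow> 0) (at_right 0)" by simp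
  have "\<forall>\<^sub>F \<epsilon> in at_right 0. \<epsilon> * (press (S \<epsilon>) x / \<epsilon>) = dens (S \<epsilon>) x + temp (S \<epsilon>) x"
    using eventually_at_right_less[of 0] by eventually_elim (simp add: press_def)
  from Lim_transform_eventually[OF 1 this]
  have "((\<lambda>\<epsilon>. dens (S \<epsilon>) x + temp (S \<epsilon>) x) \<longlongrightarrow> 0) (at_right 0)" .
  moreover have "((\<lambda>\<epsilon>. dens (S \<epsilon>) x + temp (S \<epsilon>) x) \<longlongrightarrow> dens S0 x + temp S0 x) (at_right 0)"
    by (intro tendsto_add formal_limit_tendsto assms)
  ultimately show ?thesis by (metis tendsto_unique trivial_limit_at_right_real)
qed

lemma formal_limit_divergence:
  assumes "x \<in> D"
  shows "((\<lambda>\<epsilon>. divergence (vel (S \<epsilon>)) x) \<longlongrightarrow> divergence (vel S0) x) (at_right 0)"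
  unfolding divergence_def
  by (intro tendsto_sum tendsto_vec_nth)
    (use lim assms in \<open>simp add: formal_limit_def C1_limit_def\<close>)

text \<open>The singular factor moves inside the derivative and gives the gradient of p /
  \<epsilon>, whose convergence with derivatives is part of \<open>formal_limit\<close>.\<close>

lemma formal_limit_gradient:
  assumes x: "x \<in> D"
  shows "((\<lambda>\<epsilon>. (1 / \<epsilon>) *\<^sub>R gradient (\<lambda>y. temp (S \<epsilon>) y + dens (S \<epsilon>) y) x) \<longlongrightarrow> gradient q0 x) (at_right 0)"
proof (rule vec_tendstoI)
  fix k
  have 1: "((\<lambda>\<epsilon>. partial k (\<lambda>y. press (S \<epsilon>) y / \<epsilon>) x) \<longlongrightarrow> gradient q0 x $ k) (at_right 0)"
    using lim x by (simp add: formal_limit_def C1_limit_def gradient_def)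
  have 2: "\<forall>\<^sub>F \<epsilon> in at_right 0. partial k (\<lambda>y. press (S \<epsilon>) y / \<epsilon>) x =
    ((1 / \<epsilon>) *\<^sub>R gradient (\<lambda>y. temp (S \<epsilon>) y + dens (S \<epsilon>) y) x) $ k"
    using adm
  proof eventually_elim
    case (elim \<epsilon>)
    then have "dens (S \<epsilon>) differentiable (at x)" "temp (S \<epsilon>) differentiable (at x)"
      using differentiable_on_openD[OF _ D x] by (auto simp: admissible_def)
    then have "press (S \<epsilon>) differentiable (at x)"
      unfolding press_def[abs_def] by (rule differentiable_add)
    moreover have "(\<lambda>y. temp (S \<epsilon>) y + dens (S \<epsilon>) y) = press (S \<epsilon>)"
      by (auto simp: press_def)
    ultimately show ?case by (simp add: partial_divide gradient_def)
  qed
  show "((\<lambda>\<epsilon>. ((1 / \<epsilon>) *\<^sub>R gradient (\<lambda>y. temp (S \<epsilon>) y + dens (S \<epsilon>) y) x) $ k) \<longlongrightarrow> gradient q0 x $ k) (at_right 0)"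
    by (rule Lim_transform_eventually[OF 1 2])
qed

lemma C1_conv_weighted_moment:
  assumes "\<phi> \<in> moment_weights"
  shows "C1_conv D (\<lambda>\<epsilon> x. avg (\<lambda>v. \<phi> v * micro (S \<epsilon>) x v)) (\<lambda>x. avg (\<lambda>v. \<phi> v * micro S0 x v))"
proof (rule C1_convI[OF D])
  show "(\<lambda>x. avg (\<lambda>v. \<phi> v * micro S0 x v)) differentiable_on D"
    using formal_limit_admissible assms by (simp add: admissible_def)
  show "\<forall>\<^sub>F \<epsilon> in at_right 0. (\<lambda>x. avg (\<lambda>v. \<phi> v * micro (S \<epsilon>) x v)) differentiable_on D"
    using adm by eventually_elim (use assms in \<open>simp add: admissible_def\<close>)
  show "C1_limit D (\<lambda>\<epsilon> x. avg (\<lambda>v. \<phi> v * micro (S \<epsilon>) x v)) (\<lambda>x. avg (\<lambda>v. \<phi> v * micro S0 x v))"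
    using lim assms by (simp add: formal_limit_def)
qed

lemma C1_conv_moments:
  shows "C1_conv D (\<lambda>\<epsilon>. moment1 (S \<epsilon>) k) (moment1 S0 k)"
    and "C1_conv D (\<lambda>\<epsilon>. moment2 (S \<epsilon>) k l) (moment2 S0 k l)"
    and "C1_conv D (\<lambda>\<epsilon>. moment3 (S \<epsilon>) k) (moment3 S0 k)"
  unfolding moment1_def[abs_def] moment2_def[abs_def] moment3_def[abs_def]
  by (rule C1_conv_weighted_moment, rule moment_weights_mem)+

lemma C1_conv_moment_A: "C1_conv D (\<lambda>\<epsilon>. moment_A (S \<epsilon>) m n) (moment_A S0 m n)"
  unfolding moment_A_def[abs_def]
  by (intro C1_conv_diff C1_conv_cmult C1_conv_sum C1_conv_moments)

lemma C1_conv_moment_B: "C1_conv D (\<lambda>\<epsilon>. moment_B (S \<epsilon>) m) (moment_B S0 m)"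
  unfolding moment_B_def[abs_def]
  by (intro C1_conv_diff C1_conv_cmult C1_conv_moments)

lemma formal_limit_flux_A:
  assumes x: "x \<in> D"
  shows "((\<lambda>\<epsilon>. flux_A (S \<epsilon>) x) \<longlongrightarrow> flux_A S0 x) (at_right 0)"
proof (rule vec_tendstoI)
  fix m
  have "((\<lambda>\<epsilon>. \<Sum>n\<in>UNIV. partial n (moment_A (S \<epsilon>) m n) x) \<longlongrightarrow> flux_A S0 x $ m) (at_right 0)"
    unfolding flux_A_eq[OF D x formal_limit_admissible]
    by (intro tendsto_sum C1_conv_partial[OF C1_conv_moment_A x])
  moreover have "\<forall>\<^sub>F \<epsilon> in at_right 0. (\<Sum>n\<in>UNIV. partial n (moment_A (S \<epsilon>) m n) x) = flux_A (S \<epsilon>) x $ m"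
    using adm by eventually_elim (simp add: flux_A_eq[OF D x])
  ultimately show "((\<lambda>\<epsilon>. flux_A (S \<epsilon>) x $ m) \<longlongrightarrow> flux_A S0 x $ m) (at_right 0)"
    by (rule Lim_transform_eventually)
qed

lemma formal_limit_flux_B:
  assumes x: "x \<in> D"
  shows "((\<lambda>\<epsilon>. flux_B (S \<epsilon>) x) \<longlongrightarrow> flux_B S0 x) (at_right 0)"
proof -
  have "((\<lambda>\<epsilon>. \<Sum>n\<in>UNIV. partial n (moment_B (S \<epsilon>) n) x) \<longlongrightarrow> flux_B S0 x) (at_right 0)"
    unfolding flux_B_eq[OF D x formal_limit_admissible]
    by (intro tendsto_sum C1_conv_partial[OF C1_conv_moment_B x])
  moreover have "\<forall>\<^sub>F \<epsilon> in at_right 0. (\<Sum>n\<in>UNIV. partial n (moment_B (S \<epsilon>) n) x) = flux_B (S \<epsilon>) x"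
    using adm by eventually_elim (simp add: flux_B_eq[OF D x])
  ultimately show ?thesis by (rule Lim_transform_eventually)
qed

lemma C1_conv_vel: "C1_conv D (\<lambda>\<epsilon> y. vel (S \<epsilon>) y $ k) (\<lambda>y. vel S0 y $ k)"
  unfolding C1_conv_def
proof (intro ballI conjI allI)
  fix x l assume x: "x \<in> D"
  have d0: "vel S0 differentiable (at x)"
    by (rule differentiable_on_openD[OF _ D x]) (use formal_limit_admissible in \<open>simp add: admissible_def\<close>)
  have d: "\<forall>\<^sub>F \<epsilon> in at_right 0. vel (S \<epsilon>) differentiable (at x)"
    using adm by eventually_elim (rule differentiable_on_openD[OF _ D x], simp add: admissible_def)
  show "(\<lambda>y. vel S0 y $ k) differentiable (at x)" by (rule differentiable_nth[OF d0])
  show "\<forall>\<^sub>F \<epsilon> in at_right 0. (\<lambda>y. vel (S \<epsilon>) y $ k) differentiable (at x)"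
    using d by eventually_elim (rule differentiable_nth)
  show "((\<lambda>\<epsilon>. vel (S \<epsilon>) x $ k) \<longlongrightarrow> vel S0 x $ k) (at_right 0)"
    by (intro tendsto_vec_nth formal_limit_tendsto x)
  have 1: "((\<lambda>\<epsilon>. partial l (vel (S \<epsilon>)) x $ k) \<longlongrightarrow> partial l (\<lambda>y. vel S0 y $ k) x) (at_right 0)"
    unfolding partial_nth[OF d0]
    by (intro tendsto_vec_nth) (use lim x in \<open>simp add: formal_limit_def C1_limit_def\<close>)
  have 2: "\<forall>\<^sub>F \<epsilon> in at_right 0. partial l (vel (S \<epsilon>)) x $ k = partial l (\<lambda>y. vel (S \<epsilon>) y $ k) x"
    using d by eventually_elim (simp add: partial_nth)
  show "((\<lambda>\<epsilon>. partial l (\<lambda>y. vel (S \<epsilon>) y $ k) x) \<longlongrightarrow> partial l (\<lambda>y. vel S0 y $ k) x) (at_right 0)"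
    by (rule Lim_transform_eventually[OF 1 2])
qed

lemma C1_conv_temp: "C1_conv D (\<lambda>\<epsilon>. temp (S \<epsilon>)) (temp S0)"
proof (rule C1_convI[OF D])
  show "\<forall>\<^sub>F \<epsilon> in at_right 0. temp (S \<epsilon>) differentiable_on D"
    using adm by eventually_elim (simp add: admissible_def)
qed (use lim formal_limit_admissible in \<open>simp_all add: formal_limit_def admissible_def\<close>)

lemma C1_conv_micro: "C1_conv D (\<lambda>\<epsilon> y. micro (S \<epsilon>) y v) (\<lambda>y. micro S0 y v)"
proof (rule C1_convI[OF D])
  show "\<forall>\<^sub>F \<epsilon> in at_right 0. (\<lambda>y. micro (S \<epsilon>) y v) differentiable_on D"
    using adm by eventually_elim (simp add: admissible_def)
qed (use lim formal_limit_admissible in \<open>simp_all add: formal_limit_def admissible_def\<close>)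

lemma C1_conv_coproj_flux:
  "C1_conv D (\<lambda>\<epsilon> y. coproj_flux (micro (S \<epsilon>) y) v $ k) (\<lambda>y. coproj_flux (micro S0 y) v $ k)"
proof (rule C1_conv_cong[OF D])
  let ?d = "real CARD('d)"
  show "C1_conv D (\<lambda>\<epsilon> y. v $ k * micro (S \<epsilon>) y v
      - (moment1 (S \<epsilon>) k y + (\<Sum>l\<in>UNIV. v $ l * moment2 (S \<epsilon>) k l y)
       + ((norm v)\<^sup>2 - ?d) / 2 * (1 / ?d * (moment3 (S \<epsilon>) k y - ?d * moment1 (S \<epsilon>) k y))))
     (\<lambda>y. v $ k * micro S0 y v
      - (moment1 S0 k y + (\<Sum>l\<in>UNIV. v $ l * moment2 S0 k l y)
       + ((norm v)\<^sup>2 - ?d) / 2 * (1 / ?d * (moment3 S0 k y - ?d * moment1 S0 k y))))"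
    by (intro C1_conv_diff C1_conv_add C1_conv_cmult C1_conv_sum C1_conv_moments C1_conv_micro)
  show "\<forall>\<^sub>F \<epsilon> in at_right 0. \<forall>y\<in>D. v $ k * micro (S \<epsilon>) y v
      - (moment1 (S \<epsilon>) k y + (\<Sum>l\<in>UNIV. v $ l * moment2 (S \<epsilon>) k l y)
       + ((norm v)\<^sup>2 - ?d) / 2 * (1 / ?d * (moment3 (S \<epsilon>) k y - ?d * moment1 (S \<epsilon>) k y)))
      = coproj_flux (micro (S \<epsilon>) y) v $ k"
    using adm by eventually_elim (intro ballI coproj_flux_nth[symmetric])
qed (rule coproj_flux_nth[symmetric, OF formal_limit_admissible])

lemma formal_limit_explicit_micro:
  assumes \<tau>: "\<tau> > 0" and x: "x \<in> D"
  shows "((\<lambda>\<epsilon>. explicit_micro \<tau> \<epsilon> (S \<epsilon>) x v) \<longlongrightarrow> macro_source S0 \<tau> x v) (at_right 0)"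
proof -
  let ?d = "real CARD('d)"
  let ?u = "vel S0 x" and ?T = "temp S0 x"
  let ?F = "\<lambda>\<epsilon> k y. (\<Sum>l\<in>UNIV. tensor_A v $ k $ l * vel (S \<epsilon>) y $ l) + vector_B v $ k / 2 * temp (S \<epsilon>) y
    + \<epsilon> * coproj_flux (micro (S \<epsilon>) y) v $ k"
  \<comment> \<open>The summand with factor 0 is the limit of the \<epsilon> term, kept in the shape
    in which \<open>C1_conv_scale\<close> delivers it.\<close>
  let ?f = "\<lambda>k y. (\<Sum>l\<in>UNIV. tensor_A v $ k $ l * vel S0 y $ l) + vector_B v $ k / 2 * temp S0 y
    + 0 * coproj_flux (micro S0 y) v $ k"
  have F: "C1_conv D (\<lambda>\<epsilon>. ?F \<epsilon> k) (?f k)" for k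
    by (intro C1_conv_add C1_conv_sum C1_conv_cmult C1_conv_scale[OF tendsto_ident_at]
        C1_conv_vel C1_conv_temp C1_conv_coproj_flux)
  have nth: "(\<lambda>y. (tensor_A v *v vel (S \<epsilon>) y + (temp (S \<epsilon>) y / 2) *\<^sub>R vector_B v
      + \<epsilon> *\<^sub>R coproj_flux (micro (S \<epsilon>) y) v) $ k) = ?F \<epsilon> k" for \<epsilon> k
    by (auto simp: matrix_vector_mult_def mult.commute)
  have evd: "\<forall>\<^sub>F \<epsilon> in at_right 0. \<forall>k. ?F \<epsilon> k differentiable (at x)"
    by (rule eventually_all_finite, rule F[unfolded C1_conv_def, THEN bspec, OF x, THEN conjunct2, THEN conjunct1])
  have 1: "((\<lambda>\<epsilon>. \<Sum>k\<in>UNIV. partial k (?F \<epsilon> k) x) \<longlongrightarrow> (\<Sum>k\<in>UNIV. partial k (?f k) x)) (at_right 0)"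
    by (intro tendsto_sum C1_conv_partial[OF F x])
  have 2: "\<forall>\<^sub>F \<epsilon> in at_right 0. (\<Sum>k\<in>UNIV. partial k (?F \<epsilon> k) x) =
     divergence (\<lambda>y. tensor_A v *v vel (S \<epsilon>) y + (temp (S \<epsilon>) y / 2) *\<^sub>R vector_B v
      + \<epsilon> *\<^sub>R coproj_flux (micro (S \<epsilon>) y) v) x"
    using evd
  proof eventually_elim
    case (elim \<epsilon>)
    then show ?case by (subst divergence_eq_sum_components) (simp_all only: nth)
  qed
  note div = Lim_transform_eventually[OF 1 2]
  \<comment> \<open>The limit of Q is computed under \<rho> + T = 0, so the limit density is
    rewritten as - T.\<close>
  have r: "((\<lambda>\<epsilon>. dens (S \<epsilon>) x) \<longlongrightarrow> - temp S0 x) (at_right 0)"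
    using formal_limit_tendsto(1)[OF x] formal_limit_press_eq_0[OF x] by (simp add: eq_neg_iff_add_eq_0[symmetric])
  note Q = collision_Q_limit[OF \<tau> formal_limit_tendsto(2)[OF x] r formal_limit_tendsto(3)[OF x], of v]
  have d0: "(\<lambda>y. vel S0 y $ l) differentiable (at x)" "temp S0 differentiable (at x)" for l
    using C1_conv_vel C1_conv_temp x by (auto simp: C1_conv_def)
  have p: "partial k (?f k) x = (\<Sum>l\<in>UNIV. tensor_A v $ k $ l * partial k (\<lambda>y. vel S0 y $ l) x)
      + vector_B v $ k / 2 * partial k (temp S0) x" for k
  proof -
    have "?f k = (\<lambda>y. (\<Sum>l\<in>UNIV. tensor_A v $ k $ l * vel S0 y $ l) + vector_B v $ k / 2 * temp S0 y)"
      by simp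
    then show ?thesis
      using d0 by (simp only:) (subst partial_add; simp add: partial_sum partial_cmult partial_divide)
  qed
  \<comment> \<open>The part of 2 \<tau> Q_0 that is quadratic in u is A(v) contracted with u u^T;
    its second term is the trace correction in A.\<close>
  have A: "(v \<bullet> ?u)\<^sup>2 - (norm v)\<^sup>2 * (norm ?u)\<^sup>2 / ?d = (\<Sum>k\<in>UNIV. \<Sum>l\<in>UNIV. ?u $ k * ?u $ l * tensor_A v $ k $ l)"
  proof -
    have "(\<Sum>k\<in>UNIV. \<Sum>l\<in>UNIV. ?u $ k * ?u $ l * tensor_A v $ k $ l) =
        (\<Sum>k\<in>UNIV. \<Sum>l\<in>UNIV. (v $ k * ?u $ k) * (v $ l * ?u $ l))
        - (\<Sum>k\<in>UNIV. \<Sum>l\<in>UNIV. if k = l then (norm v)\<^sup>2 / ?d * (?u $ k * ?u $ k) else 0)"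
      unfolding sum_subtractf[symmetric]
      by (intro sum.cong refl) (auto simp: tensor_A_nth algebra_simps)
    also have "\<dots> = (v \<bullet> ?u)\<^sup>2 - (norm v)\<^sup>2 / ?d * (norm ?u)\<^sup>2"
    proof -
      have "(\<Sum>k\<in>UNIV. \<Sum>l\<in>UNIV. (v $ k * ?u $ k) * (v $ l * ?u $ l)) = (v \<bullet> ?u)\<^sup>2"
        by (simp add: inner_vec_def power2_eq_square sum_product)
      moreover have "(\<Sum>k\<in>UNIV. \<Sum>l\<in>UNIV. if k = l then c * (?u $ k * ?u $ k) else 0) = c * (norm ?u)\<^sup>2" for c
        unfolding norm_power2_eq_sum[of ?u] by (simp add: sum_distrib_left)
      ultimately show ?thesis by (simp only:)
    qed
    finally show ?thesis by simp
  qed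
  \<comment> \<open>The mixed term of Q_0 in u and T is B(v) . u times T / (2 \<tau>).\<close>
  have B: "((norm v)\<^sup>2 - (?d + 2)) * (v \<bullet> ?u) = (\<Sum>k\<in>UNIV. ?u $ k * vector_B v $ k)"
    unfolding vector_B_def inner_vec_def sum_distrib_left by (intro sum.cong refl) simp
  have eq: "(\<Sum>k\<in>UNIV. partial k (?f k) x) - 1 / \<tau> * (((v \<bullet> ?u)\<^sup>2 - (norm v)\<^sup>2 * (norm ?u)\<^sup>2 / ?d) / 2
      + ((norm v)\<^sup>2 - (?d + 2)) / 2 * ?T * (v \<bullet> ?u)
      + ?T\<^sup>2 * (((norm v)\<^sup>2 - (?d + 2))\<^sup>2 / 8 - 1 / 2 - ?d / 4)) = macro_source S0 \<tau> x v"
  proof -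
    have 1: "((norm v)\<^sup>2 - (?d + 2)) / 2 * ?T * (v \<bullet> ?u) = ?T / 2 * (\<Sum>k\<in>UNIV. ?u $ k * vector_B v $ k)"
      unfolding B[symmetric] by simp
    have 2: "(\<Sum>k\<in>UNIV. \<Sum>l\<in>UNIV. (partial k (\<lambda>y. vel S0 y $ l) x - ?u $ k * ?u $ l / (2 * \<tau>)) * tensor_A v $ k $ l)
      = (\<Sum>k\<in>UNIV. \<Sum>l\<in>UNIV. tensor_A v $ k $ l * partial k (\<lambda>y. vel S0 y $ l) x)
        - 1 / (2 * \<tau>) * (\<Sum>k\<in>UNIV. \<Sum>l\<in>UNIV. ?u $ k * ?u $ l * tensor_A v $ k $ l)"
      unfolding sum_distrib_left sum_subtractf[symmetric]
      by (intro sum.cong refl) (simp add: left_diff_distrib right_diff_distrib mult_ac)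
    have 3: "(\<Sum>k\<in>UNIV. (partial k (temp S0) x / 2 - ?u $ k * ?T / (2 * \<tau>)) * vector_B v $ k)
      = (\<Sum>k\<in>UNIV. vector_B v $ k / 2 * partial k (temp S0) x)
        - ?T / (2 * \<tau>) * (\<Sum>k\<in>UNIV. ?u $ k * vector_B v $ k)"
      unfolding sum_distrib_left sum_subtractf[symmetric]
      by (intro sum.cong refl) (simp add: left_diff_distrib right_diff_distrib mult_ac)
    show ?thesis
      unfolding macro_source_def quadratic_source_def 1 2 3 A p sum.distrib
      using \<tau> by (simp add: field_simps power2_eq_square)
  qed
  show ?thesis
    unfolding explicit_micro_def eq[symmetric] by (intro tendsto_diff div Q)
qed

end

subsection \<open>Stress and heat flux of the limit; the implicit tableau\<close>

lemma differentiable_onI_open: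
  "open D \<Longrightarrow> (\<And>x. x \<in> D \<Longrightarrow> f differentiable (at x)) \<Longrightarrow> f differentiable_on D"
  by (simp add: differentiable_on_eq_differentiable_at)

lemma C2_on_differentiable:
  assumes "C2_on D f" "open D" "x \<in> D"
  shows "f differentiable (at x)" "partial k f differentiable (at x)"
  by (rule differentiable_on_openD[OF _ assms(2,3)], use assms(1) in \<open>simp add: C2_on_def\<close>)+

lemma C2_on_nth:
  fixes u :: "real^'d::finite \<Rightarrow> real^'n::finite"
  assumes D: "open D" and u: "C2_on D u"
  shows "C2_on D (\<lambda>y. u y $ n)"
proof -
  have du: "u differentiable (at y)" and dp: "partial k u differentiable (at y)" if "y \<in> D" for y k
    by (rule C2_on_differentiable[OF u D that])+
  have 1: "partial k u y $ n = partial k (\<lambda>y. u y $ n) y" if "y \<in> D" for k y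
    by (rule partial_nth[symmetric, OF du[OF that]])
  have 2: "partial l (partial k (\<lambda>y. u y $ n)) y = partial l (partial k u) y $ n" if y: "y \<in> D" for k l y
    unfolding partial_nth[OF dp[OF y], symmetric]
    by (rule partial_cong_open[OF D y]) (simp add: 1)
  show ?thesis
    unfolding C2_on_def
  proof (intro conjI allI)
    show "(\<lambda>y. u y $ n) differentiable_on D"
      by (intro differentiable_onI_open D differentiable_nth du)
    show "partial k (\<lambda>y. u y $ n) differentiable_on D" for k
    proof (rule differentiable_onI_open[OF D])
      fix y assume y: "y \<in> D"
      show "partial k (\<lambda>y. u y $ n) differentiable (at y)"
        by (rule differentiable_cong_open[OF D y 1 differentiable_nth[OF dp[OF y]]])
    qed
    show "continuous_on D (partial l (partial k (\<lambda>y. u y $ n)))" for k l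
    proof -
      have "continuous_on D (\<lambda>y. partial l (partial k u) y $ n)"
        by (rule continuous_on_component) (use u in \<open>simp add: C2_on_def\<close>)
      moreover have "continuous_on D (partial l (partial k (\<lambda>y. u y $ n))) =
          continuous_on D (\<lambda>y. partial l (partial k u) y $ n)"
        by (rule continuous_on_cong[OF refl 2])
      ultimately show ?thesis by blast
    qed
  qed
qed

lemma norm_power2_differentiable:
  fixes u :: "real^'d::finite \<Rightarrow> real^'n::finite"
  assumes "u differentiable (at x)"
  shows "(\<lambda>y. (norm (u y))\<^sup>2 / c) differentiable (at x)"
  unfolding norm_power2_eq_sum divide_inverse
  by (intro differentiable_mult differentiable_const differentiable_sum finite ballI differentiable_nth assms)

text \<open>Incompressibility acts twice: it turns the divergence of u u^T into the convection term
  and, once second partials are commuted, removes the divergence of the transposed velocity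
  gradient. The diagonal term yields the gradient that the pressure will absorb.\<close>

lemma stress_divergence:
  fixes u :: "real^'d::finite \<Rightarrow> real^'d" and \<tau> :: real
  assumes D: "open D" and x: "x \<in> D" and u: "C2_on D u"
    and div: "\<And>y. y \<in> D \<Longrightarrow> divergence u y = 0"
  defines "G \<equiv> \<lambda>m n y. u y $ m * u y $ n - of_bool (m = n) * ((norm (u y))\<^sup>2 / real CARD('d))
        - \<tau> * (partial m (\<lambda>z. u z $ n) y + partial n (\<lambda>z. u z $ m) y)"
  shows "G m n differentiable (at x)"
    and "(\<Sum>n\<in>UNIV. partial n (G m n) x) =
      convection u x $ m - partial m (\<lambda>y. (norm (u y))\<^sup>2 / real CARD('d)) x - \<tau> * laplacian u x $ m"
proof -
  let ?U = "\<lambda>n z. u z $ n" and ?N = "\<lambda>y. (norm (u y))\<^sup>2 / real CARD('d)"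
  have du: "u differentiable (at y)" and dp: "partial k u differentiable (at y)" if "y \<in> D" for y k
    by (rule C2_on_differentiable[OF u D that])+
  have dU: "?U n differentiable (at y)" and dP: "partial k (?U n) differentiable (at y)"
    if "y \<in> D" for y n k
    by (rule C2_on_differentiable[OF C2_on_nth[OF D u] D that])+
  have dN: "?N differentiable (at x)" by (rule norm_power2_differentiable[OF du[OF x]])
  have d1: "(\<lambda>y. ?U m y * ?U n y) differentiable (at x)" for m n
    by (intro differentiable_mult dU x)
  have d2: "(\<lambda>y. of_bool (m = n) * ?N y) differentiable (at x)" for m n
    by (intro differentiable_mult differentiable_const dN)
  have d3: "(\<lambda>y. partial m (?U n) y + partial n (?U m) y) differentiable (at x)" for m n
    by (intro differentiable_add dP x)
  have d3': "(\<lambda>y. \<tau> * (partial m (?U n) y + partial n (?U m) y)) differentiable (at x)" for m n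
    by (intro differentiable_mult differentiable_const d3)
  show "G m n differentiable (at x)"
    unfolding G_def by (intro differentiable_diff d1 d2 d3')
  have "partial n (G m n) x = (?U m x * partial n (?U n) x + partial n (?U m) x * ?U n x)
      - of_bool (m = n) * partial n ?N x
      - \<tau> * (partial n (partial m (?U n)) x + partial n (partial n (?U m)) x)" for n
    unfolding G_def partial_diff[OF differentiable_diff[OF d1 d2] d3'] partial_diff[OF d1 d2]
      partial_mult[OF dU[OF x] dU[OF x]] partial_cmult[OF dN] partial_cmult[OF d3]
      partial_add[OF dP[OF x] dP[OF x]] by (rule refl)
  then have "(\<Sum>n\<in>UNIV. partial n (G m n) x) =
      ?U m x * (\<Sum>n\<in>UNIV. partial n (?U n) x) + (\<Sum>n\<in>UNIV. partial n (?U m) x * ?U n x)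
      - (\<Sum>n\<in>UNIV. of_bool (m = n) * partial n ?N x)
      - \<tau> * ((\<Sum>n\<in>UNIV. partial n (partial m (?U n)) x) + (\<Sum>n\<in>UNIV. partial n (partial n (?U m)) x))"
    by (simp only: sum.distrib sum_subtractf sum_distrib_left distrib_left)
  moreover have divU: "(\<Sum>n\<in>UNIV. partial n (?U n) y) = 0" if "y \<in> D" for y
    using div[OF that] unfolding divergence_def partial_nth[OF du[OF that]] .
  moreover have "(\<Sum>n\<in>UNIV. partial n (?U m) x * ?U n x) = convection u x $ m"
    unfolding convection_def partial_nth[OF du[OF x]] by (simp add: mult.commute)
  moreover have "(\<Sum>n\<in>UNIV. of_bool (m = n) * partial n ?N x) = partial m ?N x"
  proof -
    have "(\<Sum>n\<in>UNIV. of_bool (m = n) * partial n ?N x) = (\<Sum>n\<in>UNIV. if m = n then partial n ?N x else 0)"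
      by (rule sum.cong) auto
    then show ?thesis by simp
  qed
  \<comment> \<open>After commuting the partials this is the m-th partial derivative of div u, which
    vanishes on a whole neighbourhood of x.\<close>
  moreover have "(\<Sum>n\<in>UNIV. partial n (partial m (?U n)) x) = 0"
  proof -
    have "(\<Sum>n\<in>UNIV. partial n (partial m (?U n)) x) = (\<Sum>n\<in>UNIV. partial m (partial n (?U n)) x)"
      by (intro sum.cong refl partial_commute[OF D x] C2_on_nth[OF D u])
    also have "\<dots> = partial m (\<lambda>y. \<Sum>n\<in>UNIV. partial n (?U n) y) x"
      by (rule partial_sum[symmetric]) (rule dP[OF x])
    also have "\<dots> = 0" by (rule partial_eq_0_open[OF D x divU])
    finally show ?thesis .
  qed
  moreover have "(\<Sum>n\<in>UNIV. partial n (partial n (?U m)) x) = laplacian u x $ m"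
  proof -
    have "partial n (partial n (?U m)) x = partial n (partial n u) x $ m" for n
      unfolding partial_nth[OF dp[OF x], symmetric]
      by (rule partial_cong_open[OF D x], rule partial_nth, rule du)
    then show ?thesis by (simp add: laplacian_def)
  qed
  ultimately show "(\<Sum>n\<in>UNIV. partial n (G m n) x) =
      convection u x $ m - partial m ?N x - \<tau> * laplacian u x $ m"
    by (simp only: divU[OF x] mult_zero_right add_0_left)
qed

lemma heat_flux_divergence:
  fixes u :: "real^'d::finite \<Rightarrow> real^'d" and T :: "real^'d \<Rightarrow> real" and \<tau> :: real
  assumes D: "open D" and x: "x \<in> D" and u: "C2_on D u" and T: "C2_on D T"
  defines "H \<equiv> \<lambda>n y. u y $ n * T y - \<tau> * partial n T y"
  shows "H n differentiable (at x)"
    and "(\<Sum>n\<in>UNIV. partial n (H n) x) = divergence (\<lambda>y. T y *\<^sub>R u y) x - \<tau> * laplacian T x"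
proof -
  note du = C2_on_differentiable(1)[OF u D x]
    and dT = C2_on_differentiable(1)[OF T D x] and dp = C2_on_differentiable(2)[OF T D x]
  have d1: "(\<lambda>y. u y $ n * T y) differentiable (at x)" for n
    by (intro differentiable_mult differentiable_nth du dT)
  have d2: "(\<lambda>y. \<tau> * partial n T y) differentiable (at x)" for n
    by (intro differentiable_mult differentiable_const dp)
  show "H n differentiable (at x)" unfolding H_def by (intro differentiable_diff d1 d2)
  have "partial n (H n) x = partial n (\<lambda>y. (T y *\<^sub>R u y) $ n) x - \<tau> * partial n (partial n T) x" for n
    unfolding H_def partial_diff[OF d1 d2] partial_cmult[OF dp] by (simp add: mult.commute)
  moreover have "divergence (\<lambda>y. T y *\<^sub>R u y) x = (\<Sum>n\<in>UNIV. partial n (\<lambda>y. (T y *\<^sub>R u y) $ n) x)"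
    by (rule divergence_eq_sum_components) (use d1 in \<open>simp add: mult.commute\<close>)
  ultimately show "(\<Sum>n\<in>UNIV. partial n (H n) x) = divergence (\<lambda>y. T y *\<^sub>R u y) x - \<tau> * laplacian T x"
    by (simp add: laplacian_def sum_subtractf sum_distrib_left)
qed

section \<open>Linear systems with the implicit matrix\<close>

lemma lower_triangular_sum:
  fixes a :: "nat \<Rightarrow> nat \<Rightarrow> real"
  assumes "imex_tableaux s ta a" "i \<in> {1..s}"
  shows "(\<Sum>j\<in>{1..i}. a i j * y j) = (\<Sum>j=1..s. a i j * y j)"
  by (rule sum.mono_neutral_left) (use assms in \<open>auto simp: imex_tableaux_def\<close>)

text \<open>Right inverse of the implicit matrix. The coefficients \<open>b\<close> are fixed before
  \<open>r\<close>, so the same ones serve at every point x, and solutions are finite linear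
  combinations of the data, hence differentiable when the data are.\<close>

lemma type_A_solvable:
  assumes tab: "imex_tableaux s ta a" and A: "type_A s a"
  shows "\<exists>b. \<forall>r. \<forall>i\<in>{1..s}. (\<Sum>j\<in>{1..i}. a i j * (\<Sum>k=1..s. b j k * r k)) = r i"
proof -
  obtain b where b: "\<forall>i\<in>{1..s}. \<forall>k\<in>{1..s}.
     (\<Sum>j=1..s. a i j * b j k) = (if i = k then 1 else 0) \<and>
     (\<Sum>j=1..s. b i j * a j k) = (if i = k then 1 else 0)"
    using A unfolding type_A_def by (elim exE)
  have ab: "(\<Sum>j=1..s. a i j * b j k) = (if i = k then 1 else 0)"
    if "i \<in> {1..s}" "k \<in> {1..s}" for i k
    by (rule b[THEN bspec, OF that(1), THEN bspec, OF that(2), THEN conjunct1])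
  have "(\<Sum>j\<in>{1..i}. a i j * (\<Sum>k=1..s. b j k * r k)) = r i" if i: "i \<in> {1..s}" for i r
  proof -
    have "(\<Sum>j\<in>{1..i}. a i j * (\<Sum>k=1..s. b j k * r k)) = (\<Sum>j=1..s. \<Sum>k=1..s. a i j * b j k * r k)"
      unfolding lower_triangular_sum[OF tab i] by (simp add: sum_distrib_left mult.assoc)
    also have "\<dots> = (\<Sum>k=1..s. (\<Sum>j=1..s. a i j * b j k) * r k)"
      by (subst sum.swap) (simp add: sum_distrib_right)
    also have "\<dots> = (\<Sum>k=1..s. if i = k then r k else 0)"
      by (rule sum.cong[OF refl], subst ab[OF i], assumption) simp
    finally show ?thesis using i by simp
  qed
  then show ?thesis by blast
qed

text \<open>Left inverse of the implicit matrix; it will be applied at each x to the divergences of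
  the stage velocities.\<close>

lemma type_A_injective:
  assumes tab: "imex_tableaux s ta a" and A: "type_A s a"
    and y: "\<And>i. i \<in> {1..s} \<Longrightarrow> (\<Sum>j\<in>{1..i}. a i j * y j) = 0" and k: "k \<in> {1..s}"
  shows "y k = 0"
proof -
  obtain b where b: "\<forall>i\<in>{1..s}. \<forall>k\<in>{1..s}.
     (\<Sum>j=1..s. a i j * b j k) = (if i = k then 1 else 0) \<and>
     (\<Sum>j=1..s. b i j * a j k) = (if i = k then 1 else 0)"
    using A unfolding type_A_def by (elim exE)
  have ba: "(\<Sum>i=1..s. b k i * a i j) = (if k = j then 1 else 0)" if "j \<in> {1..s}" for j
    by (rule b[THEN bspec, OF k, THEN bspec, OF that, THEN conjunct2])
  have "y k = (\<Sum>j=1..s. if k = j then y j else 0)" using k by simp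
  also have "\<dots> = (\<Sum>j=1..s. (\<Sum>i=1..s. b k i * a i j) * y j)"
    by (rule sum.cong[OF refl], subst ba, assumption) simp
  also have "\<dots> = (\<Sum>i=1..s. b k i * (\<Sum>j=1..s. a i j * y j))"
    unfolding sum_distrib_right sum_distrib_left by (subst sum.swap) (simp add: mult.assoc)
  also have "\<dots> = 0"
    by (rule sum.neutral) (use y lower_triangular_sum[OF tab, of _ y] in auto)
  finally show ?thesis .
qed

subsection \<open>The limit of the scheme\<close>

locale imex_fluid_limit =
  fixes D :: "(real^'d::finite) set"
    and \<tau> dt \<epsilon>0 :: real
    and s :: nat
    and ta a :: "nat \<Rightarrow> nat \<Rightarrow> real"
    and tw w :: "nat \<Rightarrow> real"
    and Sn Snew :: "real \<Rightarrow> 'd state"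
    and S :: "real \<Rightarrow> nat \<Rightarrow> 'd state"
    and Sn0 :: "'d state"
    and S0 :: "nat \<Rightarrow> 'd state"
    and qn0 :: "real^'d \<Rightarrow> real"
    and q0 :: "nat \<Rightarrow> real^'d \<Rightarrow> real"
  assumes D: "open D"
    and \<tau>: "\<tau> > 0"
    and dt: "dt > 0"
    and \<epsilon>0: "\<epsilon>0 > 0"
    and tableaux: "imex_tableaux s ta a"
    and typeA: "type_A s a"
    and admissible: "\<And>\<epsilon>. \<epsilon> \<in> {0<..<\<epsilon>0} \<Longrightarrow>
          admissible D (Sn \<epsilon>) \<and> (\<forall>i\<in>{1..s}. admissible D (S \<epsilon> i))"
    and scheme: "\<And>\<epsilon>. \<epsilon> \<in> {0<..<\<epsilon>0} \<Longrightarrow>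
          micro_macro_imex D \<tau> dt \<epsilon> s ta tw a w (Sn \<epsilon>) (S \<epsilon>) (Snew \<epsilon>)"
    and limit_n: "formal_limit D Sn Sn0 qn0"
    and limit_stages: "\<And>i. i \<in> {1..s} \<Longrightarrow> formal_limit D (\<lambda>\<epsilon>. S \<epsilon> i) (S0 i) (q0 i)"
    and smooth: "\<And>i. i \<in> {1..s} \<Longrightarrow> C2_on D (vel (S0 i)) \<and> C2_on D (temp (S0 i))"
begin

lemma eventually_small: "\<forall>\<^sub>F \<epsilon> in at_right 0. \<epsilon> \<in> {0<..<\<epsilon>0}"
  by (rule eventually_at_right_real[OF \<epsilon>0])

lemma eventually_admissible_n: "\<forall>\<^sub>F \<epsilon> in at_right 0. admissible D (Sn \<epsilon>)"
  using eventually_small by eventually_elim (use admissible in blast)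

lemma eventually_admissible: "i \<in> {1..s} \<Longrightarrow> \<forall>\<^sub>F \<epsilon> in at_right 0. admissible D (S \<epsilon> i)"
  using eventually_small by eventually_elim (use admissible in blast)

lemma sub_stage: "i \<in> {1..s} \<Longrightarrow> j \<in> {1..i} \<Longrightarrow> j \<in> {1..s}" "i \<in> {1..s} \<Longrightarrow> j \<in> {1..<i} \<Longrightarrow> j \<in> {1..s}"
  by auto

lemma stage_row:
  assumes "\<epsilon> \<in> {0<..<\<epsilon>0}" "i \<in> {1..s}" "x \<in> D"
  shows "dens (S \<epsilon> i) x = dens (Sn \<epsilon>) x - dt / \<epsilon> * (\<Sum>j\<in>{1..i}. a i j * divergence (vel (S \<epsilon> j)) x)"
    and "vel (S \<epsilon> i) x = vel (Sn \<epsilon>) x - dt *\<^sub>R (\<Sum>j\<in>{1..i}. a i j *\<^sub>R flux_A (S \<epsilon> j) x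
        + (a i j / \<epsilon>) *\<^sub>R gradient (\<lambda>y. temp (S \<epsilon> j) y + dens (S \<epsilon> j) y) x)"
    and "temp (S \<epsilon> i) x = temp (Sn \<epsilon>) x - dt * (\<Sum>j\<in>{1..i}. a i j / real CARD('d) * flux_B (S \<epsilon> j) x
        + 2 * a i j / (real CARD('d) * \<epsilon>) * divergence (vel (S \<epsilon> j)) x)"
    and "micro (S \<epsilon> i) x v = micro (Sn \<epsilon>) x v
        - dt / \<epsilon>\<^sup>2 * (\<Sum>j\<in>{1..<i}. ta i j * explicit_micro \<tau> \<epsilon> (S \<epsilon> j) x v)
        - dt / (\<epsilon>\<^sup>2 * \<tau>) * (\<Sum>j\<in>{1..i}. a i j * micro (S \<epsilon> j) x v)"
proof -
  have "micro_macro_row D \<tau> dt \<epsilon> {1..<i} (ta i) {1..i} (a i) (Sn \<epsilon>) (S \<epsilon>) (S \<epsilon> i)"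
    using scheme[OF assms(1)] assms(2) by (simp add: micro_macro_imex_def)
  note row = this[unfolded micro_macro_row_def, THEN bspec, OF assms(3)]
  show "dens (S \<epsilon> i) x = dens (Sn \<epsilon>) x - dt / \<epsilon> * (\<Sum>j\<in>{1..i}. a i j * divergence (vel (S \<epsilon> j)) x)"
    and "vel (S \<epsilon> i) x = vel (Sn \<epsilon>) x - dt *\<^sub>R (\<Sum>j\<in>{1..i}. a i j *\<^sub>R flux_A (S \<epsilon> j) x
        + (a i j / \<epsilon>) *\<^sub>R gradient (\<lambda>y. temp (S \<epsilon> j) y + dens (S \<epsilon> j) y) x)"
    and "temp (S \<epsilon> i) x = temp (Sn \<epsilon>) x - dt * (\<Sum>j\<in>{1..i}. a i j / real CARD('d) * flux_B (S \<epsilon> j) x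
        + 2 * a i j / (real CARD('d) * \<epsilon>) * divergence (vel (S \<epsilon> j)) x)"
    and "micro (S \<epsilon> i) x v = micro (Sn \<epsilon>) x v
        - dt / \<epsilon>\<^sup>2 * (\<Sum>j\<in>{1..<i}. ta i j * explicit_micro \<tau> \<epsilon> (S \<epsilon> j) x v)
        - dt / (\<epsilon>\<^sup>2 * \<tau>) * (\<Sum>j\<in>{1..i}. a i j * micro (S \<epsilon> j) x v)"
    using row by blast+
qed

lemmas stage_limit = formal_limit_tendsto[OF D eventually_admissible limit_stages]
lemmas n_limit = formal_limit_tendsto[OF D eventually_admissible_n limit_n]

lemma stage_admissible: "i \<in> {1..s} \<Longrightarrow> admissible D (S0 i)"
  using limit_stages by (simp add: formal_limit_def)

lemma dens_eq_minus_temp: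
  "x \<in> D \<Longrightarrow> dens Sn0 x = - temp Sn0 x"
  "i \<in> {1..s} \<Longrightarrow> x \<in> D \<Longrightarrow> dens (S0 i) x = - temp (S0 i) x"
  using formal_limit_press_eq_0[OF D eventually_admissible_n limit_n]
    formal_limit_press_eq_0[OF D eventually_admissible limit_stages]
  by (simp_all add: eq_neg_iff_add_eq_0)

lemma limit_divergence_free:
  assumes i: "i \<in> {1..s}" and x: "x \<in> D"
  shows "divergence (vel (S0 i)) x = 0"
proof -
  have "(\<Sum>j\<in>{1..i}. a i j * divergence (vel (S0 j)) x) = 0" if i: "i \<in> {1..s}" for i
  proof -
    have 1: "((\<lambda>\<epsilon>. \<Sum>j\<in>{1..i}. a i j * divergence (vel (S \<epsilon> j)) x) \<longlongrightarrow>
        (\<Sum>j\<in>{1..i}. a i j * divergence (vel (S0 j)) x)) (at_right 0)"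
      by (intro tendsto_sum tendsto_mult tendsto_const
          formal_limit_divergence[OF D eventually_admissible limit_stages x] sub_stage(1)[OF i])
    \<comment> \<open>The density row multiplied by - \<epsilon> / dt: the densities have finite
      limits, so their scaled difference tends to 0.\<close>
    have 2: "((\<lambda>\<epsilon>. - (\<epsilon> / dt) * (dens (S \<epsilon> i) x - dens (Sn \<epsilon>) x)) \<longlongrightarrow>
        - (0 / dt) * (dens (S0 i) x - dens Sn0 x)) (at_right 0)"
      using dt by (intro tendsto_intros stage_limit n_limit i x) auto
    have "\<forall>\<^sub>F \<epsilon> in at_right 0. - (\<epsilon> / dt) * (dens (S \<epsilon> i) x - dens (Sn \<epsilon>) x) =
        (\<Sum>j\<in>{1..i}. a i j * divergence (vel (S \<epsilon> j)) x)"
      using eventually_small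
    proof eventually_elim
      case (elim \<epsilon>)
      then show ?case using stage_row(1)[OF elim i x] dt by simp
    qed
    from tendsto_unique[OF trivial_limit_at_right_real 1 Lim_transform_eventually[OF 2 this]]
    show ?thesis by simp
  qed
  from type_A_injective[OF tableaux typeA this i] show ?thesis .
qed

lemma limit_vel:
  assumes i: "i \<in> {1..s}" and x: "x \<in> D"
  shows "vel (S0 i) x = vel Sn0 x - dt *\<^sub>R (\<Sum>j\<in>{1..i}. a i j *\<^sub>R flux_A (S0 j) x + a i j *\<^sub>R gradient (q0 j) x)"
proof -
  have 1: "((\<lambda>\<epsilon>. vel (Sn \<epsilon>) x - dt *\<^sub>R (\<Sum>j\<in>{1..i}. a i j *\<^sub>R flux_A (S \<epsilon> j) x
        + a i j *\<^sub>R ((1 / \<epsilon>) *\<^sub>R gradient (\<lambda>y. temp (S \<epsilon> j) y + dens (S \<epsilon> j) y) x))) \<longlongrightarrow>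
      vel Sn0 x - dt *\<^sub>R (\<Sum>j\<in>{1..i}. a i j *\<^sub>R flux_A (S0 j) x + a i j *\<^sub>R gradient (q0 j) x)) (at_right 0)"
    by (intro tendsto_diff tendsto_sum tendsto_add tendsto_scaleR tendsto_const n_limit x
        formal_limit_flux_A[OF D eventually_admissible limit_stages]
        formal_limit_gradient[OF D eventually_admissible limit_stages] sub_stage(1)[OF i])
  have "\<forall>\<^sub>F \<epsilon> in at_right 0. vel (Sn \<epsilon>) x - dt *\<^sub>R (\<Sum>j\<in>{1..i}. a i j *\<^sub>R flux_A (S \<epsilon> j) x
        + a i j *\<^sub>R ((1 / \<epsilon>) *\<^sub>R gradient (\<lambda>y. temp (S \<epsilon> j) y + dens (S \<epsilon> j) y) x)) = vel (S \<epsilon> i) x"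
    using eventually_small
  proof eventually_elim
    case (elim \<epsilon>)
    then show ?case unfolding stage_row(2)[OF elim i x] by simp
  qed
  from tendsto_unique[OF trivial_limit_at_right_real stage_limit(2)[OF i i x] Lim_transform_eventually[OF 1 this]]
  show ?thesis .
qed

text \<open>After multiplication of the row by \<epsilon>^2 \<tau> / dt the increment of g, and with
  it the old value of g, disappears in the limit. What remains is an algebraic relation for each
  fixed x and v.\<close>

lemma limit_micro:
  assumes i: "i \<in> {1..s}" and x: "x \<in> D"
  shows "(\<Sum>j\<in>{1..i}. a i j * micro (S0 j) x v) = - \<tau> * (\<Sum>j\<in>{1..<i}. ta i j * macro_source (S0 j) \<tau> x v)"
proof -
  have 1: "((\<lambda>\<epsilon>. \<Sum>j\<in>{1..i}. a i j * micro (S \<epsilon> j) x v) \<longlongrightarrow> (\<Sum>j\<in>{1..i}. a i j * micro (S0 j) x v)) (at_right 0)"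
    by (intro tendsto_sum tendsto_mult tendsto_const stage_limit(4) x sub_stage(1)[OF i])
  have 2: "((\<lambda>\<epsilon>. - (\<epsilon>\<^sup>2 * \<tau> / dt) * (micro (S \<epsilon> i) x v - micro (Sn \<epsilon>) x v)
      - \<tau> * (\<Sum>j\<in>{1..<i}. ta i j * explicit_micro \<tau> \<epsilon> (S \<epsilon> j) x v)) \<longlongrightarrow>
     - (0\<^sup>2 * \<tau> / dt) * (micro (S0 i) x v - micro Sn0 x v)
      - \<tau> * (\<Sum>j\<in>{1..<i}. ta i j * macro_source (S0 j) \<tau> x v)) (at_right 0)"
    using dt by (intro tendsto_intros stage_limit(4) n_limit(4) i x
        formal_limit_explicit_micro[OF D eventually_admissible limit_stages \<tau>] sub_stage(2)[OF i]) auto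
  have "\<forall>\<^sub>F \<epsilon> in at_right 0. - (\<epsilon>\<^sup>2 * \<tau> / dt) * (micro (S \<epsilon> i) x v - micro (Sn \<epsilon>) x v)
      - \<tau> * (\<Sum>j\<in>{1..<i}. ta i j * explicit_micro \<tau> \<epsilon> (S \<epsilon> j) x v) = (\<Sum>j\<in>{1..i}. a i j * micro (S \<epsilon> j) x v)"
    using eventually_small
  proof eventually_elim
    case (elim \<epsilon>)
    have "c = - (\<epsilon>\<^sup>2 * \<tau> / dt) * (m - m') - \<tau> * e" if "m = m' - dt / \<epsilon>\<^sup>2 * e - dt / (\<epsilon>\<^sup>2 * \<tau>) * c" for c m m' e :: real
      unfolding that using dt \<tau> elim by (simp add: field_simps)
    from this[OF stage_row(4)[OF elim i x]] show ?case by simp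
  qed
  from tendsto_unique[OF trivial_limit_at_right_real 1 Lim_transform_eventually[OF 2 this]]
  show ?thesis by simp
qed

text \<open>The density equation eliminates the singular term \<open>\<nabla> \<cdot> u / \<epsilon>\<close>.\<close>

lemma limit_temp:
  assumes i: "i \<in> {1..s}" and x: "x \<in> D"
  shows "(1 + 2 / real CARD('d)) * (temp (S0 i) x - temp Sn0 x) =
    - dt * (\<Sum>j\<in>{1..i}. a i j / real CARD('d) * flux_B (S0 j) x)"
proof -
  let ?d = "real CARD('d)"
  have 1: "((\<lambda>\<epsilon>. temp (S \<epsilon> i) x - temp (Sn \<epsilon>) x - 2 / ?d * (dens (S \<epsilon> i) x - dens (Sn \<epsilon>) x)) \<longlongrightarrow>
      temp (S0 i) x - temp Sn0 x - 2 / ?d * (dens (S0 i) x - dens Sn0 x)) (at_right 0)"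
    by (intro tendsto_diff tendsto_mult tendsto_const stage_limit n_limit i x)
  have 2: "((\<lambda>\<epsilon>. - dt * (\<Sum>j\<in>{1..i}. a i j / ?d * flux_B (S \<epsilon> j) x)) \<longlongrightarrow>
      - dt * (\<Sum>j\<in>{1..i}. a i j / ?d * flux_B (S0 j) x)) (at_right 0)"
    by (intro tendsto_mult tendsto_sum tendsto_const x
        formal_limit_flux_B[OF D eventually_admissible limit_stages] sub_stage(1)[OF i])
  have "\<forall>\<^sub>F \<epsilon> in at_right 0. - dt * (\<Sum>j\<in>{1..i}. a i j / ?d * flux_B (S \<epsilon> j) x) =
      temp (S \<epsilon> i) x - temp (Sn \<epsilon>) x - 2 / ?d * (dens (S \<epsilon> i) x - dens (Sn \<epsilon>) x)"
    using eventually_small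
  proof eventually_elim
    case (elim \<epsilon>)
    have "(\<Sum>j\<in>{1..i}. 2 * a i j / (?d * \<epsilon>) * divergence (vel (S \<epsilon> j)) x) =
        2 / (?d * \<epsilon>) * (\<Sum>j\<in>{1..i}. a i j * divergence (vel (S \<epsilon> j)) x)"
      by (simp add: sum_distrib_left mult.assoc)
    then show ?case
      unfolding stage_row(1,3)[OF elim i x] sum.distrib
      by (simp add: algebra_simps)
  qed
  from tendsto_unique[OF trivial_limit_at_right_real 1 Lim_transform_eventually[OF 2 this]]
  \<comment> \<open>With \<rho> = - T, the term - 2 / d times the density increment becomes + 2 / d
    times the temperature increment; this is the origin of 1 + 2 / d.\<close>
  show ?thesis unfolding dens_eq_minus_temp(1)[OF x] dens_eq_minus_temp(2)[OF i x] by (simp add: algebra_simps)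
qed

text \<open>\<open>limit_micro\<close> integrated against A: symmetrization doubles the 1 / (2
  \<tau>) in the coefficient of A, and the factor - \<tau> turns the result into u u^T minus \<tau>
  times the symmetrized gradient; the trace part gives the diagonal term.\<close>

lemma limit_moment_A:
  assumes i: "i \<in> {1..s}" and x: "x \<in> D"
  shows "(\<Sum>j\<in>{1..i}. a i j * moment_A (S0 j) m n x) = (\<Sum>j\<in>{1..<i}. ta i j *
    (vel (S0 j) x $ m * vel (S0 j) x $ n - of_bool (m = n) * ((norm (vel (S0 j) x))\<^sup>2 / real CARD('d))
     - \<tau> * (partial m (\<lambda>z. vel (S0 j) z $ n) x + partial n (\<lambda>z. vel (S0 j) z $ m) x)))"
proof -
  let ?d = "real CARD('d)"
  let ?X = "\<lambda>j k l. partial k (\<lambda>y. vel (S0 j) y $ l) x - vel (S0 j) x $ k * vel (S0 j) x $ l / (2 * \<tau>)"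
  have 1: "has_avg (\<lambda>v. \<Sum>j\<in>{1..i}. a i j * (micro (S0 j) x v * tensor_A v $ m $ n))
      (\<Sum>j\<in>{1..i}. a i j * moment_A (S0 j) m n x)"
    by (intro has_avg_sum has_avg_cmult has_avg_moment_A[OF stage_admissible x] sub_stage(1)[OF i])
  have 2: "has_avg (\<lambda>v. - \<tau> * (\<Sum>j\<in>{1..<i}. ta i j * (macro_source (S0 j) \<tau> x v * tensor_A v $ m $ n)))
     (- \<tau> * (\<Sum>j\<in>{1..<i}. ta i j * (?X j m n + ?X j n m - of_bool (m = n) * (2 / ?d * (\<Sum>k\<in>UNIV. ?X j k k)))))"
    unfolding macro_source_def by (intro has_avg_sum has_avg_cmult has_avg_quadratic_source_tensor_A)
  have 3: "(\<Sum>j\<in>{1..i}. a i j * (micro (S0 j) x v * tensor_A v $ m $ n)) =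
      - \<tau> * (\<Sum>j\<in>{1..<i}. ta i j * (macro_source (S0 j) \<tau> x v * tensor_A v $ m $ n))" for v
  proof -
    have "(\<Sum>j\<in>{1..i}. a i j * (micro (S0 j) x v * tensor_A v $ m $ n)) =
        (\<Sum>j\<in>{1..i}. a i j * micro (S0 j) x v) * tensor_A v $ m $ n"
      by (simp add: sum_distrib_right mult.assoc)
    then show ?thesis unfolding limit_micro[OF i x] by (simp add: sum_distrib_right mult.assoc)
  qed
  have "(\<Sum>j\<in>{1..i}. a i j * moment_A (S0 j) m n x) =
      - \<tau> * (\<Sum>j\<in>{1..<i}. ta i j * (?X j m n + ?X j n m - of_bool (m = n) * (2 / ?d * (\<Sum>k\<in>UNIV. ?X j k k))))"
    by (rule has_avg_unique[OF 1, unfolded 3, OF 2])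
  also have "\<dots> = (\<Sum>j\<in>{1..<i}. ta i j *
    (vel (S0 j) x $ m * vel (S0 j) x $ n - of_bool (m = n) * ((norm (vel (S0 j) x))\<^sup>2 / ?d)
     - \<tau> * (partial m (\<lambda>z. vel (S0 j) z $ n) x + partial n (\<lambda>z. vel (S0 j) z $ m) x)))"
    unfolding sum_distrib_left[of "- \<tau>"]
  proof (rule sum.cong[OF refl])
    fix j assume "j \<in> {1..<i}"
    then have j: "j \<in> {1..s}" by (rule sub_stage(2)[OF i])
    have "vel (S0 j) differentiable (at x)"
      using smooth[OF j] C2_on_differentiable(1)[OF _ D x] by blast
    then have "(\<Sum>k\<in>UNIV. partial k (\<lambda>y. vel (S0 j) y $ k) x) = 0"
      using limit_divergence_free[OF j x] by (simp add: divergence_def partial_nth)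
    \<comment> \<open>As div u = 0, only the quadratic part of the trace remains; multiplied by 2
      \<tau> / d it gives - |u|^2 / d.\<close>
    then have tr: "(\<Sum>k\<in>UNIV. ?X j k k) = - (norm (vel (S0 j) x))\<^sup>2 / (2 * \<tau>)"
      unfolding norm_power2_eq_sum by (simp add: sum_subtractf sum_divide_distrib)
    show "- \<tau> * (ta i j * (?X j m n + ?X j n m - of_bool (m = n) * (2 / ?d * (\<Sum>k\<in>UNIV. ?X j k k)))) =
      ta i j * (vel (S0 j) x $ m * vel (S0 j) x $ n - of_bool (m = n) * ((norm (vel (S0 j) x))\<^sup>2 / ?d)
     - \<tau> * (partial m (\<lambda>z. vel (S0 j) z $ n) x + partial n (\<lambda>z. vel (S0 j) z $ m) x))"
      unfolding tr using \<tau> by (simp add: field_simps)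
  qed
  finally show ?thesis .
qed

text \<open>The mean of B B carries the constant 2 (d + 2), whose 2 cancels the halves in the
  coefficient of B.\<close>

lemma limit_moment_B:
  assumes i: "i \<in> {1..s}" and x: "x \<in> D"
  shows "(\<Sum>j\<in>{1..i}. a i j * moment_B (S0 j) n x) = (real CARD('d) + 2) * (\<Sum>j\<in>{1..<i}. ta i j *
    (vel (S0 j) x $ n * temp (S0 j) x - \<tau> * partial n (temp (S0 j)) x))"
proof -
  let ?d = "real CARD('d)"
  let ?Y = "\<lambda>j k. partial k (temp (S0 j)) x / 2 - vel (S0 j) x $ k * temp (S0 j) x / (2 * \<tau>)"
  have 1: "has_avg (\<lambda>v. \<Sum>j\<in>{1..i}. a i j * (micro (S0 j) x v * vector_B v $ n))
      (\<Sum>j\<in>{1..i}. a i j * moment_B (S0 j) n x)"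
    by (intro has_avg_sum has_avg_cmult has_avg_moment_B[OF stage_admissible x] sub_stage(1)[OF i])
  have 2: "has_avg (\<lambda>v. - \<tau> * (\<Sum>j\<in>{1..<i}. ta i j * (macro_source (S0 j) \<tau> x v * vector_B v $ n)))
     (- \<tau> * (\<Sum>j\<in>{1..<i}. ta i j * (2 * (?d + 2) * ?Y j n)))"
    unfolding macro_source_def by (intro has_avg_sum has_avg_cmult has_avg_quadratic_source_vector_B)
  have 3: "(\<Sum>j\<in>{1..i}. a i j * (micro (S0 j) x v * vector_B v $ n)) =
      - \<tau> * (\<Sum>j\<in>{1..<i}. ta i j * (macro_source (S0 j) \<tau> x v * vector_B v $ n))" for v
  proof -
    have "(\<Sum>j\<in>{1..i}. a i j * (micro (S0 j) x v * vector_B v $ n)) =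
        (\<Sum>j\<in>{1..i}. a i j * micro (S0 j) x v) * vector_B v $ n"
      by (simp add: sum_distrib_right mult.assoc)
    then show ?thesis unfolding limit_micro[OF i x] by (simp add: sum_distrib_right mult.assoc)
  qed
  have "(\<Sum>j\<in>{1..i}. a i j * moment_B (S0 j) n x) =
      - \<tau> * (\<Sum>j\<in>{1..<i}. ta i j * (2 * (?d + 2) * ?Y j n))"
    by (rule has_avg_unique[OF 1, unfolded 3, OF 2])
  also have "\<dots> = (?d + 2) * (\<Sum>j\<in>{1..<i}. ta i j *
    (vel (S0 j) x $ n * temp (S0 j) x - \<tau> * partial n (temp (S0 j)) x))"
    unfolding sum_distrib_left using \<tau> by (intro sum.cong refl) (simp add: field_simps)
  finally show ?thesis .
qed

text \<open>Since \<open>limit_moment_A\<close> holds throughout the open set D, its divergence can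
  be taken, and \<open>stress_divergence\<close> evaluates the right side. The individual fluxes
  stay unknown.\<close>

lemma limit_flux_A:
  assumes i: "i \<in> {1..s}" and x: "x \<in> D"
  shows "(\<Sum>j\<in>{1..i}. a i j * flux_A (S0 j) x $ m) = (\<Sum>j\<in>{1..<i}. ta i j *
    (convection (vel (S0 j)) x $ m - partial m (\<lambda>y. (norm (vel (S0 j) y))\<^sup>2 / real CARD('d)) x
      - \<tau> * laplacian (vel (S0 j)) x $ m))"
proof -
  let ?G = "\<lambda>j m n y. vel (S0 j) y $ m * vel (S0 j) y $ n - of_bool (m = n) * ((norm (vel (S0 j) y))\<^sup>2 / real CARD('d))
     - \<tau> * (partial m (\<lambda>z. vel (S0 j) z $ n) y + partial n (\<lambda>z. vel (S0 j) z $ m) y)"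
  have dA: "moment_A (S0 j) m n differentiable (at x)" if "j \<in> {1..i}" for j n
    by (rule moment_A_differentiable[OF D stage_admissible x]) (rule sub_stage(1)[OF i that])
  have G: "?G j m n differentiable (at x)"
    "(\<Sum>n\<in>UNIV. partial n (?G j m n) x) = convection (vel (S0 j)) x $ m
      - partial m (\<lambda>y. (norm (vel (S0 j) y))\<^sup>2 / real CARD('d)) x - \<tau> * laplacian (vel (S0 j)) x $ m"
    if "j \<in> {1..<i}" for j n
    using stress_divergence[OF D x, of "vel (S0 j)"] smooth limit_divergence_free sub_stage(2)[OF i that] by auto
  have "(\<Sum>j\<in>{1..i}. a i j * flux_A (S0 j) x $ m) = (\<Sum>j\<in>{1..i}. a i j * (\<Sum>n\<in>UNIV. partial n (moment_A (S0 j) m n) x))"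
    by (intro sum.cong refl arg_cong2[where f = "(*)"] flux_A_eq[OF D x stage_admissible] sub_stage(1)[OF i])
  also have "\<dots> = (\<Sum>n\<in>UNIV. \<Sum>j\<in>{1..i}. a i j * partial n (moment_A (S0 j) m n) x)"
    unfolding sum_distrib_left by (rule sum.swap)
  also have "\<dots> = (\<Sum>n\<in>UNIV. partial n (\<lambda>y. \<Sum>j\<in>{1..i}. a i j * moment_A (S0 j) m n y) x)"
    by (intro sum.cong refl, subst partial_sum) (simp_all add: partial_cmult dA)
  also have "\<dots> = (\<Sum>n\<in>UNIV. partial n (\<lambda>y. \<Sum>j\<in>{1..<i}. ta i j * ?G j m n y) x)"
    by (intro sum.cong refl partial_cong_open[OF D x] limit_moment_A i)
  also have "\<dots> = (\<Sum>n\<in>UNIV. \<Sum>j\<in>{1..<i}. ta i j * partial n (?G j m n) x)"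
  proof (intro sum.cong refl)
    fix n
    have "partial n (\<lambda>y. \<Sum>j\<in>{1..<i}. ta i j * ?G j m n y) x = (\<Sum>j\<in>{1..<i}. partial n (\<lambda>y. ta i j * ?G j m n y) x)"
      by (rule partial_sum) (intro differentiable_mult differentiable_const G(1))
    also have "\<dots> = (\<Sum>j\<in>{1..<i}. ta i j * partial n (?G j m n) x)"
      by (intro sum.cong refl partial_cmult G(1))
    finally show "partial n (\<lambda>y. \<Sum>j\<in>{1..<i}. ta i j * ?G j m n y) x = (\<Sum>j\<in>{1..<i}. ta i j * partial n (?G j m n) x)" .
  qed
  also have "\<dots> = (\<Sum>j\<in>{1..<i}. ta i j * (\<Sum>n\<in>UNIV. partial n (?G j m n) x))"
    unfolding sum_distrib_left by (rule sum.swap)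
  also have "\<dots> = (\<Sum>j\<in>{1..<i}. ta i j *
    (convection (vel (S0 j)) x $ m - partial m (\<lambda>y. (norm (vel (S0 j) y))\<^sup>2 / real CARD('d)) x
      - \<tau> * laplacian (vel (S0 j)) x $ m))"
    by (intro sum.cong refl arg_cong2[where f = "(*)"] G(2))
  finally show ?thesis .
qed

lemma limit_flux_B:
  assumes i: "i \<in> {1..s}" and x: "x \<in> D"
  shows "(\<Sum>j\<in>{1..i}. a i j * flux_B (S0 j) x) = (real CARD('d) + 2) * (\<Sum>j\<in>{1..<i}. ta i j *
    (divergence (\<lambda>y. temp (S0 j) y *\<^sub>R vel (S0 j) y) x - \<tau> * laplacian (temp (S0 j)) x))"
proof -
  let ?d = "real CARD('d)"
  let ?H = "\<lambda>j n y. vel (S0 j) y $ n * temp (S0 j) y - \<tau> * partial n (temp (S0 j)) y"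
  have dB: "moment_B (S0 j) n differentiable (at x)" if "j \<in> {1..i}" for j n
    by (rule moment_B_differentiable[OF D stage_admissible x]) (rule sub_stage(1)[OF i that])
  have H: "?H j n differentiable (at x)"
    "(\<Sum>n\<in>UNIV. partial n (?H j n) x) =
      divergence (\<lambda>y. temp (S0 j) y *\<^sub>R vel (S0 j) y) x - \<tau> * laplacian (temp (S0 j)) x"
    if "j \<in> {1..<i}" for j n
    using heat_flux_divergence[OF D x, of "vel (S0 j)" "temp (S0 j)"] smooth sub_stage(2)[OF i that] by auto
  have dS: "(\<lambda>y. \<Sum>j\<in>{1..<i}. ta i j * ?H j n y) differentiable (at x)" for n
    by (intro differentiable_sum finite_atLeastLessThan ballI differentiable_mult differentiable_const H(1))
  have "(\<Sum>j\<in>{1..i}. a i j * flux_B (S0 j) x) = (\<Sum>j\<in>{1..i}. a i j * (\<Sum>n\<in>UNIV. partial n (moment_B (S0 j) n) x))"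
    by (intro sum.cong refl arg_cong2[where f = "(*)"] flux_B_eq[OF D x stage_admissible] sub_stage(1)[OF i])
  also have "\<dots> = (\<Sum>n\<in>UNIV. \<Sum>j\<in>{1..i}. a i j * partial n (moment_B (S0 j) n) x)"
    unfolding sum_distrib_left by (rule sum.swap)
  also have "\<dots> = (\<Sum>n\<in>UNIV. partial n (\<lambda>y. \<Sum>j\<in>{1..i}. a i j * moment_B (S0 j) n y) x)"
    by (intro sum.cong refl, subst partial_sum) (simp_all add: partial_cmult dB)
  also have "\<dots> = (\<Sum>n\<in>UNIV. partial n (\<lambda>y. (?d + 2) * (\<Sum>j\<in>{1..<i}. ta i j * ?H j n y)) x)"
    by (intro sum.cong refl partial_cong_open[OF D x] limit_moment_B i)
  also have "\<dots> = (\<Sum>n\<in>UNIV. (?d + 2) * (\<Sum>j\<in>{1..<i}. ta i j * partial n (?H j n) x))"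
  proof (intro sum.cong refl)
    fix n
    have "partial n (\<lambda>y. \<Sum>j\<in>{1..<i}. ta i j * ?H j n y) x = (\<Sum>j\<in>{1..<i}. partial n (\<lambda>y. ta i j * ?H j n y) x)"
      by (rule partial_sum) (intro differentiable_mult differentiable_const H(1))
    also have "\<dots> = (\<Sum>j\<in>{1..<i}. ta i j * partial n (?H j n) x)"
      by (intro sum.cong refl partial_cmult H(1))
    finally show "partial n (\<lambda>y. (?d + 2) * (\<Sum>j\<in>{1..<i}. ta i j * ?H j n y)) x =
        (?d + 2) * (\<Sum>j\<in>{1..<i}. ta i j * partial n (?H j n) x)"
      unfolding partial_cmult[OF dS] by (rule arg_cong)
  qed
  also have "\<dots> = (?d + 2) * (\<Sum>j\<in>{1..<i}. ta i j * (\<Sum>n\<in>UNIV. partial n (?H j n) x))"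
    unfolding sum_distrib_left[symmetric] unfolding sum_distrib_left[of "ta i _"]
    by (rule arg_cong[OF sum.swap])
  also have "\<dots> = (?d + 2) * (\<Sum>j\<in>{1..<i}. ta i j *
    (divergence (\<lambda>y. temp (S0 j) y *\<^sub>R vel (S0 j) y) x - \<tau> * laplacian (temp (S0 j)) x))"
    by (intro sum.cong refl arg_cong2[where f = "(*)"] H(2))
  finally show ?thesis .
qed

lemma limit_stages_ins:
  "\<exists>\<pi>. (\<forall>i\<in>{1..s}. \<pi> i differentiable_on D) \<and>
     absorbed_pressure D s ta a (\<lambda>i. vel (S0 i)) q0 \<pi> \<and>
     ins_imex_stages D \<tau> dt s ta a (vel Sn0) (temp Sn0)
       (\<lambda>i. dens (S0 i)) (\<lambda>i. vel (S0 i)) (\<lambda>i. temp (S0 i)) \<pi>"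
proof -
  let ?d = "real CARD('d)"
  obtain b where b: "\<forall>r. \<forall>i\<in>{1..s}. (\<Sum>j\<in>{1..i}. a i j * (\<Sum>k=1..s. b j k * r k)) = r i"
    using type_A_solvable[OF tableaux typeA] by (elim exE)
  let ?N = "\<lambda>j x. (norm (vel (S0 j) x))\<^sup>2 / ?d"
  \<comment> \<open>The terms |u|^2 / d carry the explicit coefficients \<open>ta\<close>, the
    pressures the implicit \<open>a\<close>. The correction is therefore the inverse of
    \<open>a\<close>, composed with \<open>ta\<close>, applied to the stage values of |u|^2 /
    d.\<close>
  define \<pi> where "\<pi> j x = q0 j x - (\<Sum>k=1..s. b j k * (\<Sum>l\<in>{1..<k}. ta k l * ?N l x))" for j x
  have dq: "q0 j differentiable (at x)" if "j \<in> {1..s}" "x \<in> D" for j x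
    using limit_stages[OF that(1)] differentiable_on_openD[OF _ D that(2)] unfolding formal_limit_def by blast
  have dN: "?N j differentiable (at x)" if "j \<in> {1..s}" "x \<in> D" for j x
    using norm_power2_differentiable smooth[OF that(1)] C2_on_differentiable(1)[OF _ D that(2)] by blast
  have dsum: "(\<lambda>x. \<Sum>k=1..s. b j k * (\<Sum>l\<in>{1..<k}. ta k l * ?N l x)) differentiable (at x)" if "x \<in> D" for x j
    by (intro differentiable_sum finite_atLeastAtMost finite_atLeastLessThan ballI differentiable_mult
        differentiable_const dN[OF _ that]) auto
  have d\<pi>: "\<pi> j differentiable (at x)" if "j \<in> {1..s}" "x \<in> D" for j x
    unfolding \<pi>_def[abs_def] by (intro differentiable_diff dq dsum that)
  have abs: "(\<Sum>j\<in>{1..i}. a i j * \<pi> j x) = (\<Sum>j\<in>{1..i}. a i j * q0 j x) - (\<Sum>j\<in>{1..<i}. ta i j * ?N j x)"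
    if "i \<in> {1..s}" for i x
    unfolding \<pi>_def right_diff_distrib sum_subtractf b[THEN spec, THEN bspec, OF that, of "\<lambda>k. \<Sum>l\<in>{1..<k}. ta k l * ?N l x"] ..
  \<comment> \<open>The relation just obtained is an identity between functions of x, so it passes
    to partial derivatives.\<close>
  have grad: "(\<Sum>j\<in>{1..i}. a i j * partial m (\<pi> j) x) =
      (\<Sum>j\<in>{1..i}. a i j * partial m (q0 j) x) - (\<Sum>j\<in>{1..<i}. ta i j * partial m (?N j) x)"
    if i: "i \<in> {1..s}" and x: "x \<in> D" for i x m
  proof -
    have lin1: "partial m (\<lambda>y. \<Sum>j\<in>J. c j * f j y) x = (\<Sum>j\<in>J. c j * partial m (f j) x)"
      and lin2: "(\<lambda>y. \<Sum>j\<in>J. c j * f j y) differentiable (at x)"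
      if f: "\<And>j. j \<in> J \<Longrightarrow> f j differentiable (at x)" and J: "finite J"
      for J :: "nat set" and c :: "nat \<Rightarrow> real" and f :: "nat \<Rightarrow> real^'d \<Rightarrow> real"
    proof -
      have "partial m (\<lambda>y. \<Sum>j\<in>J. c j * f j y) x = (\<Sum>j\<in>J. partial m (\<lambda>y. c j * f j y) x)"
        by (rule partial_sum) (intro differentiable_mult differentiable_const f)
      also have "\<dots> = (\<Sum>j\<in>J. c j * partial m (f j) x)"
        by (intro sum.cong refl partial_cmult f)
      finally show "partial m (\<lambda>y. \<Sum>j\<in>J. c j * f j y) x = (\<Sum>j\<in>J. c j * partial m (f j) x)" .
      show "(\<lambda>y. \<Sum>j\<in>J. c j * f j y) differentiable (at x)"
        by (intro differentiable_sum ballI differentiable_mult differentiable_const f J)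
    qed
    have \<pi>: "\<pi> j differentiable (at x)" and q: "q0 j differentiable (at x)" if "j \<in> {1..i}" for j
      by (rule d\<pi>[OF sub_stage(1)[OF i that] x], rule dq[OF sub_stage(1)[OF i that] x])
    have N: "?N j differentiable (at x)" if "j \<in> {1..<i}" for j
      by (rule dN[OF sub_stage(2)[OF i that] x])
    have "(\<Sum>j\<in>{1..i}. a i j * partial m (\<pi> j) x) = partial m (\<lambda>y. \<Sum>j\<in>{1..i}. a i j * \<pi> j y) x"
      by (rule lin1[symmetric]) (simp_all only: \<pi> finite_atLeastAtMost)
    also have "\<dots> = partial m (\<lambda>y. (\<Sum>j\<in>{1..i}. a i j * q0 j y) - (\<Sum>j\<in>{1..<i}. ta i j * ?N j y)) x"
      unfolding abs[OF i] ..
    also have "\<dots> = partial m (\<lambda>y. \<Sum>j\<in>{1..i}. a i j * q0 j y) x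
        - partial m (\<lambda>y. \<Sum>j\<in>{1..<i}. ta i j * ?N j y) x"
      by (rule partial_diff; rule lin2) (simp_all only: q N finite_atLeastAtMost finite_atLeastLessThan)
    also have "partial m (\<lambda>y. \<Sum>j\<in>{1..i}. a i j * q0 j y) x = (\<Sum>j\<in>{1..i}. a i j * partial m (q0 j) x)"
      by (rule lin1) (simp_all only: q finite_atLeastAtMost)
    also have "partial m (\<lambda>y. \<Sum>j\<in>{1..<i}. ta i j * ?N j y) x = (\<Sum>j\<in>{1..<i}. ta i j * partial m (?N j) x)"
      by (rule lin1) (simp_all only: N finite_atLeastLessThan)
    finally show ?thesis .
  qed
  have press: "gradient (\<lambda>y. dens (S0 i) y + temp (S0 i) y) x = 0" if i: "i \<in> {1..s}" and x: "x \<in> D" for i x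
    unfolding gradient_def vec_eq_iff vec_lambda_beta zero_index
    by (intro allI partial_eq_0_open[OF D x]) (simp only: dens_eq_minus_temp(2)[OF i] left_minus)
  have vel: "vel (S0 i) x = vel Sn0 x
       + dt *\<^sub>R (\<Sum>j\<in>{1..<i}. ta i j *\<^sub>R (\<tau> *\<^sub>R laplacian (vel (S0 j)) x - convection (vel (S0 j)) x))
       - dt *\<^sub>R (\<Sum>j\<in>{1..i}. a i j *\<^sub>R gradient (\<pi> j) x)" if i: "i \<in> {1..s}" and x: "x \<in> D" for i x
  proof -
    have "vel (S0 i) x $ m = (vel Sn0 x
       + dt *\<^sub>R (\<Sum>j\<in>{1..<i}. ta i j *\<^sub>R (\<tau> *\<^sub>R laplacian (vel (S0 j)) x - convection (vel (S0 j)) x))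
       - dt *\<^sub>R (\<Sum>j\<in>{1..i}. a i j *\<^sub>R gradient (\<pi> j) x)) $ m" for m
    proof -
      have "vel (S0 i) x $ m = vel Sn0 x $ m - dt * ((\<Sum>j\<in>{1..i}. a i j * flux_A (S0 j) x $ m)
          + (\<Sum>j\<in>{1..i}. a i j * partial m (q0 j) x))"
        by (subst limit_vel[OF i x]) (simp add: gradient_def sum.distrib)
      also have "\<dots> = vel Sn0 x $ m + dt * (\<Sum>j\<in>{1..<i}. ta i j * (\<tau> * laplacian (vel (S0 j)) x $ m - convection (vel (S0 j)) x $ m))
          - dt * (\<Sum>j\<in>{1..i}. a i j * partial m (\<pi> j) x)"
        unfolding limit_flux_A[OF i x] grad[OF i x]
        by (simp add: sum_subtractf sum.distrib algebra_simps)
      finally show ?thesis by (simp add: gradient_def)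
    qed
    then show ?thesis unfolding vec_eq_iff by blast
  qed
  have temp: "temp (S0 i) x = temp Sn0 x + dt * (\<Sum>j\<in>{1..<i}. ta i j *
       (\<tau> * laplacian (temp (S0 j)) x - divergence (\<lambda>y. temp (S0 j) y *\<^sub>R vel (S0 j) y) x))"
    if i: "i \<in> {1..s}" and x: "x \<in> D" for i x
  proof -
    let ?R = "\<Sum>j\<in>{1..<i}. ta i j * (divergence (\<lambda>y. temp (S0 j) y *\<^sub>R vel (S0 j) y) x - \<tau> * laplacian (temp (S0 j)) x)"
    have "(\<Sum>j\<in>{1..i}. a i j / ?d * flux_B (S0 j) x) = (\<Sum>j\<in>{1..i}. a i j * flux_B (S0 j) x) / ?d"
      by (simp add: sum_divide_distrib)
    \<comment> \<open>The d + 2 from the heat flux, divided by the d of the scheme, is again 1 + 2 /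
      d, so the factor found in \<open>limit_temp\<close> cancels.\<close>
    then have eq: "(1 + 2 / ?d) * (temp (S0 i) x - temp Sn0 x) = (1 + 2 / ?d) * (- dt * ?R)"
      unfolding limit_temp[OF i x] limit_flux_B[OF i x] by (simp add: field_simps)
    have "1 + 2 / ?d \<noteq> 0"
      by (smt (verit) divide_nonneg_nonneg of_nat_0_le_iff)
    from mult_left_cancel[OF this, THEN iffD1, OF eq]
    have "temp (S0 i) x - temp Sn0 x = - dt * ?R" .
    then have "temp (S0 i) x = temp Sn0 x + dt * (- ?R)" by linarith
    also have "- ?R = (\<Sum>j\<in>{1..<i}. ta i j *
       (\<tau> * laplacian (temp (S0 j)) x - divergence (\<lambda>y. temp (S0 j) y *\<^sub>R vel (S0 j) y) x))"
      unfolding sum_negf[symmetric] by (intro sum.cong refl) (simp add: algebra_simps)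
    finally show ?thesis .
  qed
  have "\<forall>i\<in>{1..s}. \<pi> i differentiable_on D"
    by (intro ballI differentiable_onI_open[OF D] d\<pi>)
  moreover have "absorbed_pressure D s ta a (\<lambda>i. vel (S0 i)) q0 \<pi>"
    unfolding absorbed_pressure_def by (intro ballI abs)
  moreover have "ins_imex_stages D \<tau> dt s ta a (vel Sn0) (temp Sn0)
       (\<lambda>i. dens (S0 i)) (\<lambda>i. vel (S0 i)) (\<lambda>i. temp (S0 i)) \<pi>"
    unfolding ins_imex_stages_def by (intro ballI conjI limit_divergence_free press vel temp)
  ultimately show ?thesis by blast
qed

text \<open>A GSA method computes \<open>Snew\<close> by the very formulas that define its last stage.\<close>

lemma GSA_last_stage:
  assumes GSA: "globally_stiffly_accurate s ta tw a w" and \<epsilon>: "\<epsilon> \<in> {0<..<\<epsilon>0}" and x: "x \<in> D"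
  shows "dens (Snew \<epsilon>) x = dens (S \<epsilon> s) x" "vel (Snew \<epsilon>) x = vel (S \<epsilon> s) x"
    "temp (Snew \<epsilon>) x = temp (S \<epsilon> s) x" "micro (Snew \<epsilon>) x = micro (S \<epsilon> s) x"
proof -
  have s: "s \<in> {1..s}" using tableaux by (simp add: imex_tableaux_def)
  have w: "w j = a s j" if "j \<in> {1..s}" for j
    using GSA that by (simp add: globally_stiffly_accurate_def implicitly_stiffly_accurate_def)
  have im: "(\<Sum>j=1..s. F (w j) j) = (\<Sum>j=1..s. F (a s j) j)" for F :: "real \<Rightarrow> nat \<Rightarrow> 'z::real_vector"
    by (intro sum.cong refl) (simp only: w)
  \<comment> \<open>The update sums explicit weights up to s, the last stage only up to s - 1;
    \<open>tw s = 0\<close> bridges the difference.\<close>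
  have ex: "(\<Sum>j=1..s. tw j * f j) = (\<Sum>j\<in>{1..<s}. ta s j * f j)" for f
  proof -
    have tw: "tw s = 0" "\<And>j. j \<in> {1..<s} \<Longrightarrow> ta s j = tw j"
      using GSA by (auto simp: globally_stiffly_accurate_def)
    have "(\<Sum>j=1..s. tw j * f j) = (\<Sum>j\<in>{1..<s}. tw j * f j)"
      by (rule sum.mono_neutral_right) (use tw in \<open>auto simp: le_less\<close>)
    then show ?thesis using tw by simp
  qed
  have "micro_macro_row D \<tau> dt \<epsilon> {1..s} tw {1..s} w (Sn \<epsilon>) (S \<epsilon>) (Snew \<epsilon>)"
    using scheme[OF \<epsilon>] by (simp add: micro_macro_imex_def)
  note row = this[unfolded micro_macro_row_def, THEN bspec, OF x]
  note st = stage_row[OF \<epsilon> s x]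
  show "dens (Snew \<epsilon>) x = dens (S \<epsilon> s) x"
    using row[THEN conjunct1] unfolding im[of "\<lambda>c j. c * divergence (vel (S \<epsilon> j)) x"] st(1)[symmetric] .
  show "vel (Snew \<epsilon>) x = vel (S \<epsilon> s) x"
    using row[THEN conjunct2, THEN conjunct1]
    unfolding im[of "\<lambda>c j. c *\<^sub>R flux_A (S \<epsilon> j) x + (c / \<epsilon>) *\<^sub>R gradient (\<lambda>y. temp (S \<epsilon> j) y + dens (S \<epsilon> j) y) x"]
      st(2)[symmetric] .
  show "temp (Snew \<epsilon>) x = temp (S \<epsilon> s) x"
    using row[THEN conjunct2, THEN conjunct2, THEN conjunct1]
    unfolding im[of "\<lambda>c j. c / real CARD('d) * flux_B (S \<epsilon> j) x + 2 * c / (real CARD('d) * \<epsilon>) * divergence (vel (S \<epsilon> j)) x"]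
      st(3)[symmetric] .
  show "micro (Snew \<epsilon>) x = micro (S \<epsilon> s) x"
  proof
    fix v
    show "micro (Snew \<epsilon>) x v = micro (S \<epsilon> s) x v"
      using row[THEN conjunct2, THEN conjunct2, THEN conjunct2, THEN conjunct2, THEN spec, of v]
      unfolding ex im[of "\<lambda>c j. c * micro (S \<epsilon> j) x v"] st(4)[symmetric] .
  qed
qed

end

theorem theorem4p4:
  fixes D :: "(real^'d::finite) set"
    and \<tau> dt \<epsilon>0 :: real
    and s :: nat
    and ta a :: "nat \<Rightarrow> nat \<Rightarrow> real"
    and tw w :: "nat \<Rightarrow> real"
    and Sn Snew :: "real \<Rightarrow> 'd state"
    and S :: "real \<Rightarrow> nat \<Rightarrow> 'd state"
    and Sn0 :: "'d state"
    and S0 :: "nat \<Rightarrow> 'd state"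
    and qn0 :: "real^'d \<Rightarrow> real"
    and q0 :: "nat \<Rightarrow> real^'d \<Rightarrow> real"
  assumes dim: "CARD('d) \<in> {1, 2, 3}"
    and D: "open D"
    and \<tau>: "\<tau> > 0"
    and dt: "dt > 0"
    and \<epsilon>0: "\<epsilon>0 > 0"
    and tableaux: "imex_tableaux s ta a"
    and typeA: "type_A s a"
    and GSA: "globally_stiffly_accurate s ta tw a w"
    and admissible: "\<And>\<epsilon>. \<epsilon> \<in> {0<..<\<epsilon>0} \<Longrightarrow>
          admissible D (Sn \<epsilon>) \<and> (\<forall>i\<in>{1..s}. admissible D (S \<epsilon> i))"
    and scheme: "\<And>\<epsilon>. \<epsilon> \<in> {0<..<\<epsilon>0} \<Longrightarrow>
          micro_macro_imex D \<tau> dt \<epsilon> s ta tw a w (Sn \<epsilon>) (S \<epsilon>) (Snew \<epsilon>)"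
    and limit_n: "formal_limit D Sn Sn0 qn0"
    and limit_stages: "\<And>i. i \<in> {1..s} \<Longrightarrow> formal_limit D (\<lambda>\<epsilon>. S \<epsilon> i) (S0 i) (q0 i)"
    and smooth: "\<And>i. i \<in> {1..s} \<Longrightarrow> C2_on D (vel (S0 i)) \<and> C2_on D (temp (S0 i))"
  shows "(\<exists>\<pi>. (\<forall>i\<in>{1..s}. \<pi> i differentiable_on D) \<and>
            absorbed_pressure D s ta a (\<lambda>i. vel (S0 i)) q0 \<pi> \<and>
            ins_imex_stages D \<tau> dt s ta a (vel Sn0) (temp Sn0)
              (\<lambda>i. dens (S0 i)) (\<lambda>i. vel (S0 i)) (\<lambda>i. temp (S0 i)) \<pi>) \<and>
         (\<forall>\<epsilon>\<in>{0<..<\<epsilon>0}. \<forall>x\<in>D.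
            dens (Snew \<epsilon>) x = dens (S \<epsilon> s) x \<and> vel (Snew \<epsilon>) x = vel (S \<epsilon> s) x \<and>
            temp (Snew \<epsilon>) x = temp (S \<epsilon> s) x \<and> micro (Snew \<epsilon>) x = micro (S \<epsilon> s) x) \<and>
         (\<forall>x\<in>D. ((\<lambda>\<epsilon>. dens (Snew \<epsilon>) x) \<longlongrightarrow> dens (S0 s) x) (at_right 0) \<and>
                 ((\<lambda>\<epsilon>. vel (Snew \<epsilon>) x) \<longlongrightarrow> vel (S0 s) x) (at_right 0) \<and>
                 ((\<lambda>\<epsilon>. temp (Snew \<epsilon>) x) \<longlongrightarrow> temp (S0 s) x) (at_right 0))"
proof -
  interpret imex_fluid_limit D \<tau> dt \<epsilon>0 s ta a tw w Sn Snew S Sn0 S0 qn0 q0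
    by unfold_locales (fact D \<tau> dt \<epsilon>0 tableaux typeA admissible scheme limit_n limit_stages smooth)+
  have s: "s \<in> {1..s}" using tableaux by (simp add: imex_tableaux_def)
  note last = GSA_last_stage[OF GSA]
  \<comment> \<open>The new value agrees with stage s on D for all small \<epsilon>, so it inherits
    the limits of that stage.\<close>
  have ev: "\<forall>\<^sub>F \<epsilon> in at_right 0. dens (S \<epsilon> s) x = dens (Snew \<epsilon>) x"
    "\<forall>\<^sub>F \<epsilon> in at_right 0. vel (S \<epsilon> s) x = vel (Snew \<epsilon>) x"
    "\<forall>\<^sub>F \<epsilon> in at_right 0. temp (S \<epsilon> s) x = temp (Snew \<epsilon>) x" if "x \<in> D" for x
    using eventually_small by (eventually_elim, simp add: last that)+
  show ?thesis
    by (intro conjI ballI limit_stages_ins last Lim_transform_eventually[OF _ ev(1)]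
        Lim_transform_eventually[OF _ ev(2)] Lim_transform_eventually[OF _ ev(3)] stage_limit s)
qed

end
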